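(* Assume the following. 1. $X_n=G(Z_n)$, where $G:\mathbb{R}\to\mathbb{R}$ is measurable and $\{Z_n\}_{n\in\mathbb{Z}}$ is a stationary Gaussian process with $\mathbb{E}Z_n=0$, $\mathrm{Var}[Z_n]=1$, whose spectral density is $f(\lambda)=f_d(\lambda)f_0(\lambda)$ on $(-\pi,\pi]$, where $f_d(\lambda)=\frac{1}{2\pi}|1-e^{i\lambda}|^{-2d}$ with $0<d<1/2$, and $f_0$ is a spectral density with covariance function $\gamma_0(n)=\int_{-\pi}^{\pi}f_0(\lambda)e^{in\lambda}\,d\lambda$ satisfying (a) $\inf_{\lambda\in(-\pi,\pi]}f_0(\lambda)>0$, (b) $\sum_{n=-\infty}^\infty|\gamma_0(n)|<\infty$, and (c) $\gamma_0(n)=O(n^{-1})$ as $n\to\infty$. 2. $T_n(X_1,\dots,X_n;\theta)$ converges in distribution as $n\to\infty$ to a random variable $T$ with distribution function $F_T(x)=P(T\le x)$. 3. For any continuity point $x$ of $F_T$ and any $\epsilon>0$ and $\delta>0$, with probability tending to $1$ as $n\to\infty$, one has $$\widehat{F}^*_{n,b_n}(x-\epsilon)-\delta\le\widehat{F}_{n,b_n}(x)\le\widehat{F}^*_{n,b_n}(x+\epsilon)+\delta.$$ If $b_n\to\infty$ and $b_n=o(n)$ as $n\to\infty$, then the subsampling procedure is consistent: $$|F_{T_n}(x)-\widehat{F}_{n,b_n}(x)|\to0\quad\text{in probability as }n\to\infty$$ for every continuity point $x$ of $F_T$.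
   Context: $\{X_n\}$ is a stationary time series. $\theta$ is an unknown (fixed) parameter, possibly absent. For each $n$, $T_n(X_1,\dots,X_n;\theta)$ is a real-valued statistic (a measurable function of the observations, depending on $\theta$), and $F_{T_n}(x)=P(T_n(X_1,\dots,X_n;\theta)\le x)$ is its distribution function. $\widehat{\theta}_n$ is a consistent estimator of $\theta$ depending on the whole sample $X_1,\dots,X_n$. $b=b_n$ is a sequence of positive integers (the block, or subsample, size). Write $\mathbf{X}_i^{i+b-1}=(X_i,\dots,X_{i+b-1})$, and define $$\widehat{F}^*_{n,b}(x)=\frac{1}{n-b+1}\sum_{i=1}^{n-b+1}\mathrm{I}\{T_b(\mathbf{X}_i^{i+b-1};\theta)\le x\},\qquad \widehat{F}_{n,b}(x)=\frac{1}{n-b+1}\sum_{i=1}^{n-b+1}\mathrm{I}\{T_b(\mathbf{X}_i^{i+b-1};\widehat{\theta}_n)\le x\},$$ where $T_b(\cdot;\cdot)$ is the statistic with sample size $b$ and $\mathrm{I}$ denotes the indicator. A process $\{Z_n\}$ with covariance function $\gamma(n)=\mathrm{Cov}[Z_n,Z_0]$ has spectral density $f$ if $\gamma(n)=\int_{-\pi}^{\pi}f(\lambda)e^{in\lambda}\,d\lambda$. It is assumed throughout that the covariance matrix of $(Z_1,\dots,Z_b)$ is non-singular for every $b\ge1$. *)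

theory Defs
  imports
    "HOL-Probability.Probability"
    "HOL-Library.Landau_Symbols"
    "Jordan_Normal_Form.Matrix"
begin

definition covariance :: "'a measure \<Rightarrow> ('a \<Rightarrow> real) \<Rightarrow> ('a \<Rightarrow> real) \<Rightarrow> real" where
  "covariance M U V =
     (\<integral>\<omega>. (U \<omega> - prob_space.expectation M U) * (V \<omega> - prob_space.expectation M V) \<partial>M)"

(* Degenerate (constant) variables count as normal: a linear combination of jointly
   Gaussian variables may have variance zero. *)
definition normal_rv :: "'a measure \<Rightarrow> ('a \<Rightarrow> real) \<Rightarrow> bool" where
  "normal_rv M U \<longleftrightarrow> U \<in> borel_measurable M \<and>
     (\<exists>\<mu>. (AE \<omega> in M. U \<omega> = \<mu>) \<or> (\<exists>\<sigma>>0. distributed M lborel U (normal_density \<mu> \<sigma>)))"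

definition gaussian_process :: "'a measure \<Rightarrow> (int \<Rightarrow> 'a \<Rightarrow> real) \<Rightarrow> bool" where
  "gaussian_process M Z \<longleftrightarrow>
     (\<forall>I a. finite I \<longrightarrow> normal_rv M (\<lambda>\<omega>. \<Sum>i\<in>I. a i * Z i \<omega>))"

definition stationary_process :: "'a measure \<Rightarrow> (int \<Rightarrow> 'a \<Rightarrow> real) \<Rightarrow> bool" where
  "stationary_process M Z \<longleftrightarrow> (\<forall>n. Z n \<in> borel_measurable M) \<and>
     (\<forall>I h. finite I \<longrightarrow>
        distr M (\<Pi>\<^sub>M i\<in>I. borel) (\<lambda>\<omega>. \<lambda>i\<in>I. Z (i + h) \<omega>) =
        distr M (\<Pi>\<^sub>M i\<in>I. borel) (\<lambda>\<omega>. \<lambda>i\<in>I. Z i \<omega>))"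

definition is_spectral_density :: "(real \<Rightarrow> real) \<Rightarrow> (int \<Rightarrow> real) \<Rightarrow> bool" where
  "is_spectral_density f \<gamma> \<longleftrightarrow>
     (\<forall>l\<in>{-pi<..pi}. 0 \<le> f l) \<and> set_integrable lborel {-pi<..pi} f \<and>
     (\<forall>n. complex_of_real (\<gamma> n) =
        (LINT l:{-pi<..pi}|lborel. complex_of_real (f l) * exp (\<i> * of_int n * complex_of_real l)))"

(* At l = 0, where the density has its pole, this formula takes the value 0, because
   0 powr a = 0.  A single point affects no integral. *)
definition frac_density :: "real \<Rightarrow> real \<Rightarrow> real" where
  "frac_density d l = 1 / (2 * pi) * norm (1 - exp (\<i> * complex_of_real l)) powr (- 2 * d)"

(* The vector (X_i, ..., X_{i+m-1}), with components indexed by {1..m}, so that it is a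
   point of the product space over {1..m}; the whole sample (X_1, ..., X_n) is block X 1 n. *)
definition block :: "(int \<Rightarrow> 'a \<Rightarrow> real) \<Rightarrow> nat \<Rightarrow> nat \<Rightarrow> 'a \<Rightarrow> nat \<Rightarrow> real" where
  "block X i m \<omega> = (\<lambda>j\<in>{1..m}. X (int i + int j - 1) \<omega>)"

(* Subsampling distribution function with the parameter value t plugged into the statistic.
   It is meaningful for 1 \<le> m \<le> n only, because n - m is truncated subtraction. *)
definition subsample_cdf ::
  "(nat \<Rightarrow> (nat \<Rightarrow> real) \<Rightarrow> 'p \<Rightarrow> real) \<Rightarrow> (int \<Rightarrow> 'a \<Rightarrow> real) \<Rightarrow> nat \<Rightarrow> nat \<Rightarrow> 'p \<Rightarrow> real \<Rightarrow> 'a \<Rightarrow> real" where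
  "subsample_cdf T X n m t x \<omega> =
     (\<Sum>i=1..n - m + 1. of_bool (T m (block X i m \<omega>) t \<le> x)) / real (n - m + 1)"

definition tendsto_in_prob ::
  "'a measure \<Rightarrow> (nat \<Rightarrow> 'a \<Rightarrow> 'b::metric_space) \<Rightarrow> 'b \<Rightarrow> bool" where
  "tendsto_in_prob M Y c \<longleftrightarrow>
     (\<forall>\<epsilon>>0. (\<lambda>n. measure M {\<omega> \<in> space M. dist (Y n \<omega>) c > \<epsilon>}) \<longlonglongrightarrow> 0)"

end

theory Submission
  imports Defs
begin

text \<open>
  The variance of the empirical distribution function of the blocks is small as soon as two far-apart
  blocks are nearly uncorrelated.  For events depending on Gaussian blocks this follows from the
  corresponding statement for linear combinations (Gebelein's inequality).  For trigonometric
  polynomials \<open>\<Sum>i. c i * cis (W i)\<close> in Gaussian variables, covariances are given by the kernel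
  \<open>exp (E (W i * W j)) - 1\<close>, and Schur's product theorem applied term by term to the exponential
  series turns the linear bound into a bound for these; the sets whose indicators are limits of
  trigonometric polynomials in mean square form a sigma-algebra.

  For linear combinations, the density \<open>frac_density d\<close> is a mixture of Poisson kernels, that is, of
  spectral densities of autoregressions of order one with parameter \<open>r\<close> between 0 and 1.  For each of
  them the covariance of two blocks of length \<open>m\<close> at distance \<open>k\<close> carries a factor of about
  \<open>r ^ (k - m)\<close>, which is small unless \<open>1 - r\<close> is small compared with \<open>1 / m\<close>; but these
  autoregressions contribute only a small fraction of the variance of a block.  The factor \<open>f\<^sub>0\<close> is
  bounded below, and it enters the covariances as a convolution with an absolutely summable sequence.
\<close>

section \<open>Autoregressions of order one\<close>

text \<open>Bounding the cross-covariances of two blocks and the smallest eigenvalue of the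
  covariance matrix of one block separately is too weak: the covariances decay like
  \<open>k powr (2 * d - 1)\<close>, so \<open>m\<close> would have to be small against
  \<open>k powr (1 - 2 * d)\<close>, whereas \<open>b_n = o(n)\<close> calls for distances
  \<open>k\<close> that are a fixed multiple of \<open>m\<close>. Both quantities are therefore
  compared inside the same mixture. A fixed multiple works because the weight
  \<open>t powr (- 2 * d)\<close> near \<open>t = 0\<close>, with \<open>r = 1 - t\<close>, is a
  pure power: the part below \<open>y / m\<close> has the proportion
  \<open>y powr (1 - 2 * d)\<close> of the part below \<open>1 / m\<close>, whatever
  \<open>m\<close> is. The bounds have the form \<open>\<delta> * (variance + variance)\<close>
  instead of a product of standard deviations, since variances are linear in the spectral density
  and such a bound can be integrated over the mixture. In this form it also says that a certain
  block matrix is positive semidefinite, which is what Schur's theorem can work with.\<close>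

definition ar_quad :: "real \<Rightarrow> nat \<Rightarrow> (nat \<Rightarrow> real) \<Rightarrow> real" where
  "ar_quad r m a = (\<Sum>j<m. \<Sum>l<m. a j * a l * r ^ nat \<bar>int j - int l\<bar>)"

text \<open>In \<open>Y_j = r ^ j * Y_0 + (\<Sum>i=1..j. r ^ (j - i) * e_i)\<close> with
  uncorrelated innovations \<open>e_i\<close>, the combination \<open>\<Sum>j<m. a j * Y_j\<close>
  has \<open>ar_tail r m a i\<close> as the coefficient of \<open>e_i\<close>, and of
  \<open>Y_0\<close> for \<open>i = 0\<close>.\<close>

definition ar_tail :: "real \<Rightarrow> nat \<Rightarrow> (nat \<Rightarrow> real) \<Rightarrow> nat \<Rightarrow> real" where
  "ar_tail r m a i = (\<Sum>j=i..<m. a j * r ^ (j - i))"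

lemma ar_tail_Suc:
  assumes "i < m"
  shows "ar_tail r m a i = a i + r * ar_tail r m a (Suc i)"
proof -
  have "ar_tail r m a i = a i + (\<Sum>j=Suc i..<m. a j * r ^ (j - i))"
    unfolding ar_tail_def using assms by (subst sum.atLeast_Suc_lessThan) auto
  also have "(\<Sum>j=Suc i..<m. a j * r ^ (j - i)) = (\<Sum>j=Suc i..<m. r * (a j * r ^ (j - Suc i)))"
  proof (rule sum.cong)
    fix j assume "j \<in> {Suc i..<m}"
    then have "j - i = Suc (j - Suc i)" by auto
    then show "a j * r ^ (j - i) = r * (a j * r ^ (j - Suc i))" by simp
  qed simp
  finally show ?thesis by (simp add: ar_tail_def sum_distrib_left)
qed

lemma ar_tail_shift: "ar_tail r (Suc m) a (Suc i) = ar_tail r m (a \<circ> Suc) i"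
  unfolding ar_tail_def by (subst sum.shift_bounds_Suc_ivl) simp

lemma ar_quad_Suc:
  "ar_quad r (Suc m) a = (a 0)\<^sup>2 + 2 * a 0 * r * ar_tail r m (a \<circ> Suc) 0 + ar_quad r m (a \<circ> Suc)"
proof -
  have expo: "nat \<bar>int 0 - int (Suc l)\<bar> = Suc l" "nat \<bar>int (Suc l) - int 0\<bar> = Suc l"
    "\<bar>int (Suc j) - int (Suc l)\<bar> = \<bar>int j - int l\<bar>" for j l
    by auto
  have cross: "(\<Sum>l<m. a 0 * a (Suc l) * r ^ Suc l) = a 0 * r * ar_tail r m (a \<circ> Suc) 0"
    "(\<Sum>l<m. a (Suc l) * a 0 * r ^ Suc l) = a 0 * r * ar_tail r m (a \<circ> Suc) 0"
    unfolding ar_tail_def sum_distrib_left atLeast0LessThan by (auto intro!: sum.cong)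
  show ?thesis
    unfolding ar_quad_def sum.lessThan_Suc_shift expo sum.distrib cross
    by (simp add: power2_eq_square)
qed

text \<open>The variance computed from the innovations: \<open>Y_0\<close> has variance 1 and every
  \<open>e_i\<close> has variance \<open>1 - r\<^sup>2\<close>. Dropping the first coefficient
  shifts the tails by one, so induction over the length applies.\<close>

lemma ar_quad_eq:
  "ar_quad r m a = (ar_tail r m a 0)\<^sup>2 + (1 - r\<^sup>2) * (\<Sum>i=1..<m. (ar_tail r m a i)\<^sup>2)"
proof (induction m arbitrary: a)
  case 0
  then show ?case by (simp add: ar_quad_def ar_tail_def)
next
  case (Suc m)
  define t where "t = ar_tail r m (a \<circ> Suc)"
  have head: "ar_tail r (Suc m) a 0 = a 0 + r * t 0"
    by (subst ar_tail_Suc) (auto simp: ar_tail_shift t_def)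
  have "(\<Sum>i=1..<Suc m. (ar_tail r (Suc m) a i)\<^sup>2) = (\<Sum>i=0..<m. (t i)\<^sup>2)"
    unfolding One_nat_def t_def by (subst sum.shift_bounds_Suc_ivl) (simp add: ar_tail_shift)
  also have "\<dots> = (t 0)\<^sup>2 + (\<Sum>i=1..<m. (t i)\<^sup>2)"
    by (cases "m = 0") (auto simp: sum.atLeast_Suc_lessThan t_def ar_tail_def)
  finally have tl: "(\<Sum>i=1..<Suc m. (ar_tail r (Suc m) a i)\<^sup>2) = (t 0)\<^sup>2 + (\<Sum>i=1..<m. (t i)\<^sup>2)" .
  show ?case
    unfolding ar_quad_Suc Suc.IH head tl t_def[symmetric] by (simp add: power2_eq_square algebra_simps)
qed

lemma ar_quad_nonneg:
  assumes "0 \<le> r" "r \<le> 1"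
  shows "0 \<le> ar_quad r m a"
  using assms by (simp add: ar_quad_eq power_le_one sum_nonneg)

text \<open>An autoregression with \<open>1 - r \<le> 1/m\<close> is nearly constant on a block of length \<open>m\<close>.\<close>

lemma ar_quad_compare:
  assumes m: "m \<ge> 1" and r': "1 - 1 / real m \<le> r'" "r' \<le> r" and r: "r \<le> 1"
  shows "ar_quad r m a \<le> 10 * ar_quad r' m a"
proof -
  define s where "s = ar_tail r' m a"
  define S where "S = ar_tail r m a"
  define V where "V = ar_quad r' m a"
  define Q where "Q = (\<Sum>i=1..<m. (s i)\<^sup>2)"
  define L where "L = (\<Sum>i=1..<m. \<bar>s i\<bar>)"
  have r'0: "0 \<le> r'" using r'(1) m order_trans[of 0 "1 - 1 / real m" r'] by simp
  have r0: "0 \<le> r" using r' r'0 by simp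
  have Veq: "V = (s 0)\<^sup>2 + (1 - r'\<^sup>2) * Q"
    unfolding V_def s_def Q_def by (rule ar_quad_eq)
  have Q0: "0 \<le> Q" unfolding Q_def by (simp add: sum_nonneg)
  have r'1: "r' \<le> 1" using r' r by simp
  have sq': "1 - r' \<le> 1 - r'\<^sup>2" using r'0 r'1 by (simp add: power2_eq_square mult_left_le)
  have sq: "1 - r\<^sup>2 \<le> 1 - r'\<^sup>2" using r' r'0 by (simp add: power_mono)
  have sq0: "0 \<le> 1 - r\<^sup>2" using r0 r by (simp add: power_le_one)
  have V_ge1: "(s 0)\<^sup>2 \<le> V" and V_ge2: "(1 - r'\<^sup>2) * Q \<le> V"
    using Veq Q0 sq0 sq by (auto simp: mult_nonneg_nonneg)
  have LQ: "L\<^sup>2 \<le> real m * Q"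
  proof -
    have "L\<^sup>2 \<le> real (card {1..<m}) * (\<Sum>i=1..<m. \<bar>s i\<bar>\<^sup>2)"
      unfolding L_def using sum_squared_le_sum_of_squares[of "\<lambda>i. \<bar>s i\<bar>" "{1..<m}"] by (simp add: mult.commute)
    also have "\<dots> \<le> real m * Q"
      using Q0 by (simp add: Q_def mult_right_mono)
    finally show ?thesis .
  qed
  \<comment> \<open>Subtracting the recursions for \<open>r\<close> and \<open>r'\<close> leaves the
    previous error times \<open>r \<le> 1\<close> plus \<open>(r - r') * s (Suc i)\<close>, so the
    errors add up from the right end of the block.\<close>
  have diff: "\<bar>S i - s i\<bar> \<le> (r - r') * (\<Sum>j=Suc i..<m. \<bar>s j\<bar>)" if "i \<le> m" for i
    using that
  proof (induction rule: inc_induct)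
    case base
    then show ?case by (simp add: S_def s_def ar_tail_def)
  next
    case (step i)
    have "S i - s i = r * (S (Suc i) - s (Suc i)) + (r - r') * s (Suc i)"
      using step(2) by (simp add: S_def s_def ar_tail_Suc[of i] algebra_simps)
    then have "\<bar>S i - s i\<bar> \<le> r * \<bar>S (Suc i) - s (Suc i)\<bar> + (r - r') * \<bar>s (Suc i)\<bar>"
      using r0 r' abs_triangle_ineq[of "r * (S (Suc i) - s (Suc i))" "(r - r') * s (Suc i)"]
      by (simp add: abs_mult)
    also have "\<dots> \<le> \<bar>S (Suc i) - s (Suc i)\<bar> + (r - r') * \<bar>s (Suc i)\<bar>"
      using r r0 by (simp add: mult_left_le_one_le)
    also have "\<dots> \<le> (r - r') * (\<Sum>j=Suc (Suc i)..<m. \<bar>s j\<bar>) + (r - r') * \<bar>s (Suc i)\<bar>"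
      using step by simp
    also have "\<dots> = (r - r') * (\<Sum>j=Suc i..<m. \<bar>s j\<bar>)"
    proof (cases "Suc i < m")
      case True
      then show ?thesis by (simp add: sum.atLeast_Suc_lessThan[of "Suc i"] algebra_simps)
    next
      case False
      then have "s (Suc i) = 0" by (simp add: s_def ar_tail_def)
      then show ?thesis using False by simp
    qed
    finally show ?case .
  qed
  \<comment> \<open>Cauchy-Schwarz costs a factor \<open>m\<close>. One of the two factors
    \<open>1 - r' \<le> 1 / m\<close> pays for it; the other is at most
    \<open>1 - r'\<^sup>2\<close>, the weight of \<open>Q\<close> in \<open>V\<close>.\<close>
  have dsq: "(S i - s i)\<^sup>2 \<le> V" if "i < m" for i
  proof -
    have "(\<Sum>j=Suc i..<m. \<bar>s j\<bar>) \<le> L"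
      unfolding L_def by (rule sum_mono2) auto
    then have "(r - r') * (\<Sum>j=Suc i..<m. \<bar>s j\<bar>) \<le> (r - r') * L"
      using r' by (intro mult_left_mono) auto
    also have "\<dots> \<le> (1 - r') * L"
      using r by (intro mult_right_mono) (auto simp: L_def sum_nonneg)
    finally have "\<bar>S i - s i\<bar> \<le> (1 - r') * L"
      using diff[of i] that by simp
    then have "(S i - s i)\<^sup>2 \<le> ((1 - r') * L)\<^sup>2"
      by (metis abs_ge_zero power2_abs power_mono)
    also have "\<dots> \<le> (1 - r')\<^sup>2 * (real m * Q)"
      using LQ by (simp add: power_mult_distrib mult_left_mono)
    also have "\<dots> = ((1 - r') * real m) * ((1 - r') * Q)"
      by (simp add: power2_eq_square)
    also have "\<dots> \<le> 1 * ((1 - r') * Q)"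
    proof (rule mult_right_mono)
      have "1 - r' \<le> 1 / real m" using r' by simp
      then show "(1 - r') * real m \<le> 1" using m by (simp add: field_simps)
    qed (use r'1 Q0 in auto)
    also have "\<dots> \<le> (1 - r'\<^sup>2) * Q" using sq' Q0 by (simp add: mult_right_mono)
    finally show ?thesis using V_ge2 by simp
  qed
  have two: "(S i)\<^sup>2 \<le> 2 * (s i)\<^sup>2 + 2 * (S i - s i)\<^sup>2" for i
  proof -
    have "2 * (s i)\<^sup>2 + 2 * (S i - s i)\<^sup>2 - (S i)\<^sup>2 = (S i - 2 * s i)\<^sup>2"
      by (simp add: power2_eq_square algebra_simps)
    then show ?thesis by (smt (verit) zero_le_power2)
  qed
  \<comment> \<open>The constant 10 is 4 for the initial value plus 6 for the innovations:
    \<open>2 * V\<close> from the tails for \<open>r'\<close> and \<open>4 * V\<close> from the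
    errors, since \<open>(1 - r\<^sup>2) * m \<le> 2\<close>.\<close>
  have "(S 0)\<^sup>2 \<le> 4 * V"
    using two[of 0] dsq[of 0] V_ge1 m by simp
  moreover have "(1 - r\<^sup>2) * (\<Sum>i=1..<m. (S i)\<^sup>2) \<le> 6 * V"
  proof -
    have "(\<Sum>i=1..<m. (S i)\<^sup>2) \<le> (\<Sum>i=1..<m. 2 * (s i)\<^sup>2 + 2 * V)"
    proof (rule sum_mono)
      fix i assume "i \<in> {1..<m}"
      then show "(S i)\<^sup>2 \<le> 2 * (s i)\<^sup>2 + 2 * V" using two[of i] dsq[of i] by auto
    qed
    also have "\<dots> = 2 * Q + real (m - 1) * (2 * V)"
      by (simp add: Q_def sum.distrib sum_distrib_left)
    also have "\<dots> \<le> 2 * Q + real m * (2 * V)"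
      using ar_quad_nonneg[OF r'0 r'1, of m a] by (auto simp: V_def intro!: mult_right_mono)
    finally have "(1 - r\<^sup>2) * (\<Sum>i=1..<m. (S i)\<^sup>2) \<le> (1 - r\<^sup>2) * (2 * Q + real m * (2 * V))"
      using sq0 by (rule mult_left_mono)
    also have "\<dots> \<le> 2 * ((1 - r'\<^sup>2) * Q) + ((1 - r\<^sup>2) * real m) * (2 * V)"
      using mult_right_mono[OF sq Q0] by (simp add: algebra_simps)
    also have "\<dots> \<le> 2 * V + 2 * (2 * V)"
    proof (intro add_mono mult_right_mono)
      have "1 - r \<le> 1 / real m" using r' by simp
      then have "(1 - r) * real m \<le> 1" using m by (simp add: field_simps)
      moreover have "1 - r\<^sup>2 \<le> 2 * (1 - r)"
        using zero_le_power2[of "1 - r"] by (simp add: power2_eq_square algebra_simps)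
      ultimately show "(1 - r\<^sup>2) * real m \<le> 2"
        using mult_right_mono[of "1 - r\<^sup>2" "2 * (1 - r)" "real m"] by (simp add: algebra_simps)
    qed (use V_ge2 V_ge1 in \<open>auto intro: order_trans[OF zero_le_power2]\<close>)
    finally show ?thesis by simp
  qed
  ultimately have "ar_quad r m a \<le> 10 * V"
    using ar_quad_eq[of r m a] by (simp add: S_def)
  then show ?thesis by (simp add: V_def)
qed

section \<open>Poisson kernels\<close>

definition poisson :: "real \<Rightarrow> real \<Rightarrow> real" where
  "poisson r l = (1 - r\<^sup>2) / (1 - 2 * r * cos l + r\<^sup>2)"

lemma poisson_denom: "1 - 2 * (r::real) * cos l + r\<^sup>2 = (1 - r)\<^sup>2 + r * (2 - 2 * cos l)"
  by (simp add: power2_eq_square algebra_simps)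

lemma poisson_denom_pos:
  assumes "0 \<le> (r::real)" "r < 1"
  shows "0 < 1 - 2 * r * cos l + r\<^sup>2"
  unfolding poisson_denom using assms by (intro add_pos_nonneg mult_nonneg_nonneg) auto

lemma poisson_nonneg:
  assumes "0 \<le> r" "r < 1"
  shows "0 \<le> poisson r l"
  using poisson_denom_pos[OF assms, of l] assms unfolding poisson_def
  by (intro divide_nonneg_nonneg) (auto simp: power_le_one)

lemma poisson_le:
  assumes "0 \<le> r" "r < 1"
  shows "poisson r l \<le> 1 / (1 - r)\<^sup>2"
  unfolding poisson_def
proof (rule frac_le)
  show "(1 - r)\<^sup>2 \<le> 1 - 2 * r * cos l + r\<^sup>2"
    unfolding poisson_denom using assms by simp
qed (use assms in auto)

lemma borel_measurable_poisson [measurable]: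
  "(\<lambda>x. poisson (f x) (g x)) \<in> borel_measurable M"
  if [measurable]: "f \<in> borel_measurable M" "g \<in> borel_measurable M"
  unfolding poisson_def by measurable

text \<open>The kernel is \<open>1 + 2 * Re (z / (1 - z))\<close> for \<open>z = r * cis l\<close>,
  so its cosine series is the real part of a geometric series.\<close>

lemma poisson_sums:
  assumes r: "0 \<le> r" "r < 1"
  shows "(\<lambda>i. 2 * r ^ Suc i * cos (real (Suc i) * l)) sums (poisson r l - 1)"
proof -
  define z where "z = of_real r * cis l"
  have nz: "norm z < 1" using r by (simp add: z_def norm_mult)
  have "(\<lambda>i. z * z ^ i) sums (z * (1 / (1 - z)))"
    by (intro sums_mult geometric_sums nz)
  then have "(\<lambda>i. 2 * Re (z ^ Suc i)) sums (2 * Re (z / (1 - z)))"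
    by (intro sums_mult sums_Re) simp
  moreover have "Re (z ^ Suc i) = r ^ Suc i * cos (real (Suc i) * l)" for i
  proof -
    have "z ^ Suc i = of_real (r ^ Suc i) * cis (real (Suc i) * l)"
      using Complex.DeMoivre[of l "Suc i"] by (simp only: z_def power_mult_distrib of_real_power)
    then show ?thesis by (simp del: power_Suc of_nat_Suc)
  qed
  moreover have "2 * Re (z / (1 - z)) = poisson r l - 1"
  proof -
    have sq: "(sin l)\<^sup>2 = 1 - (cos l)\<^sup>2" by (simp add: sin_squared_eq)
    have den: "(1 - r * cos l)\<^sup>2 + (r * sin l)\<^sup>2 = 1 - 2 * r * cos l + r\<^sup>2"
      by (simp add: power2_diff power_mult_distrib sq) (simp add: algebra_simps)
    have gen: "r * c * (1 - r * c) - (r * s) * (r * s) = r * c - r\<^sup>2 * (c\<^sup>2 + s\<^sup>2)" for c s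
      by (simp add: power2_eq_square algebra_simps)
    have "Re (z / (1 - z)) = (r * cos l * (1 - r * cos l) - (r * sin l) * (r * sin l)) / ((1 - r * cos l)\<^sup>2 + (r * sin l)\<^sup>2)"
      by (simp add: z_def Re_divide)
    also have "r * cos l * (1 - r * cos l) - (r * sin l) * (r * sin l) = r * cos l - r\<^sup>2 * ((cos l)\<^sup>2 + (sin l)\<^sup>2)"
      using gen .
    finally have "Re (z / (1 - z)) = (r * cos l - r\<^sup>2) / (1 - 2 * r * cos l + r\<^sup>2)"
      by (simp add: den)
    then show ?thesis
      using poisson_denom_pos[OF r, of l] by (simp add: poisson_def field_simps)
  qed
  ultimately show ?thesis by (simp add: mult.assoc del: power_Suc of_nat_Suc)
qed

section \<open>Fourier coefficients on the circle and products with Poisson kernels\<close>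

abbreviation (input) circ :: "real set" where "circ \<equiv> {-pi<..pi}"

definition fourier_cos :: "(real \<Rightarrow> real) \<Rightarrow> int \<Rightarrow> real" where
  "fourier_cos g n = (LINT l:circ|lborel. g l * cos (of_int n * l))"

lemma set_integrable_mult_bounded:
  fixes g h :: "real \<Rightarrow> real"
  assumes g: "set_integrable lborel A g" and [measurable]: "h \<in> borel_measurable borel"
    and b: "\<And>x. x \<in> A \<Longrightarrow> \<bar>h x\<bar> \<le> B"
  shows "set_integrable lborel A (\<lambda>x. g x * h x)"
  unfolding set_integrable_def
proof (rule Bochner_Integration.integrable_bound)
  show "integrable lborel (\<lambda>x. B * (indicator A x *\<^sub>R g x))"
    using g unfolding set_integrable_def by simp
  have "(\<lambda>x. indicator A x *\<^sub>R g x * h x) \<in> borel_measurable lborel"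
    using g unfolding set_integrable_def by measurable
  then show "(\<lambda>x. indicator A x *\<^sub>R (g x * h x)) \<in> borel_measurable lborel"
    by (simp add: mult.assoc)
  show "AE x in lborel. norm (indicator A x *\<^sub>R (g x * h x)) \<le> norm (B * (indicator A x *\<^sub>R g x))"
  proof (rule AE_I2)
    fix x
    show "norm (indicator A x *\<^sub>R (g x * h x)) \<le> norm (B * (indicator A x *\<^sub>R g x))"
    proof (cases "x \<in> A")
      case True
      have "\<bar>g x\<bar> * \<bar>h x\<bar> \<le> \<bar>g x\<bar> * \<bar>B\<bar>"
        using b[OF True] by (intro mult_left_mono) auto
      then show ?thesis using True by (simp add: abs_mult mult.commute)
    qed simp
  qed
qed

lemma fourier_cos_uminus: "fourier_cos g (- n) = fourier_cos g n"
  unfolding fourier_cos_def by simp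

lemma fourier_cos_bounded:
  assumes g: "set_integrable lborel circ g"
  shows "\<bar>fourier_cos g n\<bar> \<le> (LINT l:circ|lborel. \<bar>g l\<bar>)"
proof -
  have i: "set_integrable lborel circ (\<lambda>l. g l * cos (of_int n * l))"
    using g by (rule set_integrable_mult_bounded[where B=1]) auto
  have "norm (fourier_cos g n) \<le> (LINT l:circ|lborel. norm (g l * cos (of_int n * l)))"
    unfolding fourier_cos_def by (rule set_integral_norm_bound[OF i])
  also have "\<dots> \<le> (LINT l:circ|lborel. \<bar>g l\<bar>)"
    by (intro set_integral_mono set_integrable_norm i set_integrable_abs g)
      (auto simp: abs_mult mult_left_le)
  finally show ?thesis by simp
qed

text \<open>The cosine series delivers the terms at \<open>n\<close> and \<open>- n\<close> in
  pairs; absolute summability of both halves turns the ordered sum of the pairs into an unordered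
  sum over the integers.\<close>

lemma has_sum_int:
  fixes F :: "int \<Rightarrow> real"
  assumes pos: "summable (\<lambda>i. \<bar>F (int (Suc i))\<bar>)" and neg: "summable (\<lambda>i. \<bar>F (- int (Suc i))\<bar>)"
    and S: "(\<lambda>i. F (int (Suc i)) + F (- int (Suc i))) sums S"
  shows "(F has_sum (F 0 + S)) UNIV"
proof -
  define P where "P = (\<Sum>i. F (int (Suc i)))"
  define N where "N = (\<Sum>i. F (- int (Suc i)))"
  have Ps: "(\<lambda>i. F (int (Suc i))) sums P"
    unfolding P_def by (rule summable_sums[OF summable_rabs_cancel[OF pos]])
  have Ns: "(\<lambda>i. F (- int (Suc i))) sums N"
    unfolding N_def by (rule summable_sums[OF summable_rabs_cancel[OF neg]])
  have "S = P + N" using sums_unique2[OF S sums_add[OF Ps Ns]] .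
  have "((\<lambda>i. F (int (Suc i))) has_sum P) UNIV"
    using pos Ps by (intro norm_summable_imp_has_sum) auto
  then have 1: "(F has_sum P) (range (\<lambda>i. int (Suc i)))"
    by (subst has_sum_reindex) (auto simp: inj_def o_def)
  have "((\<lambda>i. F (- int (Suc i))) has_sum N) UNIV"
    using neg Ns by (intro norm_summable_imp_has_sum) auto
  then have 2: "(F has_sum N) (range (\<lambda>i. - int (Suc i)))"
    by (subst has_sum_reindex) (auto simp: inj_def o_def)
  have 3: "(F has_sum (P + N)) (range (\<lambda>i. int (Suc i)) \<union> range (\<lambda>i. - int (Suc i)))"
    by (rule has_sum_Un_disjoint[OF 1 2]) auto
  have "(F has_sum (F 0 + (P + N))) ({0} \<union> (range (\<lambda>i. int (Suc i)) \<union> range (\<lambda>i. - int (Suc i))))"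
    by (rule has_sum_Un_disjoint[OF _ 3]) (auto simp: has_sum_finite_iff)
  moreover have "{0} \<union> (range (\<lambda>i. int (Suc i)) \<union> range (\<lambda>i. - int (Suc i))) = UNIV"
  proof -
    have "n \<in> {0} \<union> (range (\<lambda>i. int (Suc i)) \<union> range (\<lambda>i. - int (Suc i)))" for n :: int
    proof (cases n rule: int_cases3)
      case (pos k)
      then have "n = int (Suc (k - 1))" by simp
      then show ?thesis by blast
    next
      case (neg k)
      then have "n = - int (Suc (k - 1))" by simp
      then show ?thesis by blast
    qed simp
    then show ?thesis by (rule UNIV_eq_I[symmetric])
  qed
  ultimately show ?thesis using \<open>S = P + N\<close> by simp
qed

text \<open>Multiplying densities convolves covariances. The cosine series of the kernel is
  integrated term by term, dominated by the geometric factor \<open>r ^ Suc i\<close>.\<close>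

lemma has_sum_fourier_cos_poisson:
  assumes g: "set_integrable lborel circ g" and r: "0 \<le> r" "r < 1"
  shows "((\<lambda>h. fourier_cos g h * r ^ nat \<bar>n - h\<bar>) has_sum
      fourier_cos (\<lambda>l. g l * poisson r l) n) UNIV"
proof -
  let ?gh = "\<lambda>i l. g l * (cos (of_int n * l) * (2 * r ^ Suc i * cos (real (Suc i) * l)))"
  let ?f = "\<lambda>i l. indicator circ l *\<^sub>R ?gh i l"
  define G where "G = (LINT l:circ|lborel. \<bar>g l\<bar>)"
  define c where "c = fourier_cos g"
  define F where "F = (\<lambda>k. c (n + k) * r ^ nat \<bar>k\<bar>)"
  have cb: "\<bar>c k\<bar> \<le> G" for k
    unfolding c_def G_def by (rule fourier_cos_bounded[OF g])
  have geo: "summable (\<lambda>i. G * r ^ Suc i)"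
    using r by (intro summable_mult) (simp add: summable_geometric summable_mult)
  have cosint: "set_integrable lborel circ (\<lambda>l. ?gh i l)" for i
  proof (rule set_integrable_mult_bounded[OF g])
    fix l
    have "\<bar>cos (of_int n * l) * (2 * r ^ Suc i * cos (real (Suc i) * l))\<bar> \<le> 1 * (2 * 1 * 1)"
      unfolding abs_mult using r by (intro mult_mono) (auto simp: power_le_one simp del: power_Suc)
    then show "\<bar>cos (of_int n * l) * (2 * r ^ Suc i * cos (real (Suc i) * l))\<bar> \<le> 2" by simp
  qed measurable
  have termeq: "(LINT l:circ|lborel. ?gh i l)
      = F (int (Suc i)) + F (- int (Suc i))" for i
  proof -
    have i1: "set_integrable lborel circ (\<lambda>l. g l * cos (of_int k * l))" for k
      using g by (rule set_integrable_mult_bounded[where B=1]) auto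
    have eq: "?gh i l
      = r ^ Suc i * (g l * cos (of_int (n + int (Suc i)) * l)) + r ^ Suc i * (g l * cos (of_int (n - int (Suc i)) * l))" for l
    proof -
      have prod: "2 * (cos (of_int n * l) * cos (real (Suc i) * l)) = cos (of_int (n + int (Suc i)) * l) + cos (of_int (n - int (Suc i)) * l)"
        by (simp add: cos_times_cos algebra_simps)
      have "?gh i l
        = r ^ Suc i * (g l * (2 * (cos (of_int n * l) * cos (real (Suc i) * l))))"
        by (simp only: mult_ac)
      also have "\<dots> = r ^ Suc i * (g l * (cos (of_int (n + int (Suc i)) * l) + cos (of_int (n - int (Suc i)) * l)))"
        by (simp only: prod)
      finally show ?thesis by (simp only: distrib_left)
    qed
    have "(LINT l:circ|lborel. ?gh i l)
      = (LINT l:circ|lborel. r ^ Suc i * (g l * cos (of_int (n + int (Suc i)) * l)))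
        + (LINT l:circ|lborel. r ^ Suc i * (g l * cos (of_int (n - int (Suc i)) * l)))"
      unfolding eq by (intro set_integral_add(2) set_integrable_mult_right i1)
    then show ?thesis
      by (simp add: F_def c_def fourier_cos_def mult.commute del: power_Suc of_nat_Suc)
  qed
  have "(\<lambda>i. LINT l|lborel. ?f i l)
      sums (LINT l|lborel. (\<Sum>i. ?f i l))"
  proof (rule sums_integral)
    show "integrable lborel (\<lambda>l. ?f i l)" for i
      using cosint unfolding set_integrable_def .
    have bound: "norm (?f i l)
      \<le> (indicator circ l *\<^sub>R \<bar>g l\<bar>) * (2 * r ^ Suc i)" for l i
    proof -
      have "\<bar>cos (of_int n * l)\<bar> * (2 * r ^ Suc i * \<bar>cos (real (Suc i) * l)\<bar>) \<le> 1 * (2 * r ^ Suc i * 1)"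
        using r by (intro mult_mono) auto
      then have "\<bar>g l\<bar> * (\<bar>cos (of_int n * l)\<bar> * (2 * r ^ Suc i * \<bar>cos (real (Suc i) * l)\<bar>)) \<le> \<bar>g l\<bar> * (2 * r ^ Suc i)"
        by (intro mult_left_mono) auto
      then show ?thesis using r by (simp add: abs_mult indicator_def)
    qed
    show "AE l in lborel. summable (\<lambda>i. norm (?f i l))"
    proof (rule AE_I2)
      fix l
      have "summable (\<lambda>i. (indicator circ l *\<^sub>R \<bar>g l\<bar>) * (2 * r ^ Suc i))"
        using r by (intro summable_mult) (simp add: summable_geometric summable_mult)
      then show "summable (\<lambda>i. norm (?f i l))"
        by (rule summable_comparison_test'[where N=0]) (use bound in simp)
    qed
    have "summable (\<lambda>i. G * (2 * r ^ Suc i))"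
      using r by (intro summable_mult) (simp add: summable_geometric summable_mult)
    then show "summable (\<lambda>i. LINT l|lborel. norm (?f i l))"
    proof (rule summable_comparison_test'[where N=0])
      fix i
      have "(LINT l|lborel. norm (?f i l))
        \<le> (LINT l|lborel. (indicator circ l *\<^sub>R \<bar>g l\<bar>) * (2 * r ^ Suc i))"
        using bound cosint[of i] g unfolding set_integrable_def
        by (intro integral_mono integrable_norm integrable_mult_left) (auto dest: integrable_abs simp: abs_mult)
      also have "\<dots> = G * (2 * r ^ Suc i)"
        by (simp add: G_def set_lebesgue_integral_def)
      finally show "norm (LINT l|lborel. norm (?f i l)) \<le> G * (2 * r ^ Suc i)"
        by simp
    qed
  qed
  also have "(\<lambda>i. LINT l|lborel. ?f i l)
      = (\<lambda>i. F (int (Suc i)) + F (- int (Suc i)))"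
    using termeq unfolding set_lebesgue_integral_def by simp
  \<comment> \<open>The series omits the constant term 1 of the kernel. Its contribution
    \<open>c n\<close> is subtracted here and returns as the term \<open>F 0\<close> of
    \<open>has_sum_int\<close>.\<close>
  also have "(\<lambda>l. \<Sum>i. ?f i l)
      = (\<lambda>l. indicator circ l *\<^sub>R (g l * poisson r l * cos (of_int n * l) - g l * cos (of_int n * l)))"
  proof
    fix l
    have "(\<lambda>i. indicator circ l * ?gh i l)
      sums (indicator circ l * (g l * (cos (of_int n * l) * (poisson r l - 1))))"
      by (intro sums_mult poisson_sums r)
    then show "(\<Sum>i. ?f i l)
      = indicator circ l *\<^sub>R (g l * poisson r l * cos (of_int n * l) - g l * cos (of_int n * l))"
      by (simp add: sums_iff algebra_simps del: power_Suc)
  qed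
  also have "(LINT l|lborel. indicator circ l *\<^sub>R (g l * poisson r l * cos (of_int n * l) - g l * cos (of_int n * l)))
      = fourier_cos (\<lambda>l. g l * poisson r l) n - c n"
  proof -
    have "set_integrable lborel circ (\<lambda>l. g l * (poisson r l * cos (of_int n * l)))"
    proof (rule set_integrable_mult_bounded[OF g])
      fix l
      have "\<bar>poisson r l * cos (of_int n * l)\<bar> \<le> 1 / (1 - r)\<^sup>2 * 1"
        unfolding abs_mult using poisson_le[OF r, of l] poisson_nonneg[OF r, of l]
        by (intro mult_mono) auto
      then show "\<bar>poisson r l * cos (of_int n * l)\<bar> \<le> 1 / (1 - r)\<^sup>2" by simp
    qed measurable
    moreover have "set_integrable lborel circ (\<lambda>l. g l * cos (of_int n * l))"
      using g by (rule set_integrable_mult_bounded[where B=1]) auto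
    ultimately show ?thesis
      unfolding c_def fourier_cos_def by (subst set_integral_diff(2)[symmetric]) (auto simp: mult.assoc set_lebesgue_integral_def)
  qed
  finally have S: "(\<lambda>i. F (int (Suc i)) + F (- int (Suc i))) sums (fourier_cos (\<lambda>l. g l * poisson r l) n - c n)" .
  have sm: "summable (\<lambda>i. \<bar>F (int (Suc i))\<bar>)" "summable (\<lambda>i. \<bar>F (- int (Suc i))\<bar>)"
    using r cb by (auto simp: F_def abs_mult simp del: power_Suc of_nat_Suc
        intro!: summable_comparison_test'[OF geo, where N=0] mult_right_mono)
  have "(F has_sum (F 0 + (fourier_cos (\<lambda>l. g l * poisson r l) n - c n))) UNIV"
    by (rule has_sum_int[OF sm S])
  then have "(F has_sum fourier_cos (\<lambda>l. g l * poisson r l) n) UNIV"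
    by (simp add: F_def)
  then have "((\<lambda>h. F (h - n)) has_sum fourier_cos (\<lambda>l. g l * poisson r l) n) UNIV"
    by (subst has_sum_reindex_bij_betw[where f = F and g = "\<lambda>h. h - n" and A = UNIV and B = UNIV])
      (auto intro!: bij_betwI[where g = "\<lambda>k. k + n"])
  then show ?thesis
    by (simp add: F_def c_def abs_minus_commute)
qed

lemma fourier_cos_one: "fourier_cos (\<lambda>_. 1) h = (if h = 0 then 2 * pi else 0)"
proof (cases "h = 0")
  case True
  then show ?thesis by (simp add: fourier_cos_def set_lebesgue_integral_def)
next
  case False
  have "(LBINT l=-pi..pi. cos (of_int h * l)) = sin (of_int h * pi) / of_int h - sin (of_int h * (- pi)) / of_int h"
  proof (rule interval_integral_FTC_finite)
    show "continuous_on {min (- pi) pi..max (- pi) pi} (\<lambda>l. cos (of_int h * l))"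
      by (intro continuous_intros)
    show "((\<lambda>l. sin (of_int h * l) / of_int h) has_vector_derivative cos (of_int h * x)) (at x within {min (- pi) pi..max (- pi) pi})" for x
      using False by (auto intro!: derivative_eq_intros simp: has_real_derivative_iff_has_vector_derivative[symmetric])
  qed
  also have "\<dots> = 0"
    using sin_zero_iff_int2[of "of_int h * pi"] by auto
  finally show ?thesis
    using False by (simp add: fourier_cos_def interval_integral_Ioc)
qed

text \<open>The convolution for \<open>g = 1\<close>, whose only nonzero coefficient sits at
  0.\<close>

lemma fourier_cos_poisson:
  assumes r: "0 \<le> r" "r < 1"
  shows "fourier_cos (poisson r) n = 2 * pi * r ^ nat \<bar>n\<bar>"
proof -
  have "set_integrable lborel circ (\<lambda>_. 1::real)" by (simp add: set_integrable_def)
  from has_sum_fourier_cos_poisson[OF this r, of n]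
  have "((\<lambda>h. (if h = 0 then 2 * pi else 0) * r ^ nat \<bar>n - h\<bar>) has_sum fourier_cos (poisson r) n) UNIV"
    by (simp add: fourier_cos_one)
  moreover have "((\<lambda>h. (if h = 0 then 2 * pi else 0) * r ^ nat \<bar>n - h\<bar>) has_sum (2 * pi * r ^ nat \<bar>n\<bar>)) UNIV"
    by (subst has_sum_cong_neutral[where T = "{0}" and g = "\<lambda>h. 2 * pi * r ^ nat \<bar>n - h\<bar>"])
      (auto simp: has_sum_finite_iff)
  ultimately show ?thesis by (rule has_sum_unique)
qed

section \<open>The fractional density as a mixture\<close>

lemma set_integrable_lborel_nonneg:
  fixes f :: "real \<Rightarrow> real"
  assumes I: "(f has_integral I) S" and nonneg: "\<And>x. x \<in> S \<Longrightarrow> 0 \<le> f x"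
    and [measurable]: "f \<in> borel_measurable borel" "S \<in> sets borel"
  shows "set_integrable lborel S f" "(LINT x:S|lborel. f x) = I"
proof -
  have "f absolutely_integrable_on S"
    using I nonneg by (intro nonnegative_absolutely_integrable_1) (auto simp: has_integral_integrable)
  then show int: "set_integrable lborel S f"
    unfolding set_integrable_def by (subst (asm) integrable_completion) auto
  show "(LINT x:S|lborel. f x) = I"
    using set_borel_integral_eq_integral(2)[OF int] integral_unique[OF I] by simp
qed

text \<open>The parameter is \<open>t = 1 - r\<close>, so the unit root is at \<open>t = 0\<close>.
  The exponent \<open>- 2 * d\<close> there produces the pole of the fractional density; the
  exponent \<open>d - 1\<close> is what the substitution leading to \<open>mix_const\<close> leaves
  of the powers of \<open>1 - t\<close>.\<close>

definition mix_weight :: "real \<Rightarrow> real \<Rightarrow> real" where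
  "mix_weight d t = (1 - t) powr (d - 1) * t powr (- 2 * d)"

text \<open>A classical integral with the value \<open>pi / sin (pi * d)\<close>; the argument
  relies only on its being positive.\<close>

definition mix_const :: "real \<Rightarrow> real" where
  "mix_const d = (LINT u:{0<..}|lborel. u powr (- d) / (1 + u))"

lemma mix_weight_measurable [measurable]: "mix_weight d \<in> borel_measurable borel"
  unfolding mix_weight_def by measurable

lemma mix_weight_nonneg: "0 \<le> mix_weight d t"
  by (simp add: mix_weight_def)

text \<open>A Beta integral: both exponents \<open>d - 1\<close> and \<open>- 2 * d\<close> exceed
  -1 exactly when \<open>0 < d < 1 / 2\<close>.\<close>

lemma set_integrable_mix_weight:
  assumes d: "0 < d" "d < 1 / 2"
  shows "set_integrable lborel {0<..<1} (mix_weight d)"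
proof -
  have "((\<lambda>t. t powr ((1 - 2 * d) - 1) * (1 - t) powr (d - 1)) has_integral Beta (1 - 2 * d) d) {0..1}"
    using d by (intro has_integral_Beta_real) auto
  then have "((\<lambda>t. t powr ((1 - 2 * d) - 1) * (1 - t) powr (d - 1)) has_integral Beta (1 - 2 * d) d) {0<..<1}"
    by (simp add: has_integral_Icc_iff_Ioo)
  then have "(mix_weight d has_integral Beta (1 - 2 * d) d) {0<..<1}"
    unfolding mix_weight_def by (simp add: mult.commute)
  then show ?thesis
    by (rule set_integrable_lborel_nonneg(1)) (auto simp: mix_weight_nonneg)
qed

text \<open>Substitute \<open>u = t\<^sup>2 / ((1 - t) * (2 - 2 * cos l))\<close>.\<close>

lemma mixture_pointwise:
  assumes d: "0 < d" "d < 1 / 2" and l: "cos l \<noteq> 1"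
  shows "set_integrable lborel {0<..<1} (\<lambda>t. mix_weight d t * poisson (1 - t) l)"
    "(LINT t:{0<..<1}|lborel. mix_weight d t * poisson (1 - t) l) = mix_const d * (2 - 2 * cos l) powr (- d)"
proof -
  define s where "s = 2 - 2 * cos l"
  have s: "0 < s" using l cos_le_one[of l] by (simp add: s_def less_le)
  define g where "g = (\<lambda>t. t\<^sup>2 / ((1 - t) * s))"
  define g' where "g' = (\<lambda>t. t * (2 - t) / ((1 - t)\<^sup>2 * s))"
  define f where "f = (\<lambda>u::real. u powr (- d) / (1 + u))"
  have pois: "poisson (1 - t) l = t * (2 - t) / (t\<^sup>2 + (1 - t) * s)" for t
    unfolding poisson_def poisson_denom s_def by (simp add: power2_eq_square algebra_simps)
  have den_pos: "0 < t\<^sup>2 + (1 - t) * s" if "0 \<le> t" "t \<le> 1" for t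
  proof (cases "t = 1")
    case False
    then show ?thesis using that s by (intro add_nonneg_pos mult_pos_pos) auto
  qed simp
  have fg: "f (g t) * g' t = s powr d * (mix_weight d t * poisson (1 - t) l)" if t: "0 < t" "t < 1" for t
  proof -
    have "g t powr (- d) = t powr (- 2 * d) * ((1 - t) powr d * s powr d)"
    proof -
      have "g t powr (- d) = (t\<^sup>2) powr (- d) / ((1 - t) powr (- d) * s powr (- d))"
        using t s by (simp add: g_def powr_divide powr_mult)
      also have "(t\<^sup>2) powr (- d) = t powr (- 2 * d)"
        using t by (simp add: powr_powr flip: powr_numeral)
      finally show ?thesis by (simp add: powr_minus field_simps)
    qed
    moreover have "(1 - t) powr d = (1 - t) powr (d - 1) * (1 - t)"
      using t by (simp add: powr_diff)
    moreover have "1 + g t = (t\<^sup>2 + (1 - t) * s) / ((1 - t) * s)"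
      using t s by (simp add: g_def field_simps)
    ultimately have "f (g t) * g' t = s powr d * (1 - t) powr (d - 1) * t powr (- 2 * d)
        * ((1 - t) * (((1 - t) * s) / (t\<^sup>2 + (1 - t) * s)) * (t * (2 - t) / ((1 - t)\<^sup>2 * s)))"
      by (simp add: f_def g'_def)
    also have "(1 - t) * (((1 - t) * s) / (t\<^sup>2 + (1 - t) * s)) * (t * (2 - t) / ((1 - t)\<^sup>2 * s))
      = t * (2 - t) / (t\<^sup>2 + (1 - t) * s)"
      using t s by (simp add: power2_eq_square)
    finally show ?thesis by (simp add: mix_weight_def pois)
  qed
  \<comment> \<open>For fixed \<open>l\<close> the kernel is bounded in \<open>t\<close>:
    \<open>cos l \<noteq> 1\<close> makes \<open>s\<close> positive, so the denominator has no zero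
    on the compact unit interval.\<close>
  show int: "set_integrable lborel {0<..<1} (\<lambda>t. mix_weight d t * poisson (1 - t) l)"
  proof -
    have "continuous_on {0..1} (\<lambda>t. t * (2 - t) / (t\<^sup>2 + (1 - t) * s))"
      using den_pos by (intro continuous_intros) (metis atLeastAtMost_iff less_irrefl)
    then have "bounded ((\<lambda>t. t * (2 - t) / (t\<^sup>2 + (1 - t) * s)) ` {0..1})"
      by (intro compact_imp_bounded compact_continuous_image) auto
    then obtain B where "\<forall>x \<in> (\<lambda>t. t * (2 - t) / (t\<^sup>2 + (1 - t) * s)) ` {0..1}. norm x \<le> B"
      unfolding bounded_iff by blast
    then have "\<bar>poisson (1 - t) l\<bar> \<le> B" if "t \<in> {0<..<1}" for t
      using that unfolding pois by (auto simp del: abs_divide)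
    then show ?thesis
      by (intro set_integrable_mult_bounded[where B=B] set_integrable_mix_weight d) auto
  qed
  \<comment> \<open>\<open>g\<close> runs from 0 to infinity on the unit interval, so the left side
    is free of \<open>l\<close>; the dependence on \<open>l\<close> is the power of \<open>s\<close>
    pulled out in \<open>fg\<close>.\<close>
  have "(LBINT u=ereal 0..\<infinity>. f u) = (LBINT t=ereal 0..ereal 1. f (g t) * g' t)"
  proof (rule interval_integral_substitution_nonneg(2))
    fix t assume "ereal 0 < ereal t" "ereal t < ereal 1"
    then have t: "0 < t" "t < 1" by auto
    have gt: "0 < g t" using t s by (simp add: g_def)
    show "(g has_real_derivative g' t) (at t)"
    proof -
      have num: "2 * t * ((1 - t) * s) - t\<^sup>2 * (- s) = s * (t * (2 - t))"
        by (simp add: power2_eq_square algebra_simps)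
      have den: "((1 - t) * s) * ((1 - t) * s) = s * ((1 - t)\<^sup>2 * s)"
        by (simp add: power2_eq_square algebra_simps)
      have "((\<lambda>t. t\<^sup>2 / ((1 - t) * s)) has_real_derivative
          (2 * t * ((1 - t) * s) - t\<^sup>2 * (- s)) / (((1 - t) * s) * ((1 - t) * s))) (at t)"
        using t s by (auto intro!: derivative_eq_intros)
      then show ?thesis
        unfolding num den g_def g'_def using s by simp
    qed
    show "isCont f (g t)"
      unfolding f_def using gt by (intro continuous_intros) auto
    show "isCont g' t"
      unfolding g'_def using t s by (intro continuous_intros) auto
    show "0 \<le> f (g t)" using gt by (simp add: f_def)
  next
    fix t assume "ereal 0 \<le> ereal t" "ereal t \<le> ereal 1"
    then show "0 \<le> g' t" using s by (simp add: g'_def)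
  next
    have "(g \<longlongrightarrow> 0\<^sup>2 / ((1 - 0) * s)) (at_right 0)"
      unfolding g_def using s by (intro tendsto_intros) auto
    then show "((ereal \<circ> g \<circ> real_of_ereal) \<longlongrightarrow> ereal 0) (at_right (ereal 0))"
      unfolding ereal_tendsto_simps by simp
    have "filterlim g at_top (at_left 1)"
      unfolding g_def
    proof (rule LIM_at_top_divide)
      show "((\<lambda>t::real. t\<^sup>2) \<longlongrightarrow> 1\<^sup>2) (at_left 1)" by (intro tendsto_intros)
      have "((\<lambda>t. (1 - t) * s) \<longlongrightarrow> (1 - 1) * s) (at_left 1)" by (intro tendsto_intros)
      then show "((\<lambda>t. (1 - t) * s) \<longlongrightarrow> 0) (at_left 1)" by simp
      show "\<forall>\<^sub>F t in at_left 1. 0 < (1 - t) * s"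
        using s unfolding eventually_at_left_field by (auto intro!: exI[of _ 0])
    qed simp
    then show "((ereal \<circ> g \<circ> real_of_ereal) \<longlongrightarrow> \<infinity>) (at_left (ereal 1))"
      unfolding ereal_tendsto_simps .
    have "set_integrable lborel {0<..<1} (\<lambda>t. s powr d * (mix_weight d t * poisson (1 - t) l))"
      using int by (intro set_integrable_mult_right)
    also have "?this \<longleftrightarrow> set_integrable lborel {0<..<1} (\<lambda>t. f (g t) * g' t)"
      using fg by (intro set_integrable_cong) auto
    finally show "set_integrable lborel (einterval (ereal 0) (ereal 1)) (\<lambda>t. f (g t) * g' t)" by simp
  qed simp
  then have "mix_const d = (LINT t:{0<..<1}|lborel. f (g t) * g' t)"
    by (simp add: interval_lebesgue_integral_def mix_const_def f_def)
  also have "\<dots> = (LINT t:{0<..<1}|lborel. s powr d * (mix_weight d t * poisson (1 - t) l))"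
    by (rule set_lebesgue_integral_cong) (auto simp: fg)
  finally have "mix_const d = s powr d * (LINT t:{0<..<1}|lborel. mix_weight d t * poisson (1 - t) l)"
    by simp
  then show "(LINT t:{0<..<1}|lborel. mix_weight d t * poisson (1 - t) l) = mix_const d * (2 - 2 * cos l) powr (- d)"
    using s unfolding s_def[symmetric] by (simp add: powr_minus field_simps)
qed

text \<open>A divergent integral would be 0 by convention, so positivity is read off the mixture
  identity at \<open>l = pi\<close>, where the integrand is known to be integrable and is positive
  inside the unit interval.\<close>

lemma mix_const_pos:
  assumes d: "0 < d" "d < 1 / 2"
  shows "0 < mix_const d"
proof -
  note mix = mixture_pointwise[OF d, of pi]
  let ?h = "\<lambda>t. indicator {0<..<1} t *\<^sub>R (mix_weight d t * poisson (1 - t) pi)"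
  have int: "integrable lborel ?h" using mix(1) unfolding set_integrable_def by simp
  have nonneg: "0 \<le> ?h t" for t
    by (auto simp: indicator_def intro!: mult_nonneg_nonneg mix_weight_nonneg poisson_nonneg)
  have "(LINT t|lborel. ?h t) \<noteq> 0"
  proof
    assume "(LINT t|lborel. ?h t) = 0"
    then have "AE t in lborel. ?h t = 0"
      using integral_nonneg_eq_0_iff_AE[OF int] nonneg by simp
    moreover have "?h t \<noteq> 0" if "t \<in> {0<..<1}" for t
    proof -
      have "0 < poisson (1 - t) pi"
        unfolding poisson_def using that poisson_denom_pos[of "1 - t" pi]
        by (intro divide_pos_pos) (auto simp: power_less_one_iff abs_square_less_1)
      moreover have "0 < mix_weight d t" using that by (simp add: mix_weight_def)
      ultimately show ?thesis using that by simp
    qed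
    ultimately have "AE t in lborel. t \<notin> {0<..<1::real}" by (auto elim!: eventually_mono)
    then have "{0<..<1::real} \<in> null_sets lborel"
      by (intro AE_iff_null_sets[THEN iffD2]) auto
    then have "emeasure lborel {0<..<1::real} = 0" by (rule null_setsD1)
    then show False by (subst (asm) emeasure_lborel_Ioo) auto
  qed
  moreover have "0 \<le> (LINT t|lborel. ?h t)" using nonneg by (rule Bochner_Integration.integral_nonneg)
  ultimately have "0 < mix_const d * 4 powr (- d)"
    using mix(2) by (simp add: set_lebesgue_integral_def less_le)
  then show ?thesis by (simp add: zero_less_mult_iff)
qed

lemma frac_density_eq: "frac_density d l = 1 / (2 * pi) * (2 - 2 * cos l) powr (- d)"
proof -
  have "(cmod (1 - exp (\<i> * complex_of_real l)))\<^sup>2 = (1 - cos l)\<^sup>2 + (sin l)\<^sup>2"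
    unfolding cmod_power2 by (simp add: cis_conv_exp[symmetric])
  also have "\<dots> = 2 - 2 * cos l" by (simp add: power2_diff sin_squared_eq)
  finally have sq: "(cmod (1 - exp (\<i> * complex_of_real l)))\<^sup>2 = 2 - 2 * cos l" .
  have "x powr (- 2 * d) = (x\<^sup>2) powr (- d)" if "0 \<le> x" for x :: real
    using that by (cases "x = 0") (simp_all add: powr_powr flip: powr_numeral)
  then show ?thesis unfolding frac_density_def using sq by simp
qed

lemma cos_eq_1_circ: "l \<in> circ \<Longrightarrow> cos l = 1 \<Longrightarrow> l = 0"
proof -
  assume l: "l \<in> circ" "cos l = 1"
  have "\<bar>l\<bar> = 0"
  proof (rule ccontr)
    assume "\<bar>l\<bar> \<noteq> 0"
    then have "cos \<bar>l\<bar> < cos 0" using l(1) by (intro cos_monotone_0_pi) auto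
    then show False using l(2) by simp
  qed
  then show "l = 0" by simp
qed

abbreviation (input) "poisson_acf g r \<equiv> fourier_cos (\<lambda>l. g l * poisson r l)"

abbreviation (input) "frac_acf d g \<equiv> fourier_cos (\<lambda>l. frac_density d l * g l)"

text \<open>Fubini. Weight and kernel are nonnegative, so integrating the absolute value over
  \<open>t\<close> first gives back the absolute value of the density up to a constant; joint
  integrability thus reduces to the integrability of \<open>frac_density d l * f0 l\<close>. The
  factor \<open>2 * pi\<close> undoes the normalisation of \<open>frac_density\<close>.\<close>

lemma mixture_fourier:
  assumes d: "0 < d" "d < 1 / 2" and f0: "set_integrable lborel circ f0"
    and f: "set_integrable lborel circ (\<lambda>l. frac_density d l * f0 l)"
  shows "set_integrable lborel {0<..<1} (\<lambda>t. mix_weight d t * poisson_acf f0 (1 - t) n)"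
    "(LINT t:{0<..<1}|lborel. mix_weight d t * poisson_acf f0 (1 - t) n)
      = 2 * pi * mix_const d * frac_acf d f0 n"
proof -
  let ?D = "\<lambda>l. 2 * pi * mix_const d * (indicator circ l * (frac_density d l * f0 l * cos (of_int n * l)))"
  define G where "G = (\<lambda>l. indicator circ l * f0 l)"
  define w where "w = (\<lambda>t l. indicator {0<..<1} t * (mix_weight d t * poisson (1 - t) l))"
  define F where "F = (\<lambda>l t. G l * cos (of_int n * l) * w t l)"
  have [measurable]: "G \<in> borel_measurable borel"
    using f0 unfolding set_integrable_def G_def by simp
  have [measurable]: "(\<lambda>x. w (fst x) (snd x)) \<in> borel_measurable (borel \<Otimes>\<^sub>M borel)"
    unfolding w_def by measurable
  have Fm: "case_prod F \<in> borel_measurable (lborel \<Otimes>\<^sub>M lborel)"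
  proof -
    have "(\<lambda>x. indicator {0<..<1} (snd x) * (mix_weight d (snd x) * poisson (1 - snd x) (fst x)))
        \<in> borel_measurable (borel \<Otimes>\<^sub>M borel)" by measurable
    then have "(\<lambda>x. w (snd x) (fst x)) \<in> borel_measurable (lborel \<Otimes>\<^sub>M lborel)"
      unfolding w_def by simp
    then show ?thesis unfolding F_def split_beta' by measurable
  qed
  have wint: "integrable lborel (\<lambda>t. w t l)" "(LINT t|lborel. w t l) = mix_const d * (2 - 2 * cos l) powr (- d)"
    if "l \<in> circ" "l \<noteq> 0" for l
    using mixture_pointwise[OF d, of l] cos_eq_1_circ[of l] that
    unfolding w_def set_integrable_def set_lebesgue_integral_def by auto
  have wnn: "0 \<le> w t l" for t l
    unfolding w_def by (auto simp: indicator_def intro!: mult_nonneg_nonneg mix_weight_nonneg poisson_nonneg)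
  \<comment> \<open>\<open>mixture_pointwise\<close> requires \<open>cos l \<noteq> 1\<close>, which
    on the circle excludes only the pole \<open>l = 0\<close>.\<close>
  have AE0: "AE l in lborel. l \<noteq> (0::real)" by (rule AE_lborel_singleton)
  have inner: "(LINT t|lborel. F l t) = ?D l"
    "(LINT t|lborel. norm (F l t)) = norm (?D l)"
    "integrable lborel (F l)" if "l \<noteq> 0" for l
  proof -
    show "(LINT t|lborel. F l t) = ?D l"
      using wint[of l] that by (cases "l \<in> circ") (auto simp: F_def G_def frac_density_eq)
    show "(LINT t|lborel. norm (F l t)) = norm (?D l)"
      using wint[of l] that mix_const_pos[OF d] wnn
      by (cases "l \<in> circ") (auto simp: F_def G_def frac_density_eq abs_mult)
    show "integrable lborel (F l)"
      using wint[of l] that by (cases "l \<in> circ") (auto simp: F_def G_def)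
  qed
  have fcos: "set_integrable lborel circ (\<lambda>l. frac_density d l * f0 l * cos (of_int n * l))"
    using f by (rule set_integrable_mult_bounded[where B=1]) auto
  have Fint: "integrable (lborel \<Otimes>\<^sub>M lborel) (case_prod F)"
  proof (rule lborel_pair.Fubini_integrable[OF Fm])
    have "integrable lborel (\<lambda>l. norm (?D l))"
      using fcos unfolding set_integrable_def by (intro integrable_norm integrable_mult_right) simp
    moreover have "(\<lambda>l. LINT t|lborel. norm (F l t)) \<in> borel_measurable lborel"
    proof -
      have "(\<lambda>l. LINT t|lborel. norm (case_prod F (l, t))) \<in> borel_measurable lborel"
        using Fm by measurable
      then show ?thesis by simp
    qed
    moreover have "AE l in lborel. norm (?D l)
        = (LINT t|lborel. norm (F l t))"
      using AE0 by eventually_elim (rule inner(2)[symmetric])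
    ultimately show "integrable lborel (\<lambda>l. LINT t|lborel. norm (case_prod F (l, t)))"
      by (simp add: integrable_cong_AE_imp)
    show "AE l in lborel. integrable lborel (\<lambda>t. case_prod F (l, t))"
      using AE0 by eventually_elim (simp add: inner(3))
  qed
  have outer: "(LINT l|lborel. F l t) = indicator {0<..<1} t *\<^sub>R (mix_weight d t * poisson_acf f0 (1 - t) n)" for t
  proof -
    have "(LINT l|lborel. F l t) = (LINT l|lborel. (indicator {0<..<1} t * mix_weight d t) * (indicator circ l * (f0 l * poisson (1 - t) l * cos (of_int n * l))))"
      by (rule Bochner_Integration.integral_cong) (auto simp: F_def G_def w_def)
    also have "\<dots> = (indicator {0<..<1} t * mix_weight d t) * poisson_acf f0 (1 - t) n"
      by (simp add: fourier_cos_def set_lebesgue_integral_def)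
    finally show ?thesis by simp
  qed
  show "set_integrable lborel {0<..<1} (\<lambda>t. mix_weight d t * poisson_acf f0 (1 - t) n)"
    using lborel_pair.integrable_snd[OF Fint] unfolding set_integrable_def outer .
  have "(LINT t:{0<..<1}|lborel. mix_weight d t * poisson_acf f0 (1 - t) n)
    = (LINT t|lborel. LINT l|lborel. F l t)"
    unfolding outer set_lebesgue_integral_def ..
  also have "\<dots> = (LINT l|lborel. LINT t|lborel. F l t)"
    by (rule lborel_pair.Fubini_integral[OF Fint])
  also have "\<dots> = (LINT l|lborel. ?D l)"
  proof (rule integral_cong_AE)
    show "(\<lambda>l. LINT t|lborel. F l t) \<in> borel_measurable lborel"
      using lborel_pair.integrable_fst[OF Fint] by simp
    show "(\<lambda>l. ?D l) \<in> borel_measurable lborel"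
      using fcos unfolding set_integrable_def by (auto dest: borel_measurable_integrable)
    show "AE l in lborel. (LINT t|lborel. F l t) = ?D l"
      using AE0 by eventually_elim (rule inner(1))
  qed
  also have "\<dots> = 2 * pi * mix_const d * frac_acf d f0 n"
    by (simp add: fourier_cos_def set_lebesgue_integral_def)
  finally show "(LINT t:{0<..<1}|lborel. mix_weight d t * poisson_acf f0 (1 - t) n)
      = 2 * pi * mix_const d * frac_acf d f0 n" .
qed

section \<open>Covariances of distant blocks\<close>

definition ar_cross :: "real \<Rightarrow> int \<Rightarrow> nat \<Rightarrow> (nat \<Rightarrow> real) \<Rightarrow> (nat \<Rightarrow> real) \<Rightarrow> real" where
  "ar_cross r q m a b = (\<Sum>j<m. \<Sum>l<m. a j * b l * r ^ nat \<bar>q + int l - int j\<bar>)"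

text \<open>The covariance of \<open>\<Sum>j<m. a j * Y j\<close> and
  \<open>\<Sum>l<m. b l * Y (q + l)\<close> for a stationary process with covariance function
  \<open>\<gamma>\<close>. Thus \<open>q\<close> is the distance of the starting points of the two
  blocks, not the gap between them.\<close>

definition toeplitz_form :: "(int \<Rightarrow> real) \<Rightarrow> int \<Rightarrow> nat \<Rightarrow> (nat \<Rightarrow> real) \<Rightarrow> (nat \<Rightarrow> real) \<Rightarrow> real" where
  "toeplitz_form \<gamma> q m a b = (\<Sum>j<m. \<Sum>l<m. a j * b l * \<gamma> (q + int l - int j))"

lemma toeplitz_form_ar: "toeplitz_form (\<lambda>n. r ^ nat \<bar>n\<bar>) q m a b = ar_cross r q m a b"
  by (simp add: toeplitz_form_def ar_cross_def)

lemma ar_cross_self: "ar_cross r 0 m a a = ar_quad r m a"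
  unfolding ar_cross_def ar_quad_def by (simp add: abs_minus_commute)

definition dirichlet_sum :: "nat \<Rightarrow> (nat \<Rightarrow> real) \<Rightarrow> real \<Rightarrow> complex" where
  "dirichlet_sum m a x = (\<Sum>j<m. of_real (a j) * cis (real j * x))"

abbreviation (input) "cos_form x \<equiv> toeplitz_form (\<lambda>n. cos (of_int n * x))"

text \<open>At a single frequency the form factors into two sums, one for each block; for
  \<open>q = 0\<close> and \<open>a = b\<close> it is a squared modulus. Quadratic forms can then be
  compared by comparing spectral densities pointwise.\<close>

lemma toeplitz_form_cos:
  "cos_form x q m a b
    = Re (cis (of_int q * x) * (cnj (dirichlet_sum m a x) * dirichlet_sum m b x))"
proof -
  have "cis (of_int q * x) * (cnj (dirichlet_sum m a x) * dirichlet_sum m b x)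
    = (\<Sum>j<m. \<Sum>l<m. of_real (a j * b l) * (cis (of_int q * x) * (cis (- (real j * x)) * cis (real l * x))))"
    unfolding dirichlet_sum_def by (simp add: sum_product sum_distrib_left cis_cnj mult_ac)
  also have "\<dots> = (\<Sum>j<m. \<Sum>l<m. of_real (a j * b l) * cis (of_int (q + int l - int j) * x))"
    by (simp add: cis_mult algebra_simps)
  finally show ?thesis by (simp add: toeplitz_form_def)
qed

lemma toeplitz_form_cos_self:
  "cos_form x 0 m a a = (cmod (dirichlet_sum m a x))\<^sup>2"
  unfolding toeplitz_form_cos cmod_power2 by (simp add: power2_eq_square)

lemma abs_toeplitz_form_cos_le:
  "\<bar>cos_form x q m a b\<bar>
    \<le> (cos_form x 0 m a a + cos_form x 0 m b b) / 2"
proof -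
  have "\<bar>cos_form x q m a b\<bar>
      \<le> cmod (cis (of_int q * x) * (cnj (dirichlet_sum m a x) * dirichlet_sum m b x))"
    unfolding toeplitz_form_cos by (rule abs_Re_le_cmod)
  also have "\<dots> = cmod (dirichlet_sum m a x) * cmod (dirichlet_sum m b x)"
    by (simp add: norm_mult)
  also have "\<dots> \<le> ((cmod (dirichlet_sum m a x))\<^sup>2 + (cmod (dirichlet_sum m b x))\<^sup>2) / 2"
    using sum_squares_bound[of "cmod (dirichlet_sum m a x)" "cmod (dirichlet_sum m b x)"] by simp
  finally show ?thesis by (simp add: toeplitz_form_cos_self)
qed

lemma toeplitz_form_measurable [measurable]:
  "(\<lambda>x. cos_form x q m a b) \<in> borel_measurable borel"
  unfolding toeplitz_form_def by measurable

lemma toeplitz_form_cos_bounded: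
  "\<bar>cos_form x q m a b\<bar> \<le> (\<Sum>j<m. \<Sum>l<m. \<bar>a j * b l\<bar>)"
  unfolding toeplitz_form_def
  by (intro order_trans[OF sum_abs] sum_mono) (auto simp: abs_mult mult_left_le)

lemma toeplitz_form_fourier:
  assumes g: "set_integrable lborel circ g"
  shows "set_integrable lborel circ (\<lambda>x. g x * cos_form x q m a b)"
    "toeplitz_form (fourier_cos g) q m a b = (LINT x:circ|lborel. g x * cos_form x q m a b)"
proof -
  show "set_integrable lborel circ (\<lambda>x. g x * cos_form x q m a b)"
    by (rule set_integrable_mult_bounded[OF g]) (use toeplitz_form_cos_bounded in auto)
  have int: "integrable lborel (\<lambda>x. indicator circ x * (g x * cos (of_int n * x)))" for n
    using set_integrable_mult_bounded[OF g, of "\<lambda>x. cos (of_int n * x)" 1] by (simp add: set_integrable_def)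
  have "toeplitz_form (fourier_cos g) q m a b
    = (\<Sum>j<m. \<Sum>l<m. LINT x|lborel. a j * b l * (indicator circ x * (g x * cos (of_int (q + int l - int j) * x))))"
    unfolding toeplitz_form_def fourier_cos_def set_lebesgue_integral_def by simp
  also have "\<dots> = (\<Sum>j<m. LINT x|lborel. (\<Sum>l<m. a j * b l * (indicator circ x * (g x * cos (of_int (q + int l - int j) * x)))))"
    by (intro sum.cong refl Bochner_Integration.integral_sum[symmetric] integrable_mult_right int)
  also have "\<dots> = (LINT x|lborel. (\<Sum>j<m. \<Sum>l<m. a j * b l * (indicator circ x * (g x * cos (of_int (q + int l - int j) * x)))))"
    by (intro Bochner_Integration.integral_sum[symmetric] Bochner_Integration.integrable_sum integrable_mult_right int)
  also have "\<dots> = (LINT x:circ|lborel. g x * cos_form x q m a b)"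
    unfolding toeplitz_form_def set_lebesgue_integral_def
    by (simp add: sum_distrib_left mult_ac)
  finally show "toeplitz_form (fourier_cos g) q m a b
    = (LINT x:circ|lborel. g x * cos_form x q m a b)" .
qed

lemma set_integrable_poisson:
  assumes "0 \<le> r" "r < 1"
  shows "set_integrable lborel circ (poisson r)"
proof -
  have "set_integrable lborel circ (\<lambda>l. 1 * poisson r l)"
    using poisson_le[OF assms] poisson_nonneg[OF assms]
    by (intro set_integrable_mult_bounded[where B = "1 / (1 - r)\<^sup>2"]) (auto simp: set_integrable_def)
  then show ?thesis by simp
qed

lemma set_integrable_mult_poisson:
  assumes "set_integrable lborel circ g" "0 \<le> r" "r < 1"
  shows "set_integrable lborel circ (\<lambda>l. g l * poisson r l)"
  using poisson_le[OF assms(2,3)] poisson_nonneg[OF assms(2,3)]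
  by (intro set_integrable_mult_bounded[where B = "1 / (1 - r)\<^sup>2"] assms) auto

lemma toeplitz_form_scale: "toeplitz_form (\<lambda>n. c * \<gamma> n) q m a b = c * toeplitz_form \<gamma> q m a b"
  unfolding toeplitz_form_def by (simp add: sum_distrib_left mult_ac)

lemma ar_cross_integral:
  assumes r: "0 \<le> r" "r < 1"
  shows "2 * pi * ar_cross r q m a b = (LINT x:circ|lborel. poisson r x * cos_form x q m a b)"
  using toeplitz_form_fourier(2)[OF set_integrable_poisson[OF r], of q m a b]
  unfolding fourier_cos_poisson[OF r, abs_def] toeplitz_form_scale toeplitz_form_ar by simp

text \<open>The inequality between the geometric and the arithmetic mean holds at each frequency,
  and integration against the nonnegative Poisson kernel preserves it.\<close>

lemma ar_cross_le:
  assumes r: "0 \<le> r" "r < 1"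
  shows "\<bar>ar_cross r q m a b\<bar> \<le> (ar_quad r m a + ar_quad r m b) / 2"
proof -
  let ?T = "\<lambda>q a b x. cos_form x q m a b"
  note int = toeplitz_form_fourier(1)[OF set_integrable_poisson[OF r]]
  have "\<bar>2 * pi * ar_cross r q m a b\<bar> \<le> (LINT x:circ|lborel. norm (poisson r x * ?T q a b x))"
    unfolding ar_cross_integral[OF r] using set_integral_norm_bound[OF int] by simp
  also have "\<dots> \<le> (LINT x:circ|lborel. 1 / 2 * (poisson r x * ?T 0 a a x + poisson r x * ?T 0 b b x))"
  proof (rule set_integral_mono)
    show "set_integrable lborel circ (\<lambda>x. norm (poisson r x * ?T q a b x))"
      by (rule set_integrable_norm[OF int])
    show "set_integrable lborel circ (\<lambda>x. 1 / 2 * (poisson r x * ?T 0 a a x + poisson r x * ?T 0 b b x))"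
      by (intro set_integrable_mult_right set_integral_add int)
    fix x
    have "norm (poisson r x * ?T q a b x) = poisson r x * \<bar>?T q a b x\<bar>"
      using poisson_nonneg[OF r] by (simp add: abs_mult)
    also have "\<dots> \<le> poisson r x * ((?T 0 a a x + ?T 0 b b x) / 2)"
      by (intro mult_left_mono abs_toeplitz_form_cos_le poisson_nonneg r)
    finally show "norm (poisson r x * ?T q a b x) \<le> 1 / 2 * (poisson r x * ?T 0 a a x + poisson r x * ?T 0 b b x)"
      by (simp add: algebra_simps)
  qed
  also have "\<dots> = 2 * pi * ((ar_quad r m a + ar_quad r m b) / 2)"
    using int ar_cross_integral[OF r, of 0 m a a] ar_cross_integral[OF r, of 0 m b b]
    by (simp add: set_integral_add ar_cross_self[symmetric] algebra_simps)
  finally show ?thesis by (simp add: abs_mult)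
qed

text \<open>Once the second block starts after the end of the first, every lag is positive and the
  absolute value disappears, so moving it \<open>p\<close> steps further multiplies each covariance
  by the same \<open>r ^ p\<close>.\<close>

lemma ar_cross_shift: "ar_cross r (int m + int p) m a b = r ^ p * ar_cross r (int m) m a b"
proof -
  have "nat \<bar>int m + int p + int l - int j\<bar> = p + nat \<bar>int m + int l - int j\<bar>" if "j < m" for j l
    using that by auto
  then show ?thesis
    unfolding ar_cross_def by (auto simp: sum_distrib_left power_add mult_ac intro!: sum.cong)
qed

lemma ar_cross_far_le:
  assumes r: "0 \<le> r" "r < 1" and q: "int m + int p \<le> q"
  shows "\<bar>ar_cross r q m a b\<bar> \<le> r ^ p * ((ar_quad r m a + ar_quad r m b) / 2)"
proof -
  define p' where "p' = nat (q - int m)"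
  have q': "q = int m + int p'" and p': "p \<le> p'" using q by (auto simp: p'_def)
  have "\<bar>ar_cross r q m a b\<bar> = r ^ p' * \<bar>ar_cross r (int m) m a b\<bar>"
    unfolding q' ar_cross_shift using r by (simp add: abs_mult)
  also have "\<dots> \<le> r ^ p * ((ar_quad r m a + ar_quad r m b) / 2)"
    using r p' by (intro mult_mono ar_cross_le power_decreasing) auto
  finally show ?thesis .
qed

text \<open>The pointwise bound \<open>c \<le> f0\<close> survives multiplication by two nonnegative
  factors, the Poisson kernel and the squared modulus of \<open>dirichlet_sum\<close>.\<close>

lemma ar_quad_le_toeplitz_form:
  assumes r: "0 \<le> r" "r < 1" and f0: "set_integrable lborel circ f0" and c: "\<And>l. l \<in> circ \<Longrightarrow> c \<le> f0 l"
  shows "2 * pi * c * ar_quad r m a \<le> toeplitz_form (poisson_acf f0 r) 0 m a a"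
proof -
  let ?T = "\<lambda>x. cos_form x 0 m a a"
  have "2 * pi * c * ar_quad r m a = c * (LINT x:circ|lborel. poisson r x * ?T x)"
    using ar_cross_integral[OF r, of 0 m a a] by (simp add: ar_cross_self)
  also have "\<dots> = (LINT x:circ|lborel. c * (poisson r x * ?T x))" by simp
  also have "\<dots> \<le> (LINT x:circ|lborel. f0 x * poisson r x * ?T x)"
  proof (rule set_integral_mono)
    show "set_integrable lborel circ (\<lambda>x. c * (poisson r x * ?T x))"
      by (intro set_integrable_mult_right toeplitz_form_fourier(1) set_integrable_poisson r)
    show "set_integrable lborel circ (\<lambda>x. f0 x * poisson r x * ?T x)"
      by (intro toeplitz_form_fourier(1) set_integrable_mult_poisson f0 r)
    fix x assume "x \<in> circ"
    then show "c * (poisson r x * ?T x) \<le> f0 x * poisson r x * ?T x"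
      unfolding mult.assoc using poisson_nonneg[OF r, of x]
      by (intro mult_right_mono c mult_nonneg_nonneg) (auto simp: toeplitz_form_cos_self)
  qed
  also have "\<dots> = toeplitz_form (poisson_acf f0 r) 0 m a a"
    by (intro toeplitz_form_fourier(2)[symmetric] set_integrable_mult_poisson f0 r)
  finally show ?thesis .
qed

lemma has_sum_finite_sum:
  fixes f :: "'i \<Rightarrow> 'j \<Rightarrow> real"
  assumes "finite I" "\<And>i. i \<in> I \<Longrightarrow> (f i has_sum s i) A"
  shows "((\<lambda>x. \<Sum>i\<in>I. f i x) has_sum (\<Sum>i\<in>I. s i)) A"
  using assms by (induction rule: finite_induct) (auto intro!: has_sum_add)

lemma has_sum_toeplitz_form:
  assumes "\<And>n. ((\<lambda>h. c h * \<gamma> (n - h)) has_sum \<gamma>' n) A"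
  shows "((\<lambda>h. c h * toeplitz_form \<gamma> (q - h) m a b) has_sum toeplitz_form \<gamma>' q m a b) A"
proof -
  have "((\<lambda>h. \<Sum>j<m. \<Sum>l<m. a j * b l * (c h * \<gamma> (q + int l - int j - h))) has_sum toeplitz_form \<gamma>' q m a b) A"
    unfolding toeplitz_form_def by (intro has_sum_finite_sum has_sum_cmult_right assms finite_lessThan)
  moreover have "(\<Sum>j<m. \<Sum>l<m. a j * b l * (c h * \<gamma> (q + int l - int j - h))) = c h * toeplitz_form \<gamma> (q - h) m a b" for h
    unfolding toeplitz_form_def by (auto simp: sum_distrib_left mult_ac algebra_simps intro!: sum.cong)
  ultimately show ?thesis by simp
qed

text \<open>The convolution with the coefficients of \<open>f0\<close> shifts one block by
  \<open>h\<close>. Shifts up to \<open>R\<close> keep the starting points at least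
  \<open>m + p\<close> apart, which yields \<open>r ^ p\<close>. Larger shifts may bring the blocks
  together; they are bounded without any decay and cost the tail \<open>\<tau>\<close> of the
  coefficient sum.\<close>

lemma toeplitz_form_poisson_le:
  fixes \<Gamma> :: real and R :: nat and f0 :: "real \<Rightarrow> real"
  defines "\<tau> \<equiv> \<Gamma> - (\<Sum>h=-int R..int R. \<bar>fourier_cos f0 h\<bar>)"
  assumes r: "0 \<le> r" "r < 1" and f0: "set_integrable lborel circ f0"
    and \<Gamma>: "((\<lambda>h. \<bar>fourier_cos f0 h\<bar>) has_sum \<Gamma>) UNIV" and q: "int m + int p + int R \<le> q"
  shows "\<bar>toeplitz_form (poisson_acf f0 r) q m a b\<bar>
    \<le> (\<Gamma> * r ^ p + \<tau>) * ((ar_quad r m a + ar_quad r m b) / 2)"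
proof -
  define V where "V = (ar_quad r m a + ar_quad r m b) / 2"
  have V: "0 \<le> V" using r by (simp add: V_def ar_quad_nonneg)
  define X where "X = toeplitz_form (poisson_acf f0 r) q m a b"
  have X: "((\<lambda>h. fourier_cos f0 h * ar_cross r (q - h) m a b) has_sum X) UNIV"
    unfolding X_def toeplitz_form_ar[symmetric]
    by (intro has_sum_toeplitz_form has_sum_fourier_cos_poisson f0 r)
  let ?B = "{-int R..int R}"
  have "((\<lambda>h. if h \<in> ?B then \<bar>fourier_cos f0 h\<bar> else 0) has_sum (\<Sum>h\<in>?B. \<bar>fourier_cos f0 h\<bar>)) UNIV"
    by (subst has_sum_cong_neutral[where T = ?B and g = "\<lambda>h. \<bar>fourier_cos f0 h\<bar>"]) auto
  from has_sum_add[OF \<Gamma> has_sum_uminusI[OF this]]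
  have tail: "((\<lambda>h. \<bar>fourier_cos f0 h\<bar> - (if h \<in> ?B then \<bar>fourier_cos f0 h\<bar> else 0)) has_sum \<tau>) UNIV"
    unfolding \<tau>_def by simp
  have maj: "((\<lambda>h. V * (r ^ p * \<bar>fourier_cos f0 h\<bar> + (\<bar>fourier_cos f0 h\<bar> - (if h \<in> ?B then \<bar>fourier_cos f0 h\<bar> else 0))))
      has_sum (V * (r ^ p * \<Gamma> + \<tau>))) UNIV"
    by (intro has_sum_cmult_right has_sum_add \<Gamma> tail)
  have le: "\<bar>fourier_cos f0 h * ar_cross r (q - h) m a b\<bar>
      \<le> V * (r ^ p * \<bar>fourier_cos f0 h\<bar> + (\<bar>fourier_cos f0 h\<bar> - (if h \<in> ?B then \<bar>fourier_cos f0 h\<bar> else 0)))" for h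
  proof (cases "h \<in> ?B")
    case True
    then have "\<bar>ar_cross r (q - h) m a b\<bar> \<le> r ^ p * V"
      unfolding V_def using q by (intro ar_cross_far_le r) auto
    then have "\<bar>fourier_cos f0 h\<bar> * \<bar>ar_cross r (q - h) m a b\<bar> \<le> \<bar>fourier_cos f0 h\<bar> * (r ^ p * V)"
      by (intro mult_left_mono) auto
    then show ?thesis using True by (simp add: abs_mult mult_ac)
  next
    case False
    have "\<bar>fourier_cos f0 h\<bar> * \<bar>ar_cross r (q - h) m a b\<bar> \<le> \<bar>fourier_cos f0 h\<bar> * V"
      unfolding V_def by (intro mult_left_mono ar_cross_le r) auto
    moreover have "0 \<le> V * (r ^ p * \<bar>fourier_cos f0 h\<bar>)" using V r by simp
    ultimately show ?thesis
      unfolding abs_mult if_not_P[OF False] by (simp add: distrib_left mult_ac)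
  qed
  have "X \<le> V * (r ^ p * \<Gamma> + \<tau>)"
    by (rule has_sum_mono[OF X maj]) (use le in \<open>auto simp: abs_le_iff\<close>)
  moreover have "- X \<le> V * (r ^ p * \<Gamma> + \<tau>)"
    by (rule has_sum_mono[OF has_sum_uminusI[OF X] maj]) (use le in \<open>auto simp: abs_le_iff\<close>)
  ultimately show ?thesis by (simp add: X_def V_def[symmetric] mult_ac)
qed

section \<open>Integration over the mixture\<close>

lemma set_lborel_integral_nonneg:
  fixes f :: "real \<Rightarrow> real"
  assumes "\<And>x. x \<in> A \<Longrightarrow> 0 \<le> f x"
  shows "0 \<le> (LINT x:A|lborel. f x)"
  unfolding set_lebesgue_integral_def using assms
  by (intro Bochner_Integration.integral_nonneg) (auto simp: indicator_def)

lemma set_integral_subset_le: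
  fixes f :: "real \<Rightarrow> real"
  assumes "set_integrable lborel B f" "A \<subseteq> B" "A \<in> sets lborel" "\<And>x. x \<in> B \<Longrightarrow> 0 \<le> f x"
  shows "set_integrable lborel A f" "(LINT x:A|lborel. f x) \<le> (LINT x:B|lborel. f x)"
proof -
  show A: "set_integrable lborel A f" using set_integrable_subset[OF assms(1,3,2)] .
  show "(LINT x:A|lborel. f x) \<le> (LINT x:B|lborel. f x)"
    using A assms(1,2,4) unfolding set_lebesgue_integral_def set_integrable_def
    by (intro integral_mono) (auto simp: indicator_def)
qed

lemma ar_quad_measurable [measurable]: "(\<lambda>t. ar_quad (1 - t) m a) \<in> borel_measurable borel"
  unfolding ar_quad_def by measurable

lemma ar_quad_bounded:
  assumes "0 \<le> r" "r \<le> 1"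
  shows "\<bar>ar_quad r m a\<bar> \<le> (\<Sum>j<m. \<Sum>l<m. \<bar>a j * a l\<bar>)"
  unfolding ar_quad_def using assms
  by (intro order_trans[OF sum_abs] sum_mono) (auto simp: abs_mult power_le_one intro!: mult_left_le mult_nonneg_nonneg)

lemma set_integrable_mix_ar_quad:
  assumes d: "0 < d" "d < 1 / 2"
  shows "set_integrable lborel {0<..<1} (\<lambda>t. mix_weight d t * ar_quad (1 - t) m a)"
    "set_integrable lborel {0<..<1} (\<lambda>t. mix_weight d t * ar_quad (1 - t) m a * (1 - t) ^ p)"
proof -
  show 1: "set_integrable lborel {0<..<1} (\<lambda>t. mix_weight d t * ar_quad (1 - t) m a)"
    by (rule set_integrable_mult_bounded[OF set_integrable_mix_weight[OF d],
          where B = "\<Sum>j<m. \<Sum>l<m. \<bar>a j * a l\<bar>"])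
      (auto intro!: ar_quad_bounded simp del: abs_mult)
  show "set_integrable lborel {0<..<1} (\<lambda>t. mix_weight d t * ar_quad (1 - t) m a * (1 - t) ^ p)"
    by (rule set_integrable_mult_bounded[OF 1, where B=1]) (auto simp: power_abs power_le_one)
qed

text \<open>The autoregressions with \<open>t < y/m\<close> are dominated by those with \<open>y/m \<le> t \<le> 1/m\<close>, which carry much
  more weight.\<close>

lemma mix_ar_quad_near_unit_root:
  assumes d: "0 < d" "d < 1 / 2" and m: "2 \<le> m" and y: "0 < y" "y < 1"
  defines "\<eta> \<equiv> y powr (1 - 2 * d)"
  shows "(1 - \<eta>) * (LINT t:{0<..<y / real m}|lborel. mix_weight d t * ar_quad (1 - t) m a)
    \<le> 20 * \<eta> * (LINT t:{0<..<1}|lborel. mix_weight d t * ar_quad (1 - t) m a)"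
proof -
  define x where "x = y / real m"
  define e where "e = 1 - 2 * d"
  define c where "c = 1 / real m"
  define W where "W = (\<lambda>t. ar_quad (1 - t) m a)"
  have e: "0 < e" using d by (simp add: e_def)
  \<comment> \<open>\<open>m \<ge> 2\<close> keeps \<open>t \<le> c\<close> away from the
    singularity of the weight at \<open>t = 1\<close>; in this range
    \<open>(1 - t) powr (d - 1)\<close> lies between 1 and 2.\<close>
  have c: "0 < c" "c \<le> 1 / 2" using m by (auto simp: c_def field_simps)
  have x: "0 < x" "x < c" using y m by (auto simp: x_def c_def divide_strict_right_mono)
  define \<mu>1 where "\<mu>1 = (LINT t:{0<..<x}|lborel. mix_weight d t)"
  define \<mu>2 where "\<mu>2 = (LINT t:{x..c}|lborel. mix_weight d t)"
  define I where "I = (LINT t:{0<..<1}|lborel. mix_weight d t * W t)"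
  define W1 where "W1 = (LINT t:{0<..<x}|lborel. mix_weight d t * W t)"
  have Wnn: "0 \<le> W t" if "0 \<le> t" "t \<le> 1" for t using that by (simp add: W_def ar_quad_nonneg)
  have int: "set_integrable lborel {0<..<1} (\<lambda>t. mix_weight d t * W t)"
    unfolding W_def by (rule set_integrable_mix_ar_quad(1)[OF d])
  note intw = set_integrable_mix_weight[OF d]
  have sub: "{0<..<x} \<subseteq> {0<..<1}" "{x..c} \<subseteq> {0<..<1}" using x c by auto
  have int1: "set_integrable lborel {0<..<x} (\<lambda>t. mix_weight d t * W t)" "set_integrable lborel {x..c} (\<lambda>t. mix_weight d t * W t)"
    by (rule set_integrable_subset[OF int]; use sub in simp)+
  have intw1: "set_integrable lborel {0<..<x} (mix_weight d)" "set_integrable lborel {x..c} (mix_weight d)"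
    by (rule set_integrable_subset[OF intw]; use sub in simp)+
  have "((\<lambda>t. t powr (- 2 * d)) has_integral (x powr (- 2 * d + 1) / (- 2 * d + 1))) {0..x}"
    using d x by (intro has_integral_powr_from_0) auto
  then have h1: "((\<lambda>t. t powr (- 2 * d)) has_integral (x powr e / e)) {0<..<x}"
    by (simp add: has_integral_Icc_iff_Ioo e_def add.commute)
  have h2: "((\<lambda>t. t powr (- 2 * d)) has_integral (c powr e / e - x powr e / e)) {x..c}"
  proof (rule fundamental_theorem_of_calculus)
    fix t assume "t \<in> {x..c}"
    then have "0 < t" using x by auto
    then have "((\<lambda>t. t powr e / e) has_real_derivative e * t powr (e - 1) / e) (at t within {x..c})"
      by (intro DERIV_cdivide has_field_derivative_at_within[OF has_real_derivative_powr])
    then have "((\<lambda>t. t powr e / e) has_real_derivative t powr (- 2 * d)) (at t within {x..c})"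
      using e by (simp add: e_def)
    then show "((\<lambda>t. t powr e / e) has_vector_derivative t powr (- 2 * d)) (at t within {x..c})"
      by (simp add: has_real_derivative_iff_has_vector_derivative)
  qed (use x in simp)
  have p1: "set_integrable lborel {0<..<x} (\<lambda>t. t powr (- 2 * d))" "(LINT t:{0<..<x}|lborel. t powr (- 2 * d)) = x powr e / e"
    by (rule set_integrable_lborel_nonneg[OF h1]; simp)+
  have p2: "set_integrable lborel {x..c} (\<lambda>t. t powr (- 2 * d))" "(LINT t:{x..c}|lborel. t powr (- 2 * d)) = c powr e / e - x powr e / e"
    by (rule set_integrable_lborel_nonneg[OF h2]; simp)+
  have \<mu>1: "\<mu>1 \<le> 2 * (x powr e / e)"
  proof -
    have "\<mu>1 \<le> (LINT t:{0<..<x}|lborel. 2 * t powr (- 2 * d))"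
      unfolding \<mu>1_def
    proof (rule set_integral_mono)
      fix t assume t: "t \<in> {0<..<x}"
      have "(1 - t) powr (d - 1) \<le> (1 / 2) powr (d - 1)"
        using t x c d by (intro powr_mono2') auto
      also have "\<dots> = 2 powr (1 - d)" by (simp add: powr_divide powr_diff)
      also have "\<dots> \<le> 2 powr 1" using d by (intro powr_mono) auto
      finally show "mix_weight d t \<le> 2 * t powr (- 2 * d)"
        unfolding mix_weight_def by (intro mult_right_mono) auto
    qed (use p1 intw1 in auto)
    then show ?thesis using p1 by simp
  qed
  have \<mu>2: "c powr e / e - x powr e / e \<le> \<mu>2"
    unfolding \<mu>2_def p2(2)[symmetric]
  proof (rule set_integral_mono)
    fix t assume t: "t \<in> {x..c}"
    have "1 powr (d - 1) \<le> (1 - t) powr (d - 1)"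
      using t x c d by (intro powr_mono2') auto
    then have "1 * t powr (- 2 * d) \<le> (1 - t) powr (d - 1) * t powr (- 2 * d)"
      by (intro mult_right_mono) auto
    then show "t powr (- 2 * d) \<le> mix_weight d t" by (simp add: mix_weight_def)
  qed (use p2 intw1 in auto)
  \<comment> \<open>The scale \<open>1 / m\<close> cancels between the two masses
    \<open>\<mu>1\<close> and \<open>\<mu>2\<close>, so the final estimate contains
    \<open>\<eta>\<close> but not \<open>m\<close>.\<close>
  have xe: "x powr e = c powr e * \<eta>"
    using y m by (simp add: x_def c_def \<eta>_def e_def powr_divide powr_mult)
  have \<eta>: "0 \<le> \<eta>" "\<eta> \<le> 1" using y d by (auto simp: \<eta>_def powr_le1)
  have I0: "0 \<le> I" unfolding I_def using Wnn
    by (intro set_lborel_integral_nonneg) (auto intro!: mult_nonneg_nonneg mix_weight_nonneg)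
  have \<mu>1nn: "0 \<le> \<mu>1" unfolding \<mu>1_def by (intro set_lborel_integral_nonneg mix_weight_nonneg)
  have W1nn: "0 \<le> W1" unfolding W1_def using Wnn x c
    by (intro set_lborel_integral_nonneg) (auto intro!: mult_nonneg_nonneg mix_weight_nonneg)
  \<comment> \<open>A bound for every single \<open>t'\<close> in the comparison range; integrating
    it over \<open>t'\<close> against the mixture weight gives
    \<open>W1 * \<mu>2 \<le> 10 * \<mu>1 * I\<close>.\<close>
  have W1: "W1 \<le> 10 * W t' * \<mu>1" if t': "t' \<in> {x..c}" for t'
  proof -
    have "W1 \<le> (LINT t:{0<..<x}|lborel. mix_weight d t * (10 * W t'))"
      unfolding W1_def
    proof (rule set_integral_mono)
      fix t assume t: "t \<in> {0<..<x}"
      show "mix_weight d t * W t \<le> mix_weight d t * (10 * W t')"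
        unfolding W_def using t t' x m
        by (intro mult_left_mono ar_quad_compare mix_weight_nonneg) (auto simp: c_def)
    qed (use int1 intw1 in auto)
    then show ?thesis by (simp add: \<mu>1_def mult_ac)
  qed
  have "W1 * \<mu>2 = (LINT t:{x..c}|lborel. mix_weight d t * W1)" by (simp add: \<mu>2_def)
  also have "\<dots> \<le> (LINT t:{x..c}|lborel. 10 * \<mu>1 * (mix_weight d t * W t))"
  proof (rule set_integral_mono)
    fix t assume t: "t \<in> {x..c}"
    have "mix_weight d t * W1 \<le> mix_weight d t * (10 * W t * \<mu>1)"
      by (intro mult_left_mono W1 t mix_weight_nonneg)
    then show "mix_weight d t * W1 \<le> 10 * \<mu>1 * (mix_weight d t * W t)" by (simp add: mult_ac)
  qed (use int1 intw1 in auto)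
  also have "\<dots> = 10 * \<mu>1 * (LINT t:{x..c}|lborel. mix_weight d t * W t)" by simp
  also have "\<dots> \<le> 10 * \<mu>1 * I"
    unfolding I_def using \<mu>1nn sub Wnn
    by (intro mult_left_mono set_integral_subset_le(2)[OF int]) (auto intro!: mult_nonneg_nonneg mix_weight_nonneg)
  finally have fin: "W1 * \<mu>2 \<le> 10 * \<mu>1 * I" .
  have "W1 * (c powr e / e * (1 - \<eta>)) \<le> W1 * \<mu>2"
  proof (intro mult_left_mono W1nn)
    have "c powr e / e * (1 - \<eta>) = c powr e / e - x powr e / e"
      by (simp add: xe right_diff_distrib)
    then show "c powr e / e * (1 - \<eta>) \<le> \<mu>2" using \<mu>2 by simp
  qed
  \<comment> \<open>The constant 20 is the 10 of \<open>ar_quad_compare\<close> times the 2 in the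
    bound on \<open>\<mu>1\<close>.\<close>
  also have "\<dots> \<le> 10 * (2 * (x powr e / e)) * I"
    using fin \<mu>1 I0 by (meson mult_left_mono mult_right_mono order_trans zero_le_numeral)
  also have "\<dots> = c powr e / e * (20 * \<eta> * I)" by (simp add: xe)
  finally have "(c powr e / e) * ((1 - \<eta>) * W1) \<le> (c powr e / e) * (20 * \<eta> * I)" by (simp add: mult_ac)
  moreover have "0 < c powr e / e" using c e by simp
  ultimately have "(1 - \<eta>) * W1 \<le> 20 * \<eta> * I" by (simp only: mult_le_cancel_left_pos)
  then show ?thesis by (simp add: W1_def I_def W_def x_def)
qed

text \<open>Split at \<open>t = y / m\<close>: above it \<open>(1 - t) ^ p\<close> is at most
  \<open>exp (- (y * K))\<close> because \<open>p \<ge> K * m\<close>, and below it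
  \<open>mix_ar_quad_near_unit_root\<close> leaves only a small share. What matters is that
  \<open>K\<close> depends neither on \<open>m\<close> nor on \<open>a\<close>.\<close>

lemma mix_ar_quad_power_le:
  assumes d: "0 < d" "d < 1 / 2" and \<delta>: "0 < \<delta>"
  shows "\<exists>K::nat. \<forall>m\<ge>2. \<forall>p\<ge>K * m. \<forall>a.
    (LINT t:{0<..<1}|lborel. mix_weight d t * ar_quad (1 - t) m a * (1 - t) ^ p)
      \<le> \<delta> * (LINT t:{0<..<1}|lborel. mix_weight d t * ar_quad (1 - t) m a)"
proof -
  \<comment> \<open>The solution of \<open>20 * \<eta> / (1 - \<eta>) = \<delta> / 2\<close>;
    \<open>y\<close> is then the number with \<open>y powr (1 - 2 * d) = \<eta>\<close>.\<close>
  define \<eta> where "\<eta> = \<delta> / (40 + \<delta>)"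
  have \<eta>: "0 < \<eta>" "\<eta> < 1" using \<delta> by (auto simp: \<eta>_def)
  define y where "y = \<eta> powr (1 / (1 - 2 * d))"
  have y: "0 < y" "y < 1"
    using \<eta> d powr_less_mono2[of "1 / (1 - 2 * d)" \<eta> 1] by (auto simp: y_def)
  have y\<eta>: "y powr (1 - 2 * d) = \<eta>" using \<eta> d by (simp add: y_def powr_powr)
  obtain K :: nat where K: "ln (2 / \<delta>) / y < real K" using reals_Archimedean2 by blast
  show ?thesis
  proof (intro exI[of _ K] allI impI)
    fix m p :: nat and a :: "nat \<Rightarrow> real"
    assume m: "2 \<le> m" and p: "K * m \<le> p"
    let ?W = "\<lambda>t. mix_weight d t * ar_quad (1 - t) m a"
    define x where "x = y / real m"
    define I where "I = (LINT t:{0<..<1}|lborel. mix_weight d t * ar_quad (1 - t) m a)"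
    define W1 where "W1 = (LINT t:{0<..<x}|lborel. mix_weight d t * ar_quad (1 - t) m a)"
    have x: "0 < x" "x < 1" using y m by (auto simp: x_def divide_less_eq)
    have nn: "0 \<le> ?W t" if "t \<in> {0<..<1}" for t
      using that by (intro mult_nonneg_nonneg mix_weight_nonneg ar_quad_nonneg) auto
    note int = set_integrable_mix_ar_quad[OF d, of m a]
    have small: "(1 - x) ^ p \<le> \<delta> / 2"
    proof -
      have "(1 - x) ^ p \<le> exp (- x) ^ p"
        using x exp_ge_add_one_self[of "- x"] by (intro power_mono) auto
      also have "\<dots> = exp (- (x * real p))" by (simp add: exp_of_nat_mult[symmetric] mult.commute)
      also have "\<dots> \<le> exp (- (y * real K))"
      proof -
        have "real (K * m) \<le> real p" using p by (rule of_nat_mono)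
        then have "x * real (K * m) \<le> x * real p" using x by (intro mult_left_mono) auto
        moreover have "x * real (K * m) = y * real K" using m by (simp add: x_def)
        ultimately have "y * real K \<le> x * real p" by linarith
        then show ?thesis by simp
      qed
      also have "\<dots> \<le> exp (- ln (2 / \<delta>))"
        using K y by (simp add: divide_less_eq mult.commute)
      also have "\<dots> = \<delta> / 2" using \<delta> by (simp add: exp_minus)
      finally show ?thesis .
    qed
    have near: "W1 \<le> \<delta> / 2 * I"
    proof -
      have "(1 - \<eta>) * W1 \<le> 20 * \<eta> * I"
        using mix_ar_quad_near_unit_root[OF d m y, of a] unfolding y\<eta> W1_def I_def x_def .
      moreover have "1 - \<eta> = 40 / (40 + \<delta>)" "20 * \<eta> * I = 40 / (40 + \<delta>) * (\<delta> / 2 * I)"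
        using \<delta> by (auto simp: \<eta>_def field_simps)
      ultimately have "40 / (40 + \<delta>) * W1 \<le> 40 / (40 + \<delta>) * (\<delta> / 2 * I)" by simp
      then show ?thesis using \<delta> by (subst (asm) mult_le_cancel_left_pos) auto
    qed
    have sub: "{0<..<x} \<subseteq> {0<..<1}" using x by auto
    have "(LINT t:{0<..<1}|lborel. ?W t * (1 - t) ^ p)
      \<le> (LINT t|lborel. indicator {0<..<x} t * (?W t)
          + \<delta> / 2 * (indicator {0<..<1} t * (?W t)))"
      unfolding set_lebesgue_integral_def
    proof (rule integral_mono)
      show "integrable lborel (\<lambda>t. indicator {0<..<1} t *\<^sub>R (?W t * (1 - t) ^ p))"
        using int(2) unfolding set_integrable_def .
      have "set_integrable lborel {0<..<x} (\<lambda>t. ?W t)"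
        by (rule set_integrable_subset[OF int(1)]) (use sub in auto)
      then show "integrable lborel (\<lambda>t. indicator {0<..<x} t * (?W t)
          + \<delta> / 2 * (indicator {0<..<1} t * (?W t)))"
        using int(1) unfolding set_integrable_def by simp
      fix t
      show "indicator {0<..<1} t *\<^sub>R (?W t * (1 - t) ^ p)
        \<le> indicator {0<..<x} t * (?W t)
          + \<delta> / 2 * (indicator {0<..<1} t * (?W t))"
      proof (cases "t \<in> {0<..<1}")
        case True
        show ?thesis
        proof (cases "t < x")
          case True
          have "?W t * (1 - t) ^ p \<le> ?W t"
            using nn \<open>t \<in> {0<..<1}\<close> by (intro mult_left_le power_le_one) auto
          moreover have "0 \<le> \<delta> / 2 * (?W t)"
            using \<delta> by (intro mult_nonneg_nonneg[OF _ nn[OF \<open>t \<in> {0<..<1}\<close>]]) auto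
          ultimately show ?thesis using True \<open>t \<in> {0<..<1}\<close> by simp
        next
          case False
          have "(1 - t) ^ p \<le> (1 - x) ^ p" using False \<open>t \<in> {0<..<1}\<close> by (intro power_mono) auto
          then have "?W t * (1 - t) ^ p \<le> ?W t * (\<delta> / 2)"
            using small nn[OF \<open>t \<in> {0<..<1}\<close>] by (intro mult_left_mono) auto
          then show ?thesis using False \<open>t \<in> {0<..<1}\<close> by (simp add: mult_ac)
        qed
      next
        case False
        then have "t \<notin> {0<..<x}" using sub by blast
        then show ?thesis using False by (simp del: greaterThanLessThan_iff)
      qed
    qed
    also have "\<dots> = W1 + \<delta> / 2 * I"
    proof -
      have "set_integrable lborel {0<..<x} (\<lambda>t. ?W t)"
        by (rule set_integrable_subset[OF int(1)]) (use sub in auto)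
      then show ?thesis
        using int(1) unfolding W1_def I_def set_lebesgue_integral_def set_integrable_def by simp
    qed
    also have "\<dots> \<le> \<delta> * I" using near by simp
    finally show "(LINT t:{0<..<1}|lborel. ?W t * (1 - t) ^ p)
      \<le> \<delta> * (LINT t:{0<..<1}|lborel. ?W t)" unfolding I_def .
  qed
qed

lemma has_sum_tail_small:
  fixes g :: "int \<Rightarrow> real"
  assumes g: "(g has_sum \<Gamma>) UNIV" and \<epsilon>: "0 < \<epsilon>" and nonneg: "\<And>h. 0 \<le> g h"
  shows "\<exists>R::nat. \<Gamma> - (\<Sum>h=-int R..int R. g h) \<le> \<epsilon>"
proof -
  obtain F where F: "finite F" "dist (sum g F) \<Gamma> \<le> \<epsilon>"
    using has_sum_finite_approximation[OF g \<epsilon>] by blast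
  define R where "R = (\<Sum>h\<in>F. nat \<bar>h\<bar>)"
  have "F \<subseteq> {-int R..int R}"
  proof
    fix h assume h: "h \<in> F"
    have "nat \<bar>h\<bar> \<le> R"
      unfolding R_def by (rule member_le_sum[OF h _ F(1)]) simp
    then have "\<bar>h\<bar> \<le> int R" by (simp add: nat_le_iff)
    then show "h \<in> {-int R..int R}" by (simp add: abs_le_iff)
  qed
  then have "sum g F \<le> (\<Sum>h=-int R..int R. g h)"
    using nonneg by (intro sum_mono2) auto
  then have "\<Gamma> - (\<Sum>h=-int R..int R. g h) \<le> \<epsilon>"
    using F(2) by (simp add: dist_real_def abs_le_iff)
  then show ?thesis by blast
qed

lemma toeplitz_form_mixture:
  assumes d: "0 < d" "d < 1 / 2" and f0: "set_integrable lborel circ f0"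
    and f: "set_integrable lborel circ (\<lambda>l. frac_density d l * f0 l)"
  shows "set_integrable lborel {0<..<1} (\<lambda>t. mix_weight d t * toeplitz_form (poisson_acf f0 (1 - t)) q m a b)"
    "2 * pi * mix_const d * toeplitz_form (frac_acf d f0) q m a b
      = (LINT t:{0<..<1}|lborel. mix_weight d t * toeplitz_form (poisson_acf f0 (1 - t)) q m a b)"
proof -
  define Y where "Y = (\<lambda>n t. indicator {0<..<1} t * (mix_weight d t * poisson_acf f0 (1 - t) n))"
  have Yint: "integrable lborel (Y n)" and
    Yeq: "(LINT t|lborel. Y n t) = 2 * pi * mix_const d * frac_acf d f0 n" for n
    using mixture_fourier[OF d f0 f, of n] unfolding Y_def set_integrable_def set_lebesgue_integral_def by simp_all
  have eq: "indicator {0<..<1} t * (mix_weight d t * toeplitz_form (poisson_acf f0 (1 - t)) q m a b)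
      = (\<Sum>j<m. \<Sum>l<m. a j * b l * Y (q + int l - int j) t)" for t
    unfolding toeplitz_form_def Y_def by (simp add: sum_distrib_left mult_ac)
  show "set_integrable lborel {0<..<1} (\<lambda>t. mix_weight d t * toeplitz_form (poisson_acf f0 (1 - t)) q m a b)"
    unfolding set_integrable_def real_scaleR_def eq
    by (intro Bochner_Integration.integrable_sum integrable_mult_right Yint)
  have "(LINT t|lborel. (\<Sum>j<m. \<Sum>l<m. a j * b l * Y (q + int l - int j) t))
    = (\<Sum>j<m. LINT t|lborel. (\<Sum>l<m. a j * b l * Y (q + int l - int j) t))"
    by (intro Bochner_Integration.integral_sum Bochner_Integration.integrable_sum integrable_mult_right Yint)
  also have "\<dots> = (\<Sum>j<m. \<Sum>l<m. LINT t|lborel. a j * b l * Y (q + int l - int j) t)"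
    by (intro sum.cong refl Bochner_Integration.integral_sum integrable_mult_right Yint)
  also have "\<dots> = 2 * pi * mix_const d * toeplitz_form (frac_acf d f0) q m a b"
    unfolding toeplitz_form_def by (simp add: Yeq sum_distrib_left mult_ac)
  finally show "2 * pi * mix_const d * toeplitz_form (frac_acf d f0) q m a b
      = (LINT t:{0<..<1}|lborel. mix_weight d t * toeplitz_form (poisson_acf f0 (1 - t)) q m a b)"
    unfolding set_lebesgue_integral_def real_scaleR_def eq by simp
qed

text \<open>Upper bounds for the cross form and lower bounds for the variances are established for
  each autoregression and integrated with the same weight, so they are compared through the
  integrals of \<open>ar_quad\<close>. Absolute summability of the coefficients of \<open>f0\<close>
  provides \<open>R\<close>, positivity of its infimum provides \<open>c\<close>.\<close>

lemma block_covariance_le: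
  assumes d: "0 < d" "d < 1 / 2" and f0: "set_integrable lborel circ f0"
    and f: "set_integrable lborel circ (\<lambda>l. frac_density d l * f0 l)"
    and c: "0 < c" "\<And>l. l \<in> circ \<Longrightarrow> c \<le> f0 l"
    and summ: "(\<lambda>h. \<bar>fourier_cos f0 h\<bar>) summable_on UNIV" and \<delta>: "0 < \<delta>"
  defines "\<gamma> \<equiv> frac_acf d f0"
  shows "\<exists>K::nat. \<forall>m\<ge>2. \<forall>k\<ge>K * m. \<forall>a b.
    \<bar>toeplitz_form \<gamma> (int k) m a b\<bar> \<le> \<delta> * (toeplitz_form \<gamma> 0 m a a + toeplitz_form \<gamma> 0 m b b)"
proof -
  define C where "C = 2 * pi * mix_const d"
  have C: "0 < C" using mix_const_pos[OF d] by (simp add: C_def)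
  define \<Gamma> where "\<Gamma> = (\<Sum>\<^sub>\<infinity>h. \<bar>fourier_cos f0 h\<bar>)"
  have \<Gamma>: "((\<lambda>h. \<bar>fourier_cos f0 h\<bar>) has_sum \<Gamma>) UNIV"
    unfolding \<Gamma>_def by (rule has_sum_infsum[OF summ])
  have \<Gamma>0: "0 \<le> \<Gamma>" unfolding \<Gamma>_def by (rule infsum_nonneg) simp
  \<comment> \<open>Scaled so that the factor \<open>2 * pi * c\<close> of the lower bound
    \<open>low\<close> cancels at the end.\<close>
  define \<delta>' where "\<delta>' = 2 * pi * c * \<delta>"
  have \<delta>': "0 < \<delta>'" using c \<delta> by (simp add: \<delta>'_def)
  obtain R :: nat where R: "\<Gamma> - (\<Sum>h=-int R..int R. \<bar>fourier_cos f0 h\<bar>) \<le> \<delta>'"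
    using has_sum_tail_small[OF \<Gamma> \<delta>'] by auto
  define \<tau> where "\<tau> = \<Gamma> - (\<Sum>h=-int R..int R. \<bar>fourier_cos f0 h\<bar>)"
  \<comment> \<open>Dividing by \<open>\<Gamma> + 1\<close> avoids a division by 0, and
    \<open>\<Gamma> / (\<Gamma> + 1) \<le> 1\<close> is all that remains of it.\<close>
  have "0 < \<delta>' / (\<Gamma> + 1)" using \<delta>' \<Gamma>0 by simp
  from mix_ar_quad_power_le[OF d this] obtain K :: nat where K: "\<And>m p a. 2 \<le> m \<Longrightarrow> K * m \<le> p \<Longrightarrow>
      (LINT t:{0<..<1}|lborel. mix_weight d t * ar_quad (1 - t) m a * (1 - t) ^ p)
        \<le> \<delta>' / (\<Gamma> + 1) * (LINT t:{0<..<1}|lborel. mix_weight d t * ar_quad (1 - t) m a)"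
    by blast
  show ?thesis
  proof (intro exI[of _ "K + R + 1"] allI impI)
    fix m k :: nat and a b :: "nat \<Rightarrow> real"
    assume m: "2 \<le> m" and k: "(K + R + 1) * m \<le> k"
    let ?W = "\<lambda>a t. mix_weight d t * ar_quad (1 - t) m a"
    \<comment> \<open>What is left of the distance after one block length and the largest treated
      shift. The fixed number \<open>R\<close> is absorbed into \<open>R * m\<close>, so
      \<open>p \<ge> K * m\<close> still holds.\<close>
    define p where "p = k - m - R"
    have "R \<le> R * m" using m by simp
    moreover have "(K + R + 1) * m = K * m + R * m + m" by (simp add: algebra_simps)
    ultimately have kp: "K * m + R + m \<le> k" using k by linarith
    then have p: "K * m \<le> p" "int m + int p + int R \<le> int k" by (auto simp: p_def)
    define Y where "Y = (\<lambda>t a b q. toeplitz_form (poisson_acf f0 (1 - t)) q m a b)"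
    define I where "I = (\<lambda>a. LINT t:{0<..<1}|lborel. ?W a t)"
    define J where "J = (\<lambda>a. LINT t:{0<..<1}|lborel. ?W a t * (1 - t) ^ p)"
    note int = set_integrable_mix_ar_quad[OF d, of m]
    have Yint: "set_integrable lborel {0<..<1} (\<lambda>t. mix_weight d t * Y t a b q)" for a b q
      unfolding Y_def by (rule toeplitz_form_mixture(1)[OF d f0 f])
    have Yeq: "C * toeplitz_form \<gamma> q m a b = (LINT t:{0<..<1}|lborel. mix_weight d t * Y t a b q)" for a b q
      unfolding Y_def C_def \<gamma>_def by (rule toeplitz_form_mixture(2)[OF d f0 f])
    have I0: "0 \<le> I a" for a
      unfolding I_def by (intro set_lborel_integral_nonneg mult_nonneg_nonneg mix_weight_nonneg ar_quad_nonneg) auto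
    have low: "2 * pi * c * I a \<le> C * toeplitz_form \<gamma> 0 m a a" for a
    proof -
      have "2 * pi * c * I a = (LINT t:{0<..<1}|lborel. 2 * pi * c * (?W a t))"
        by (simp add: I_def)
      also have "\<dots> \<le> (LINT t:{0<..<1}|lborel. mix_weight d t * Y t a a 0)"
      proof (rule set_integral_mono)
        fix t :: real assume t: "t \<in> {0<..<1}"
        have "mix_weight d t * (2 * pi * c * ar_quad (1 - t) m a) \<le> mix_weight d t * Y t a a 0"
          unfolding Y_def using t
          by (intro mult_left_mono ar_quad_le_toeplitz_form f0 c mix_weight_nonneg) auto
        then show "2 * pi * c * (?W a t) \<le> mix_weight d t * Y t a a 0"
          by (simp add: mult_ac)
      qed (use int Yint in auto)
      finally show ?thesis by (simp only: Yeq)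
    qed
    have "\<bar>C * toeplitz_form \<gamma> (int k) m a b\<bar> \<le> (LINT t:{0<..<1}|lborel. norm (mix_weight d t * Y t a b (int k)))"
      unfolding Yeq using set_integral_norm_bound[OF Yint] by simp
    also have "\<dots> \<le> (LINT t:{0<..<1}|lborel.
        \<Gamma> / 2 * (?W a t * (1 - t) ^ p + ?W b t * (1 - t) ^ p)
        + \<tau> / 2 * (?W a t + ?W b t))"
    proof (rule set_integral_mono)
      show "set_integrable lborel {0<..<1} (\<lambda>t. norm (mix_weight d t * Y t a b (int k)))"
        by (rule set_integrable_norm[OF Yint])
      show "set_integrable lborel {0<..<1} (\<lambda>t.
        \<Gamma> / 2 * (?W a t * (1 - t) ^ p + ?W b t * (1 - t) ^ p)
        + \<tau> / 2 * (?W a t + ?W b t))"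
        by (intro set_integral_add set_integrable_mult_right int)
      fix t :: real assume t: "t \<in> {0<..<1}"
      have "norm (mix_weight d t * Y t a b (int k)) = mix_weight d t * \<bar>Y t a b (int k)\<bar>"
        using mix_weight_nonneg[of d t] by (simp add: abs_mult)
      also have "\<dots> \<le> mix_weight d t * ((\<Gamma> * (1 - t) ^ p + \<tau>) * ((ar_quad (1 - t) m a + ar_quad (1 - t) m b) / 2))"
        unfolding Y_def \<tau>_def using t p(2)
        by (intro mult_left_mono toeplitz_form_poisson_le f0 \<Gamma> mix_weight_nonneg) auto
      also have "\<dots> = \<Gamma> / 2 * (?W a t * (1 - t) ^ p + ?W b t * (1 - t) ^ p)
        + \<tau> / 2 * (?W a t + ?W b t)"
        by (simp add: field_simps)
      finally show "norm (mix_weight d t * Y t a b (int k)) \<le> \<dots>" .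
    qed
    also have "\<dots> = \<Gamma> / 2 * (J a + J b) + \<tau> / 2 * (I a + I b)"
      unfolding I_def J_def using int by (simp add: set_integral_add)
    also have "\<dots> \<le> \<Gamma> / 2 * (\<delta>' / (\<Gamma> + 1) * I a + \<delta>' / (\<Gamma> + 1) * I b) + \<delta>' / 2 * (I a + I b)"
      unfolding J_def using K[OF m p(1)] \<Gamma>0 R I0 unfolding I_def[symmetric] \<tau>_def[symmetric]
      by (intro add_mono mult_left_mono mult_right_mono) (auto simp: I_def)
    also have "\<dots> = (\<Gamma> / (\<Gamma> + 1)) * (\<delta>' / 2 * (I a + I b)) + \<delta>' / 2 * (I a + I b)"
      by (simp add: algebra_simps add_divide_distrib)
    also have "\<dots> \<le> 1 * (\<delta>' / 2 * (I a + I b)) + \<delta>' / 2 * (I a + I b)"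
      using \<Gamma>0 \<delta>' I0[of a] I0[of b] by (intro add_mono mult_right_mono) (auto simp: divide_le_eq)
    also have "\<dots> = \<delta> * (2 * pi * c * I a + 2 * pi * c * I b)"
      by (simp add: \<delta>'_def algebra_simps)
    also have "\<dots> \<le> \<delta> * (C * toeplitz_form \<gamma> 0 m a a + C * toeplitz_form \<gamma> 0 m b b)"
      using \<delta> low by (intro mult_left_mono add_mono) auto
    finally have "C * \<bar>toeplitz_form \<gamma> (int k) m a b\<bar> \<le> C * (\<delta> * (toeplitz_form \<gamma> 0 m a a + toeplitz_form \<gamma> 0 m b b))"
      using C by (simp add: abs_mult algebra_simps)
    then show "\<bar>toeplitz_form \<gamma> (int k) m a b\<bar> \<le> \<delta> * (toeplitz_form \<gamma> 0 m a a + toeplitz_form \<gamma> 0 m b b)"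
      using C by (simp only: mult_le_cancel_left_pos)
  qed
qed

section \<open>Gebelein's inequality\<close>

definition psd_kernel :: "'i set \<Rightarrow> ('i \<Rightarrow> 'i \<Rightarrow> real) \<Rightarrow> bool" where
  "psd_kernel I K \<longleftrightarrow> (\<forall>x. 0 \<le> (\<Sum>i\<in>I. \<Sum>j\<in>I. x i * x j * K i j))"

lemma psd_kernelD: "psd_kernel I K \<Longrightarrow> 0 \<le> (\<Sum>i\<in>I. \<Sum>j\<in>I. x i * x j * K i j)"
  by (simp add: psd_kernel_def)

text \<open>Real and imaginary parts of the coefficients give two real quadratic forms; the mixed
  terms are purely imaginary.\<close>

lemma psd_kernel_complex:
  assumes "psd_kernel I K"
  shows "0 \<le> Re (\<Sum>i\<in>I. \<Sum>j\<in>I. c i * cnj (c j) * of_real (K i j))"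
proof -
  have "Re (\<Sum>i\<in>I. \<Sum>j\<in>I. c i * cnj (c j) * of_real (K i j)) =
    (\<Sum>i\<in>I. \<Sum>j\<in>I. Re (c i) * Re (c j) * K i j) + (\<Sum>i\<in>I. \<Sum>j\<in>I. Im (c i) * Im (c j) * K i j)"
    by (simp add: sum.distrib[symmetric] algebra_simps)
  then show ?thesis
    using psd_kernelD[OF assms, of "\<lambda>i. Re (c i)"] psd_kernelD[OF assms, of "\<lambda>i. Im (c i)"] by simp
qed

text \<open>When one of the factors is a Gram matrix, the quadratic form of the product is an integral of
  quadratic forms of the other factor.\<close>

lemma psd_kernel_mult_gram:
  assumes psd: "psd_kernel I K" and int: "\<And>i j. i \<in> I \<Longrightarrow> j \<in> I \<Longrightarrow> integrable M (\<lambda>w. W i w * W j w)"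
  shows "psd_kernel I (\<lambda>i j. K i j * (\<integral>w. W i w * W j w \<partial>M))"
  unfolding psd_kernel_def
proof
  fix x :: "'a \<Rightarrow> real"
  have "(\<Sum>i\<in>I. \<Sum>j\<in>I. x i * x j * (K i j * (\<integral>w. W i w * W j w \<partial>M)))
    = (\<Sum>i\<in>I. \<Sum>j\<in>I. \<integral>w. x i * x j * K i j * (W i w * W j w) \<partial>M)"
    by (simp add: mult.assoc)
  also have "\<dots> = (\<integral>w. (\<Sum>i\<in>I. \<Sum>j\<in>I. x i * x j * K i j * (W i w * W j w)) \<partial>M)"
    using int by (subst Bochner_Integration.integral_sum; (intro Bochner_Integration.integrable_sum sum.cong refl)?)
      (auto intro!: Bochner_Integration.integral_sum[symmetric] simp del: mult_eq_0_iff)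
  also have "\<dots> \<ge> 0"
  proof (rule Bochner_Integration.integral_nonneg)
    fix w
    show "0 \<le> (\<Sum>i\<in>I. \<Sum>j\<in>I. x i * x j * K i j * (W i w * W j w))"
      using psd_kernelD[OF psd, of "\<lambda>i. x i * W i w"] by (simp add: mult_ac)
  qed
  finally show "0 \<le> (\<Sum>i\<in>I. \<Sum>j\<in>I. x i * x j * (K i j * (\<integral>w. W i w * W j w \<partial>M)))" .
qed

text \<open>\<open>\<kappa>\<close> alone need not be semidefinite, only its product with the Gram
  matrix. The powers of the Gram matrix therefore start at exponent 1, each further factor
  preserving semidefiniteness, and the exponential series loses its constant term. In a covariance
  that missing 1 is the product of the means.\<close>

lemma psd_kernel_exp:
  assumes int: "\<And>i j. i \<in> I \<Longrightarrow> j \<in> I \<Longrightarrow> integrable M (\<lambda>w. W i w * W j w)"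
  assumes psd: "psd_kernel I (\<lambda>i j. \<kappa> i j * (\<integral>w. W i w * W j w \<partial>M))"
  shows "psd_kernel I (\<lambda>i j. \<kappa> i j * (exp (\<integral>w. W i w * W j w \<partial>M) - 1))"
proof -
  define F where "F = (\<lambda>i j. \<integral>w. W i w * W j w \<partial>M)"
  have pow: "psd_kernel I (\<lambda>i j. \<kappa> i j * F i j ^ Suc q)" for q
  proof (induction q)
    case 0
    then show ?case using psd by (simp add: F_def)
  next
    case (Suc q)
    show ?case
      using psd_kernel_mult_gram[OF Suc int] by (simp add: F_def mult_ac)
  qed
  show ?thesis
    unfolding psd_kernel_def
  proof
    fix x :: "'a \<Rightarrow> real"
    have exp_sums: "(\<lambda>q. y ^ Suc q / fact (Suc q)) sums (exp y - 1)" for y :: real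
      using sums_split_initial_segment[OF exp_converges[of y], of 1] by (simp add: divide_inverse mult_ac)
    have sums: "(\<lambda>q. \<Sum>i\<in>I. \<Sum>j\<in>I. x i * x j * (\<kappa> i j * (F i j ^ Suc q / fact (Suc q))))
        sums (\<Sum>i\<in>I. \<Sum>j\<in>I. x i * x j * (\<kappa> i j * (exp (F i j) - 1)))"
      by (intro sums_sum sums_mult exp_sums)
    have nonneg: "0 \<le> (\<Sum>i\<in>I. \<Sum>j\<in>I. x i * x j * (\<kappa> i j * (F i j ^ Suc q / fact (Suc q))))" for q
    proof -
      have "0 \<le> (\<Sum>i\<in>I. \<Sum>j\<in>I. x i * x j * (\<kappa> i j * F i j ^ Suc q)) / fact (Suc q)"
        using psd_kernelD[OF pow, of x q] by (intro divide_nonneg_pos) auto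
      then show ?thesis by (simp add: sum_divide_distrib del: power_Suc fact_Suc)
    qed
    have "0 \<le> (\<Sum>i\<in>I. \<Sum>j\<in>I. x i * x j * (\<kappa> i j * (exp (F i j) - 1)))"
      by (rule sums_le[OF nonneg sums_zero sums])
    then show "0 \<le> (\<Sum>i\<in>I. \<Sum>j\<in>I. x i * x j * (\<kappa> i j * (exp (\<integral>w. W i w * W j w \<partial>M) - 1)))"
      by (simp only: F_def)
  qed
qed

section \<open>Gaussian variables and trigonometric polynomials in them\<close>

abbreviation (in prob_space) (input) ip :: "('a \<Rightarrow> real) \<Rightarrow> ('a \<Rightarrow> real) \<Rightarrow> real" where
  "ip U V \<equiv> expectation (\<lambda>w. U w * V w)"

abbreviation (in prob_space) (input) msq :: "('a \<Rightarrow> real) \<Rightarrow> real" where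
  "msq U \<equiv> expectation (\<lambda>w. (U w)\<^sup>2)"

lemma abs_mult_le_sum_squares: "\<bar>u * v\<bar> \<le> u\<^sup>2 + v\<^sup>2" for u v :: real
proof -
  have "2 * (\<bar>u\<bar> * \<bar>v\<bar>) \<le> u\<^sup>2 + v\<^sup>2" using sum_squares_bound[of "\<bar>u\<bar>" "\<bar>v\<bar>"] by simp
  moreover have "0 \<le> \<bar>u\<bar> * \<bar>v\<bar>" by simp
  ultimately show ?thesis unfolding abs_mult by linarith
qed

text \<open>Constants count as normal and form a separate case, where mean 0 makes the variable
  vanish almost surely. Otherwise \<open>W / \<sigma>\<close> is standard normal and its
  characteristic function is evaluated at \<open>\<sigma>\<close>.\<close>

lemma (in prob_space) normal_rv_expectation_cis:
  assumes W: "normal_rv M W" and mean: "expectation W = 0"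
  shows "expectation (\<lambda>w. cis (W w)) = of_real (exp (- msq W / 2))"
proof -
  have meas[measurable]: "W \<in> borel_measurable M" using W by (simp add: normal_rv_def)
  from W consider \<mu> where "AE w in M. W w = \<mu>"
    | \<mu> \<sigma> where "\<sigma> > 0" "distributed M lborel W (normal_density \<mu> \<sigma>)"
    unfolding normal_rv_def by blast
  then show ?thesis
  proof cases
    case 1
    then have "expectation W = expectation (\<lambda>_. \<mu>)" by (intro integral_cong_AE) auto
    with mean 1 have AE: "AE w in M. W w = 0" by (simp add: prob_space)
    then have "msq W = expectation (\<lambda>_. 0)"
      by (intro integral_cong_AE) auto
    moreover have "expectation (\<lambda>w. cis (W w)) = expectation (\<lambda>_. 1)"
      using AE by (intro integral_cong_AE) (auto simp: cis_conv_exp)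
    ultimately show ?thesis by (simp add: prob_space)
  next
    case 2
    have \<mu>: "\<mu> = 0" using normal_distributed_expectation[OF 2] mean by simp
    have var: "msq W = \<sigma>\<^sup>2"
      using normal_distributed_variance[OF 2] mean by simp
    have "distributed M lborel (\<lambda>x. W x / \<sigma>) std_normal_density"
      using normal_standard_normal_convert[OF 2(1), of W \<mu>] 2(2) \<mu> by simp
    then have "distr M lborel (\<lambda>x. W x / \<sigma>) = std_normal_distribution"
      by (rule distributed_distr_eq_density)
    moreover have "distr M lborel (\<lambda>x. W x / \<sigma>) = distr M borel (\<lambda>x. W x / \<sigma>)"
      by (rule distr_cong) auto
    ultimately have "char (distr M borel (\<lambda>x. W x / \<sigma>)) \<sigma> = of_real (exp (- \<sigma>\<^sup>2 / 2))"
      by (simp add: char_std_normal_distribution)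
    then have "expectation (\<lambda>w. iexp (\<sigma> * (W w / \<sigma>))) = of_real (exp (- \<sigma>\<^sup>2 / 2))"
      unfolding char_def by (subst (asm) integral_distr) auto
    then show ?thesis using 2(1) by (simp add: var cis_conv_exp)
  qed
qed

definition linear_space :: "('a \<Rightarrow> real) set \<Rightarrow> bool" where
  "linear_space H \<longleftrightarrow> (\<lambda>_. 0) \<in> H \<and> (\<forall>U\<in>H. \<forall>V\<in>H. \<forall>a b. (\<lambda>w. a * U w + b * V w) \<in> H)"

lemma linear_spaceD:
  "linear_space H \<Longrightarrow> U \<in> H \<Longrightarrow> V \<in> H \<Longrightarrow> (\<lambda>w. a * U w + b * V w) \<in> H"
  by (simp add: linear_space_def)

lemma linear_space_sum:
  assumes "linear_space H" "finite I" "\<And>i. i \<in> I \<Longrightarrow> W i \<in> H"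
  shows "(\<lambda>w. \<Sum>i\<in>I. x i * W i w) \<in> H"
  using assms(2,3)
proof (induction rule: finite_induct)
  case empty
  then show ?case using assms(1) by (simp add: linear_space_def)
next
  case (insert i I)
  then have "(\<lambda>w. x i * W i w + 1 * (\<Sum>i\<in>I. x i * W i w)) \<in> H"
    by (intro linear_spaceD[OF assms(1)]) auto
  then show ?case using insert by simp
qed

definition trig_poly :: "('a \<Rightarrow> real) set \<Rightarrow> ('a \<Rightarrow> complex) \<Rightarrow> bool" where
  "trig_poly H p \<longleftrightarrow>
     (\<exists>n c W. (\<forall>i<n. W i \<in> H) \<and> p = (\<lambda>w. \<Sum>i<(n::nat). c i * cis (W i w)))"

definition ccov :: "'a measure \<Rightarrow> ('a \<Rightarrow> complex) \<Rightarrow> ('a \<Rightarrow> complex) \<Rightarrow> complex" where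
  "ccov M p q = (\<integral>w. p w * cnj (q w) \<partial>M) - (\<integral>w. p w \<partial>M) * cnj (\<integral>w. q w \<partial>M)"

lemma ccov_sum:
  assumes "\<And>i. i \<in> I \<Longrightarrow> integrable M (p i)" "\<And>j. j \<in> J \<Longrightarrow> integrable M (q j)"
    "\<And>i j. i \<in> I \<Longrightarrow> j \<in> J \<Longrightarrow> integrable M (\<lambda>w. p i w * cnj (q j w))"
  shows "ccov M (\<lambda>w. \<Sum>i\<in>I. c i * p i w) (\<lambda>w. \<Sum>j\<in>J. d j * q j w)
    = (\<Sum>i\<in>I. \<Sum>j\<in>J. c i * cnj (d j) * ccov M (p i) (q j))"
proof -
  have "(\<integral>w. (\<Sum>i\<in>I. c i * p i w) * cnj (\<Sum>j\<in>J. d j * q j w) \<partial>M)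
    = (\<integral>w. (\<Sum>i\<in>I. \<Sum>j\<in>J. c i * cnj (d j) * (p i w * cnj (q j w))) \<partial>M)"
    by (simp add: sum_product mult_ac)
  also have "\<dots> = (\<Sum>i\<in>I. \<Sum>j\<in>J. c i * cnj (d j) * (\<integral>w. p i w * cnj (q j w) \<partial>M))"
    using assms(3) by (subst Bochner_Integration.integral_sum; (intro Bochner_Integration.integrable_sum sum.cong refl)?)
      (auto intro!: trans[OF Bochner_Integration.integral_sum] simp del: mult_eq_0_iff)
  finally show ?thesis
    using assms(1,2) unfolding ccov_def
    by (simp add: Bochner_Integration.integral_sum sum_product sum_subtractf algebra_simps)
qed

locale gaussian_space = prob_space +
  fixes \<G> :: "('a \<Rightarrow> real) set"
  assumes linear: "linear_space \<G>"
    and normal: "\<And>U. U \<in> \<G> \<Longrightarrow> normal_rv M U"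
    and mean: "\<And>U. U \<in> \<G> \<Longrightarrow> expectation U = 0"
    and square_integrable: "\<And>U. U \<in> \<G> \<Longrightarrow> integrable M (\<lambda>w. (U w)\<^sup>2)"
begin

lemma measurable_\<G>: "U \<in> \<G> \<Longrightarrow> U \<in> borel_measurable M"
  using normal unfolding normal_rv_def by blast

lemma integrable_mult_\<G>:
  assumes "U \<in> \<G>" "V \<in> \<G>"
  shows "integrable M (\<lambda>w. U w * V w)"
proof (rule Bochner_Integration.integrable_bound)
  show "integrable M (\<lambda>w. (U w)\<^sup>2 + (V w)\<^sup>2)" using assms square_integrable by simp
  show "(\<lambda>w. U w * V w) \<in> borel_measurable M"
    using assms[THEN measurable_\<G>] by simp
  show "AE w in M. norm (U w * V w) \<le> norm ((U w)\<^sup>2 + (V w)\<^sup>2)"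
    using abs_mult_le_sum_squares by simp
qed

lemma integrable_cis: "U \<in> \<G> \<Longrightarrow> integrable M (\<lambda>w. cis (U w))"
  using measurable_\<G>[of U] by (intro integrable_const_bound[where B=1]) (auto simp: cis_conv_exp)

lemma cis_mult_cnj: "cis a * cnj (cis b) = cis (a - b)"
  by (simp add: cis_cnj cis_mult)

text \<open>The mean of the product is the characteristic function of \<open>U - V\<close>, and
  expanding the square in its exponent splits off \<open>ip U V\<close>. The two other factors
  involve one variable each and will be absorbed into coefficients.\<close>

lemma ccov_cis:
  assumes U: "U \<in> \<G>" and V: "V \<in> \<G>"
  shows "ccov M (\<lambda>w. cis (U w)) (\<lambda>w. cis (V w)) =
    of_real (exp (- msq U / 2) * exp (- msq V / 2)
      * (exp (ip U V) - 1))"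
proof -
  have "(\<lambda>w. 1 * U w + (-1) * V w) \<in> \<G>"
    by (rule linear_spaceD[OF linear U V])
  then have diff: "(\<lambda>w. U w - V w) \<in> \<G>" by simp
  have "expectation (\<lambda>w. (U w - V w)\<^sup>2)
      = expectation (\<lambda>w. (U w)\<^sup>2 + (V w)\<^sup>2 - 2 * (U w * V w))"
    by (simp add: power2_diff mult.assoc)
  also have "\<dots> = msq U + msq V - 2 * ip U V"
    using square_integrable[OF U] square_integrable[OF V] integrable_mult_\<G>[OF U V] by simp
  finally have "exp (- expectation (\<lambda>w. (U w - V w)\<^sup>2) / 2)
    = exp (- msq U / 2) * exp (- msq V / 2)
      * exp (ip U V)"
    by (simp add: exp_add[symmetric] field_simps)
  then show ?thesis
    unfolding ccov_def cis_mult_cnj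
    using normal_rv_expectation_cis[OF normal mean, OF diff diff]
      normal_rv_expectation_cis[OF normal mean, OF U U] normal_rv_expectation_cis[OF normal mean, OF V V]
    by (simp add: algebra_simps)
qed

text \<open>The hypothesis says that a Gram matrix of variables from both spaces stays positive
  semidefinite when its two diagonal blocks are multiplied by \<open>\<rho>\<close>. Its one-sided
  form loses nothing, since \<open>V\<close> may be replaced by \<open>- V\<close>.
  \<open>psd_kernel_exp\<close> carries semidefiniteness over to the kernel of
  \<open>ccov_cis\<close>.\<close>

lemma trig_poly_ccov_le:
  assumes H1: "linear_space H1" "H1 \<subseteq> \<G>" and H2: "linear_space H2" "H2 \<subseteq> \<G>"
    and \<rho>: "\<And>U V. U \<in> H1 \<Longrightarrow> V \<in> H2 \<Longrightarrow>
      - 2 * ip U V \<le> \<rho> * (msq U + msq V)"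
    and p: "trig_poly H1 p" and q: "trig_poly H2 q"
  shows "2 * Re (ccov M p q) \<le> \<rho> * Re (ccov M p p + ccov M q q)"
proof -
  obtain n c1 W1 where W1: "\<And>i. i < n \<Longrightarrow> W1 i \<in> H1" and peq: "p = (\<lambda>w. \<Sum>i<(n::nat). c1 i * cis (W1 i w))"
    using p unfolding trig_poly_def by blast
  obtain m c2 W2 where W2: "\<And>i. i < m \<Longrightarrow> W2 i \<in> H2" and qeq: "q = (\<lambda>w. \<Sum>i<(m::nat). c2 i * cis (W2 i w))"
    using q unfolding trig_poly_def by blast
  \<comment> \<open>The disjoint sum keeps the two families apart even if they share a variable;
    \<open>isl\<close> tells the blocks of the matrix apart.\<close>
  define I where "I = {..<n} <+> {..<m}"
  define W where "W = case_sum W1 W2"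
  \<comment> \<open>With entries 1 in the off-diagonal blocks of \<open>\<kappa>\<close>, the minus
    sign makes these blocks contribute \<open>- ccov M p q - ccov M q p\<close>.\<close>
  define c where "c = case_sum c1 (\<lambda>i. - c2 i)"
  define \<kappa> where "\<kappa> = (\<lambda>(i::nat + nat) (j::nat + nat). if isl i = isl j then \<rho> else 1)"
  define F where "F = (\<lambda>i j. ip (W i) (W j))"
  define e where "e = (\<lambda>i. exp (- expectation (\<lambda>w. (W i w)\<^sup>2) / 2))"
  have WG: "W i \<in> \<G>" if "i \<in> I" for i
    using that W1 W2 H1 H2 by (auto simp: I_def W_def)
  have int: "integrable M (\<lambda>w. W i w * W j w)" if "i \<in> I" "j \<in> I" for i j
    using integrable_mult_\<G>[OF WG WG] that .
  have split: "(\<Sum>i\<in>I. \<Sum>j\<in>I. g i j) = (\<Sum>i<n. \<Sum>j<n. g (Inl i) (Inl j)) + (\<Sum>i<m. \<Sum>j<m. g (Inr i) (Inr j))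
      + (\<Sum>i<n. \<Sum>j<m. g (Inl i) (Inr j)) + (\<Sum>i<m. \<Sum>j<n. g (Inr i) (Inl j))"
    for g :: "nat + nat \<Rightarrow> nat + nat \<Rightarrow> 'z::comm_monoid_add"
    unfolding I_def by (simp add: sum.Plus sum.distrib add_ac)
  have bilin: "expectation (\<lambda>w. (\<Sum>i\<in>I'. x i * A i w) * (\<Sum>j\<in>J'. y j * B j w))
      = (\<Sum>i\<in>I'. \<Sum>j\<in>J'. x i * y j * ip (A i) (B j))"
    if A: "\<And>i. i \<in> I' \<Longrightarrow> A i \<in> \<G>" and B: "\<And>i. i \<in> J' \<Longrightarrow> B i \<in> \<G>"
    for I' J' :: "nat set" and x y and A B :: "nat \<Rightarrow> 'a \<Rightarrow> real"
  proof -
    have "expectation (\<lambda>w. (\<Sum>i\<in>I'. x i * A i w) * (\<Sum>j\<in>J'. y j * B j w))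
      = expectation (\<lambda>w. \<Sum>i\<in>I'. \<Sum>j\<in>J'. x i * y j * (A i w * B j w))"
      by (simp add: sum_product mult_ac)
    also have "\<dots> = (\<Sum>i\<in>I'. expectation (\<lambda>w. \<Sum>j\<in>J'. x i * y j * (A i w * B j w)))"
      using A B by (intro Bochner_Integration.integral_sum Bochner_Integration.integrable_sum
          integrable_mult_right integrable_mult_\<G>)
    also have "\<dots> = (\<Sum>i\<in>I'. \<Sum>j\<in>J'. x i * y j * ip (A i) (B j))"
      using A B by (intro sum.cong refl trans[OF Bochner_Integration.integral_sum] Bochner_Integration.integrable_sum
          integrable_mult_right integrable_mult_\<G>) auto
    finally show ?thesis .
  qed
  have "psd_kernel I (\<lambda>i j. \<kappa> i j * F i j)"
    unfolding psd_kernel_def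
  proof
    fix x :: "nat + nat \<Rightarrow> real"
    define U where "U = (\<lambda>w. \<Sum>i<n. x (Inl i) * W1 i w)"
    define V where "V = (\<lambda>w. \<Sum>i<m. x (Inr i) * W2 i w)"
    have "U \<in> H1" "V \<in> H2"
      unfolding U_def V_def using W1 W2 H1 H2 by (auto intro!: linear_space_sum)
    from \<rho>[OF this] have "0 \<le> \<rho> * ip U U + \<rho> * ip V V
        + ip U V + ip V U"
      by (simp add: power2_eq_square algebra_simps)
    also have "\<dots> = (\<Sum>i\<in>I. \<Sum>j\<in>I. x i * x j * (\<kappa> i j * F i j))"
      unfolding split U_def V_def
      using W1 W2 H1(2) H2(2)
      by (subst (1 2 3 4) bilin) (auto simp: \<kappa>_def F_def W_def sum_distrib_left mult_ac)
    finally show "0 \<le> (\<Sum>i\<in>I. \<Sum>j\<in>I. x i * x j * (\<kappa> i j * F i j))" .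
  qed
  then have "psd_kernel I (\<lambda>i j. \<kappa> i j * (exp (F i j) - 1))"
    unfolding F_def by (intro psd_kernel_exp[where M = M and W = W and I = I and \<kappa> = \<kappa>] int)
  \<comment> \<open>The single-variable factors \<open>e i\<close> of \<open>ccov_cis\<close> enter
    as part of the coefficients.\<close>
  from psd_kernel_complex[OF this, of "\<lambda>i. c i * of_real (e i)"]
  have "0 \<le> Re (\<Sum>i\<in>I. \<Sum>j\<in>I. of_real (\<kappa> i j) * (c i * cnj (c j) * of_real (e i * e j * (exp (F i j) - 1))))"
    by (simp add: mult_ac)
  also have "(\<Sum>i\<in>I. \<Sum>j\<in>I. of_real (\<kappa> i j) * (c i * cnj (c j) * of_real (e i * e j * (exp (F i j) - 1))))
    = (\<Sum>i\<in>I. \<Sum>j\<in>I. of_real (\<kappa> i j) * (c i * cnj (c j) * ccov M (\<lambda>w. cis (W i w)) (\<lambda>w. cis (W j w))))"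
    by (intro sum.cong refl) (simp add: ccov_cis WG e_def F_def)
  also have "\<dots> = of_real \<rho> * ccov M p p + of_real \<rho> * ccov M q q - ccov M p q - ccov M q p"
  proof -
    have cc: "ccov M (\<lambda>w. \<Sum>i\<in>I'. x i * cis (A i w)) (\<lambda>w. \<Sum>j\<in>J'. y j * cis (B j w))
      = (\<Sum>i\<in>I'. \<Sum>j\<in>J'. x i * cnj (y j) * ccov M (\<lambda>w. cis (A i w)) (\<lambda>w. cis (B j w)))"
      if A: "\<And>i. i \<in> I' \<Longrightarrow> A i \<in> \<G>" and B: "\<And>i. i \<in> J' \<Longrightarrow> B i \<in> \<G>"
      for I' J' :: "nat set" and x y and A B :: "nat \<Rightarrow> 'a \<Rightarrow> real"
    proof (rule ccov_sum)
      fix i j assume ij: "i \<in> I'" "j \<in> J'"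
      show "integrable M (\<lambda>w. cis (A i w) * cnj (cis (B j w)))"
        unfolding cis_mult_cnj using measurable_\<G>[OF A[OF ij(1)]] measurable_\<G>[OF B[OF ij(2)]]
        by (intro integrable_const_bound[where B=1]) (auto simp: cis_conv_exp)
    qed (use A B integrable_cis in auto)
    have cc': "ccov M p p = (\<Sum>i<n. \<Sum>j<n. c1 i * cnj (c1 j) * ccov M (\<lambda>w. cis (W1 i w)) (\<lambda>w. cis (W1 j w)))"
      "ccov M p q = (\<Sum>i<n. \<Sum>j<m. c1 i * cnj (c2 j) * ccov M (\<lambda>w. cis (W1 i w)) (\<lambda>w. cis (W2 j w)))"
      "ccov M q p = (\<Sum>i<m. \<Sum>j<n. c2 i * cnj (c1 j) * ccov M (\<lambda>w. cis (W2 i w)) (\<lambda>w. cis (W1 j w)))"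
      "ccov M q q = (\<Sum>i<m. \<Sum>j<m. c2 i * cnj (c2 j) * ccov M (\<lambda>w. cis (W2 i w)) (\<lambda>w. cis (W2 j w)))"
      unfolding peq qeq using W1 W2 H1 H2 by (auto intro!: cc)
    show ?thesis
      unfolding split cc'
      by (simp add: \<kappa>_def c_def W_def sum_distrib_left sum_negf)
  qed
  finally have "0 \<le> \<rho> * Re (ccov M p p) + \<rho> * Re (ccov M q q) - Re (ccov M p q) - Re (ccov M q p)"
    by simp
  moreover have "ccov M q p = cnj (ccov M p q)"
    using Bochner_Integration.integral_cnj[of M "\<lambda>w. p w * cnj (q w)"]
    by (simp add: ccov_def mult.commute del: Bochner_Integration.integral_cnj)
  ultimately show ?thesis by (simp add: algebra_simps)
qed

end

lemma trig_poly_zero: "trig_poly H (\<lambda>_. 0)"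
  unfolding trig_poly_def by (intro exI[of _ 0]) simp

lemma trig_poly_snoc:
  assumes "trig_poly H p" "U \<in> H"
  shows "trig_poly H (\<lambda>w. p w + a * cis (U w))"
proof -
  obtain n c W where W: "\<forall>i<n. W i \<in> H" and p: "p = (\<lambda>w. \<Sum>i<(n::nat). c i * cis (W i w))"
    using assms(1) unfolding trig_poly_def by blast
  show ?thesis
    unfolding trig_poly_def
  proof (intro exI conjI)
    show "\<forall>i<Suc n. (W(n := U)) i \<in> H" using W assms(2) by (auto simp: less_Suc_eq)
    show "(\<lambda>w. p w + a * cis (U w)) = (\<lambda>w. \<Sum>i<Suc n. (c(n := a)) i * cis ((W(n := U)) i w))"
      by (simp add: p)
  qed
qed

lemma trig_poly_induct [consumes 1, case_names zero snoc]:
  assumes "trig_poly H p" "P (\<lambda>_. 0)"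
    "\<And>p a U. trig_poly H p \<Longrightarrow> P p \<Longrightarrow> U \<in> H \<Longrightarrow> P (\<lambda>w. p w + a * cis (U w))"
  shows "P p"
proof -
  obtain n c W where W: "\<forall>i<n. W i \<in> H" and p: "p = (\<lambda>w. \<Sum>i<(n::nat). c i * cis (W i w))"
    using assms(1) unfolding trig_poly_def by blast
  have "P (\<lambda>w. \<Sum>i<k. c i * cis (W i w))" if "k \<le> n" for k
    using that
  proof (induction k)
    case (Suc k)
    have "trig_poly H (\<lambda>w. \<Sum>i<k. c i * cis (W i w))"
      unfolding trig_poly_def using W Suc.prems by (intro exI[of _ k] exI[of _ c] exI[of _ W]) auto
    then show ?case using assms(3)[of "\<lambda>w. \<Sum>i<k. c i * cis (W i w)" "W k" "c k"] Suc W by simp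
  qed (simp add: assms(2))
  then show ?thesis unfolding p by simp
qed

lemma trig_poly_add:
  assumes "trig_poly H p" "trig_poly H q"
  shows "trig_poly H (\<lambda>w. p w + q w)"
  using assms(2)
proof (induct rule: trig_poly_induct)
  case zero
  then show ?case using assms(1) by simp
next
  case (snoc q a U)
  then show ?case using trig_poly_snoc[of H "\<lambda>w. p w + q w" U a] by (simp add: add.assoc)
qed

lemma trig_poly_cis: "U \<in> H \<Longrightarrow> trig_poly H (\<lambda>w. a * cis (U w))"
  using trig_poly_snoc[OF trig_poly_zero, of U H a] by simp

lemma trig_poly_const: "linear_space H \<Longrightarrow> trig_poly H (\<lambda>_. a)"
  using trig_poly_cis[of "\<lambda>_. 0" H a] by (simp add: linear_space_def)

text \<open>\<open>cis V * cis U = cis (V + U)\<close>, and \<open>H\<close> is closed under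
  addition.\<close>

lemma trig_poly_mult:
  assumes H: "linear_space H" and p: "trig_poly H p" and q: "trig_poly H q"
  shows "trig_poly H (\<lambda>w. p w * q w)"
  using q
proof (induct rule: trig_poly_induct)
  case zero
  then show ?case by (simp add: trig_poly_zero)
next
  case (snoc q a U)
  have "trig_poly H (\<lambda>w. p w * (a * cis (U w)))"
    using p
  proof (induct rule: trig_poly_induct)
    case zero
    then show ?case by (simp add: trig_poly_zero)
  next
    case (snoc p b V)
    have "(\<lambda>w. 1 * V w + 1 * U w) \<in> H"
      by (rule linear_spaceD[OF H snoc(3) \<open>U \<in> H\<close>])
    from trig_poly_add[OF snoc(2) trig_poly_cis[OF this, of "b * a"]]
    show ?case by (simp add: algebra_simps cis_mult[symmetric])
  qed
  from trig_poly_add[OF snoc(2) this] show ?case by (simp add: distrib_left)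
qed

lemma trig_poly_real_polynomial:
  assumes H: "linear_space H" and q: "trig_poly H (\<lambda>w. of_real (q w))"
    and g: "real_polynomial_function (g :: real \<Rightarrow> real)"
  shows "trig_poly H (\<lambda>w. of_real (g (q w)))"
  using g
proof (induction rule: real_polynomial_function.induct)
  case (linear g)
  then interpret bounded_linear g .
  have "g x = g 1 * x" for x using scale[of x 1] by (simp add: mult.commute)
  then have "(\<lambda>w. complex_of_real (g (q w))) = (\<lambda>w. of_real (g 1) * of_real (q w))"
    by (metis of_real_mult)
  then show ?case using trig_poly_mult[OF H trig_poly_const[OF H] q] by simp
next
  case (const c)
  then show ?case by (rule trig_poly_const[OF H])
next
  case (add f g)
  then show ?case using trig_poly_add by fastforce
next
  case (mult f g)
  then show ?case using trig_poly_mult[OF H] by fastforce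
qed

lemma trig_poly_sin:
  assumes H: "linear_space H" and U: "U \<in> H"
  shows "trig_poly H (\<lambda>w. of_real (sin (t * (U w - a))))"
proof -
  have V: "(\<lambda>w. s * U w) \<in> H" for s
    using linear_spaceD[OF H U U, of s 0] by simp
  have eq: "complex_of_real (sin (t * (u - a))) = - \<i> / 2 * cis (- t * a) * cis (t * u)
      + \<i> / 2 * cis (t * a) * cis (- t * u)" for u
    by (simp add: complex_eq_iff sin_diff right_diff_distrib field_simps)
  show ?thesis
    unfolding eq by (intro trig_poly_add trig_poly_cis V)
qed

section \<open>Approximation in mean square by trigonometric polynomials\<close>

lemma measurable_cnj [measurable]: "cnj \<in> borel_measurable borel"
  by (intro borel_measurable_continuous_onI continuous_intros)

abbreviation (in prob_space) (input) "msd f g \<equiv> expectation (\<lambda>w. (cmod (f w - g w))\<^sup>2)"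

lemma (in prob_space) square_expectation_le:
  fixes X :: "'a \<Rightarrow> real"
  assumes "integrable M X" "integrable M (\<lambda>w. (X w)\<^sup>2)"
  shows "expectation X \<le> sqrt (msq X)"
proof -
  have "0 \<le> variance X" by (rule variance_positive)
  then have "(expectation X)\<^sup>2 \<le> msq X"
    using variance_eq[OF assms] by simp
  then show ?thesis by (rule real_le_rsqrt)
qed

text \<open>Each \<open>p n\<close> is bounded, but not uniformly in \<open>n\<close>, while the
  limits are bounded by 1. The product is therefore expanded around the limits:
  \<open>e * d + e + d\<close> bounds the error pointwise, and its mean is controlled by the
  mean-square distances alone.\<close>

lemma (in prob_space) L2_tendsto_product:
  fixes f g :: "'a \<Rightarrow> complex"
  assumes [measurable]: "f \<in> borel_measurable M" "g \<in> borel_measurable M"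
    "\<And>n. p n \<in> borel_measurable M" "\<And>n. q n \<in> borel_measurable M"
    and fg: "\<And>w. w \<in> space M \<Longrightarrow> cmod (f w) \<le> 1" "\<And>w. w \<in> space M \<Longrightarrow> cmod (g w) \<le> 1"
    and bp: "\<And>n. \<exists>B. \<forall>w. cmod (p n w) \<le> B" and bq: "\<And>n. \<exists>B. \<forall>w. cmod (q n w) \<le> B"
    and lim: "(\<lambda>n. msd f (p n)) \<longlonglongrightarrow> 0"
      "(\<lambda>n. msd g (q n)) \<longlonglongrightarrow> 0"
  shows "(\<lambda>n. expectation (\<lambda>w. p n w * cnj (q n w))) \<longlonglongrightarrow> expectation (\<lambda>w. f w * cnj (g w))"
proof (rule LIM_zero_cancel, rule Lim_null_comparison)
  define E where "E = (\<lambda>n. msd f (p n))"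
  define D where "D = (\<lambda>n. msd g (q n))"
  have "(\<lambda>n. E n / 2 + D n / 2 + sqrt (E n) + sqrt (D n)) \<longlonglongrightarrow> 0 / 2 + 0 / 2 + sqrt 0 + sqrt 0"
    using lim unfolding E_def[symmetric] D_def[symmetric] by (intro tendsto_intros) auto
  then show "(\<lambda>n. E n / 2 + D n / 2 + sqrt (E n) + sqrt (D n)) \<longlonglongrightarrow> 0" by simp
  show "\<forall>\<^sub>F n in sequentially. norm (expectation (\<lambda>w. p n w * cnj (q n w)) - expectation (\<lambda>w. f w * cnj (g w)))
      \<le> E n / 2 + D n / 2 + sqrt (E n) + sqrt (D n)"
  proof (rule always_eventually, rule allI)
    fix n
    obtain B where B: "\<And>w. cmod (p n w) \<le> B" using bp[of n] by blast
    obtain C where C: "\<And>w. cmod (q n w) \<le> C" using bq[of n] by blast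
    have B0: "0 \<le> B" and C0: "0 \<le> C" using B C order_trans[OF norm_ge_zero] by blast+
    define e where "e = (\<lambda>w. cmod (f w - p n w))"
    define d where "d = (\<lambda>w. cmod (g w - q n w))"
    have [measurable]: "e \<in> borel_measurable M" "d \<in> borel_measurable M"
      unfolding e_def d_def by measurable
    have e: "0 \<le> e w" "e w \<le> 1 + B" and d: "0 \<le> d w" "d w \<le> 1 + C" if "w \<in> space M" for w
      using norm_triangle_ineq4[of "f w" "p n w"] norm_triangle_ineq4[of "g w" "q n w"] fg[OF that] B[of w] C[of w]
      by (auto simp: e_def d_def)
    have "integrable M e"
      using e by (intro integrable_const_bound[where B="1 + B"]) auto
    moreover have "integrable M d"
      using d by (intro integrable_const_bound[where B="1 + C"]) auto
    moreover have "integrable M (\<lambda>w. (e w)\<^sup>2)"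
      using e by (intro integrable_const_bound[where B="(1 + B)\<^sup>2"]) (auto intro!: power_mono)
    moreover have "integrable M (\<lambda>w. (d w)\<^sup>2)"
      using d by (intro integrable_const_bound[where B="(1 + C)\<^sup>2"]) (auto intro!: power_mono)
    ultimately have int: "integrable M e" "integrable M d" "integrable M (\<lambda>w. (e w)\<^sup>2)" "integrable M (\<lambda>w. (d w)\<^sup>2)"
      by auto
    have i1: "integrable M (\<lambda>w. p n w * cnj (q n w))"
      using B C B0 by (intro integrable_const_bound[where B="B * C"]) (auto simp: norm_mult intro!: mult_mono)
    have i2: "integrable M (\<lambda>w. f w * cnj (g w))"
      using fg by (intro integrable_const_bound[where B=1]) (auto simp: norm_mult intro!: mult_le_one)
    have ED: "E n = msq e" "D n = msq d"
      by (simp_all only: E_def D_def e_def d_def)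
    have "norm (expectation (\<lambda>w. p n w * cnj (q n w)) - expectation (\<lambda>w. f w * cnj (g w)))
      = norm (expectation (\<lambda>w. p n w * cnj (q n w) - f w * cnj (g w)))"
      using i1 i2 by simp
    also have "\<dots> \<le> expectation (\<lambda>w. norm (p n w * cnj (q n w) - f w * cnj (g w)))"
      by (rule integral_norm_bound)
    also have "\<dots> \<le> expectation (\<lambda>w. (e w)\<^sup>2 / 2 + (d w)\<^sup>2 / 2 + e w + d w)"
    proof (rule integral_mono)
      fix w assume w: "w \<in> space M"
      have "p n w * cnj (q n w) - f w * cnj (g w)
        = (p n w - f w) * cnj (q n w - g w) + (p n w - f w) * cnj (g w) + f w * cnj (q n w - g w)"
        by (simp add: algebra_simps)
      then have "norm (p n w * cnj (q n w) - f w * cnj (g w))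
        \<le> e w * d w + e w * cmod (g w) + cmod (f w) * d w"
        using norm_triangle_ineq[of "(p n w - f w) * cnj (q n w - g w) + (p n w - f w) * cnj (g w)" "f w * cnj (q n w - g w)"]
          norm_triangle_ineq[of "(p n w - f w) * cnj (q n w - g w)" "(p n w - f w) * cnj (g w)"]
        unfolding norm_mult complex_mod_cnj e_def d_def by (simp add: norm_minus_commute)
      also have "\<dots> \<le> ((e w)\<^sup>2 / 2 + (d w)\<^sup>2 / 2) + e w * 1 + 1 * d w"
        using sum_squares_bound[of "e w" "d w"] fg[OF w] e[OF w] d[OF w]
        by (intro add_mono mult_left_mono mult_right_mono) auto
      finally show "norm (p n w * cnj (q n w) - f w * cnj (g w)) \<le> (e w)\<^sup>2 / 2 + (d w)\<^sup>2 / 2 + e w + d w"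
        by simp
    qed (use i1 i2 int in auto)
    also have "\<dots> = E n / 2 + D n / 2 + expectation e + expectation d"
      using int by (simp add: ED)
    also have "\<dots> \<le> E n / 2 + D n / 2 + sqrt (E n) + sqrt (D n)"
      using square_expectation_le[OF int(1,3)] square_expectation_le[OF int(2,4)]
      by (simp add: ED)
    finally show "norm (expectation (\<lambda>w. p n w * cnj (q n w)) - expectation (\<lambda>w. f w * cnj (g w)))
      \<le> E n / 2 + D n / 2 + sqrt (E n) + sqrt (D n)" .
  qed
qed

locale gaussian_subspace = gaussian_space +
  fixes H
  assumes lin_H: "linear_space H" and H_sub: "H \<subseteq> \<G>"
begin

lemma trig_poly_measurable: "trig_poly H p \<Longrightarrow> p \<in> borel_measurable M"
proof (induct rule: trig_poly_induct)
  case (snoc p a U)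
  have [measurable]: "p \<in> borel_measurable M" "U \<in> borel_measurable M"
    using snoc H_sub measurable_\<G> by auto
  show ?case by (simp add: cis_conv_exp)
qed simp

lemma trig_poly_bounded: "trig_poly H p \<Longrightarrow> \<exists>B. \<forall>w. cmod (p w) \<le> B"
proof (induct rule: trig_poly_induct)
  case (snoc p a U)
  then obtain B where "\<forall>w. cmod (p w) \<le> B" by blast
  then have "\<forall>w. cmod (p w + a * cis (U w)) \<le> B + cmod a"
    by (auto intro!: norm_triangle_le simp: norm_mult)
  then show ?case by blast
qed auto

text \<open>The bound by 1 is imposed on the function, not on its approximations; it is what makes
  the class closed under products and pointwise limits.\<close>

definition trig_approx :: "('a \<Rightarrow> complex) \<Rightarrow> bool" where
  "trig_approx f \<longleftrightarrow> f \<in> borel_measurable M \<and> (\<forall>w\<in>space M. cmod (f w) \<le> 1) \<and>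
     (\<forall>\<epsilon>>0. \<exists>p. trig_poly H p \<and> msd f p < \<epsilon>)"

lemma integrable_cmod_square:
  assumes [measurable]: "f \<in> borel_measurable M" "g \<in> borel_measurable M"
    and f: "\<And>w. w \<in> space M \<Longrightarrow> cmod (f w) \<le> B" and g: "\<And>w. w \<in> space M \<Longrightarrow> cmod (g w) \<le> C"
  shows "integrable M (\<lambda>w. (cmod (f w - g w))\<^sup>2)"
proof (rule integrable_const_bound)
  show "AE w in M. norm ((cmod (f w - g w))\<^sup>2) \<le> (B + C)\<^sup>2"
  proof (rule AE_I2)
    fix w assume w: "w \<in> space M"
    have "cmod (f w - g w) \<le> B + C"
      using norm_triangle_ineq4[of "f w" "g w"] f[OF w] g[OF w] by linarith
    then show "norm ((cmod (f w - g w))\<^sup>2) \<le> (B + C)\<^sup>2"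
      by (simp add: power_mono)
  qed
qed measurable

lemma trig_approx_integrable:
  assumes "trig_approx f" "trig_poly H p"
  shows "integrable M (\<lambda>w. (cmod (f w - p w))\<^sup>2)"
proof -
  obtain B where "\<And>w. cmod (p w) \<le> B" using trig_poly_bounded[OF assms(2)] by blast
  then show ?thesis
    using assms trig_poly_measurable unfolding trig_approx_def
    by (intro integrable_cmod_square[where B=1 and C=B]) auto
qed

lemma cmod_square_triangle: "(cmod (a + b))\<^sup>2 \<le> 2 * (cmod a)\<^sup>2 + 2 * (cmod b)\<^sup>2"
proof -
  have "(cmod (a + b))\<^sup>2 \<le> (cmod a + cmod b)\<^sup>2"
    by (intro power_mono norm_triangle_ineq) auto
  also have "\<dots> \<le> 2 * (cmod a)\<^sup>2 + 2 * (cmod b)\<^sup>2"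
    using sum_squares_bound[of "cmod a" "cmod b"] by (simp add: power2_sum)
  finally show ?thesis .
qed

text \<open>The approximations are chosen in order: \<open>q\<close> has to be close to
  \<open>g\<close> relative to the bound \<open>B\<close> of \<open>p\<close>, which is known only
  after \<open>p\<close> has been fixed. Using \<open>1 + B\<^sup>2\<close> in the denominator
  covers \<open>B = 0\<close>.\<close>

lemma trig_approx_mult:
  assumes f: "trig_approx f" and g: "trig_approx g"
  shows "trig_approx (\<lambda>w. f w * g w)"
  unfolding trig_approx_def
proof (intro conjI ballI allI impI)
  have [measurable]: "f \<in> borel_measurable M" "g \<in> borel_measurable M"
    using f g unfolding trig_approx_def by blast+
  show "(\<lambda>w. f w * g w) \<in> borel_measurable M" by measurable
  show "cmod (f w * g w) \<le> 1" if "w \<in> space M" for w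
    using f g that unfolding trig_approx_def by (simp add: norm_mult mult_le_one)
  fix \<epsilon> :: real assume \<epsilon>: "\<epsilon> > 0"
  obtain p where p: "trig_poly H p" "msd f p < \<epsilon> / 4"
    using f \<epsilon> unfolding trig_approx_def by (metis divide_pos_pos zero_less_numeral)
  obtain B where B: "\<And>w. cmod (p w) \<le> B" using trig_poly_bounded[OF p(1)] by blast
  have "0 < \<epsilon> / (4 * (1 + B\<^sup>2))" using \<epsilon> by (intro divide_pos_pos mult_pos_pos add_pos_nonneg) auto
  then obtain q where q: "trig_poly H q" "msd g q < \<epsilon> / (4 * (1 + B\<^sup>2))"
    using g unfolding trig_approx_def by meson
  have pq: "trig_poly H (\<lambda>w. p w * q w)" by (rule trig_poly_mult[OF lin_H p(1) q(1)])
  have int: "integrable M (\<lambda>w. (cmod (f w - p w))\<^sup>2)" "integrable M (\<lambda>w. (cmod (g w - q w))\<^sup>2)"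
    using trig_approx_integrable f g p q by auto
  have "expectation (\<lambda>w. (cmod (f w * g w - p w * q w))\<^sup>2)
    \<le> expectation (\<lambda>w. 2 * (cmod (f w - p w))\<^sup>2 + 2 * B\<^sup>2 * (cmod (g w - q w))\<^sup>2)"
  proof (rule integral_mono')
    show "integrable M (\<lambda>w. 2 * (cmod (f w - p w))\<^sup>2 + 2 * B\<^sup>2 * (cmod (g w - q w))\<^sup>2)"
      using int by simp
    fix w assume w: "w \<in> space M"
    have eq: "f w * g w - p w * q w = (f w - p w) * g w + p w * (g w - q w)"
      by (simp add: algebra_simps)
    have "(cmod (f w * g w - p w * q w))\<^sup>2
      \<le> 2 * (cmod ((f w - p w) * g w))\<^sup>2 + 2 * (cmod (p w * (g w - q w)))\<^sup>2"
      unfolding eq by (rule cmod_square_triangle)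
    also have "\<dots> = 2 * ((cmod (f w - p w))\<^sup>2 * (cmod (g w))\<^sup>2) + 2 * ((cmod (p w))\<^sup>2 * (cmod (g w - q w))\<^sup>2)"
      by (simp add: norm_mult power_mult_distrib)
    also have "\<dots> \<le> 2 * ((cmod (f w - p w))\<^sup>2 * 1) + 2 * (B\<^sup>2 * (cmod (g w - q w))\<^sup>2)"
      using g w B[of w] unfolding trig_approx_def
      by (intro add_mono mult_left_mono mult_right_mono power_mono) (auto simp: power_le_one)
    finally show "(cmod (f w * g w - p w * q w))\<^sup>2
      \<le> 2 * (cmod (f w - p w))\<^sup>2 + 2 * B\<^sup>2 * (cmod (g w - q w))\<^sup>2" by (simp add: mult.assoc)
  qed simp
  also have "\<dots> = 2 * msd f p + 2 * (B\<^sup>2 * msd g q)"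
    using int by (simp add: mult.assoc)
  also have "\<dots> < 2 * (\<epsilon> / 4) + 2 * (\<epsilon> / 4)"
  proof (intro add_less_le_mono mult_strict_left_mono mult_left_mono p(2))
    have "B\<^sup>2 * msd g q \<le> B\<^sup>2 * (\<epsilon> / (4 * (1 + B\<^sup>2)))"
      using q(2) by (intro mult_left_mono) auto
    also have "\<dots> = (B\<^sup>2 / (1 + B\<^sup>2)) * (\<epsilon> / 4)" by simp
    also have "\<dots> \<le> 1 * (\<epsilon> / 4)"
      using \<epsilon> by (intro mult_right_mono) (auto simp: divide_le_eq add_pos_nonneg)
    finally show "B\<^sup>2 * msd g q \<le> \<epsilon> / 4" by simp
  qed auto
  finally have "expectation (\<lambda>w. (cmod (f w * g w - p w * q w))\<^sup>2) < \<epsilon>" by simp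
  with pq show "\<exists>p. trig_poly H p \<and> expectation (\<lambda>w. (cmod (f w * g w - p w))\<^sup>2) < \<epsilon>" by blast
qed

text \<open>Dominated convergence makes some \<open>f k\<close> close to \<open>g\<close> in mean
  square, and a polynomial close to this \<open>f k\<close> is close to \<open>g\<close>.\<close>

lemma trig_approx_limit:
  assumes f: "\<And>k::nat. trig_approx (f k)" and lim: "\<And>w. w \<in> space M \<Longrightarrow> (\<lambda>k. f k w) \<longlonglongrightarrow> g w"
  shows "trig_approx g"
  unfolding trig_approx_def
proof (intro conjI ballI allI impI)
  have fm[measurable]: "f k \<in> borel_measurable M" for k using f unfolding trig_approx_def by blast
  have fb: "cmod (f k w) \<le> 1" if "w \<in> space M" for k w using f that unfolding trig_approx_def by blast
  show gm[measurable]: "g \<in> borel_measurable M"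
    by (rule borel_measurable_LIMSEQ_metric[OF fm lim])
  show gb: "cmod (g w) \<le> 1" if "w \<in> space M" for w
    using tendsto_norm[OF lim[OF that]] fb[OF that] by (intro LIMSEQ_le_const2) auto
  fix \<epsilon> :: real assume \<epsilon>: "\<epsilon> > 0"
  have "(\<lambda>k. msd g (f k)) \<longlonglongrightarrow> expectation (\<lambda>_. 0)"
  proof (rule integral_dominated_convergence[where w="\<lambda>_. (1 + 1)\<^sup>2"])
    show "AE w in M. (\<lambda>k. (cmod (g w - f k w))\<^sup>2) \<longlonglongrightarrow> 0"
    proof (rule AE_I2)
      fix w assume "w \<in> space M"
      from lim[OF this] have "(\<lambda>k. (cmod (g w - f k w))\<^sup>2) \<longlonglongrightarrow> (cmod (g w - g w))\<^sup>2"
        by (intro tendsto_intros)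
      then show "(\<lambda>k. (cmod (g w - f k w))\<^sup>2) \<longlonglongrightarrow> 0" by simp
    qed
    show "AE w in M. norm ((cmod (g w - f k w))\<^sup>2) \<le> (1 + 1)\<^sup>2" for k
    proof (rule AE_I2)
      fix w assume w: "w \<in> space M"
      have "cmod (g w - f k w) \<le> 1 + 1"
        using norm_triangle_ineq4[of "g w" "f k w"] fb[OF w, of k] gb[OF w] by linarith
      then have "(cmod (g w - f k w))\<^sup>2 \<le> (1 + 1)\<^sup>2" by (intro power_mono) auto
      then show "norm ((cmod (g w - f k w))\<^sup>2) \<le> (1 + 1)\<^sup>2" by simp
    qed
  qed auto
  then have "\<forall>\<^sub>F k in sequentially. msd g (f k) < \<epsilon> / 4"
    using \<epsilon> by (intro order_tendstoD) auto
  then obtain k where k: "msd g (f k) < \<epsilon> / 4"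
    using eventually_happens'[OF sequentially_bot] by blast
  have "\<epsilon> / 4 > 0" using \<epsilon> by simp
  then obtain p where p: "trig_poly H p" "msd (f k) p < \<epsilon> / 4"
    using f[of k] unfolding trig_approx_def by meson
  have int: "integrable M (\<lambda>w. (cmod (g w - f k w))\<^sup>2)" "integrable M (\<lambda>w. (cmod (f k w - p w))\<^sup>2)"
    using gb fb trig_approx_integrable[OF f p(1)] by (auto intro!: integrable_cmod_square[where B=1 and C=1])
  have "msd g p
    \<le> expectation (\<lambda>w. 2 * (cmod (g w - f k w))\<^sup>2 + 2 * (cmod (f k w - p w))\<^sup>2)"
  proof (rule integral_mono')
    fix w
    show "(cmod (g w - p w))\<^sup>2 \<le> 2 * (cmod (g w - f k w))\<^sup>2 + 2 * (cmod (f k w - p w))\<^sup>2"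
      using cmod_square_triangle[of "g w - f k w" "f k w - p w"] by simp
  qed (use int in auto)
  also have "\<dots> < \<epsilon>" using int k p(2) by simp
  finally show "\<exists>p. trig_poly H p \<and> msd g p < \<epsilon>"
    using p(1) by blast
qed

text \<open>By Weierstrass there is a polynomial uniformly close to \<open>\<phi>\<close> on the
  range of \<open>q\<close>; composed with \<open>q\<close> it is again a trigonometric
  polynomial.\<close>

lemma trig_approx_continuous:
  assumes q: "trig_poly H (\<lambda>w. of_real (q w))" and qb: "\<And>w. \<bar>q w\<bar> \<le> 1"
    and \<phi>: "continuous_on UNIV \<phi>" and \<phi>b: "\<And>x. \<bar>\<phi> x\<bar> \<le> (1::real)"
  shows "trig_approx (\<lambda>w. of_real (\<phi> (q w)))"
  unfolding trig_approx_def
proof (intro conjI ballI allI impI)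
  have "(\<lambda>w. Re (of_real (q w))) \<in> borel_measurable M"
    using trig_poly_measurable[OF q] by measurable
  then have qm[measurable]: "q \<in> borel_measurable M" by simp
  have [measurable]: "\<phi> \<in> borel_measurable borel" using \<phi> by (rule borel_measurable_continuous_onI)
  show meas: "(\<lambda>w. complex_of_real (\<phi> (q w))) \<in> borel_measurable M" by measurable
  show "cmod (of_real (\<phi> (q w))) \<le> 1" for w using \<phi>b by simp
  fix \<epsilon> :: real assume \<epsilon>: "\<epsilon> > 0"
  have "compact {-1..1::real}" "continuous_on {-1..1} \<phi>" "0 < sqrt (\<epsilon> / 2)"
    using \<phi> \<epsilon> by (auto intro: continuous_on_subset)
  then obtain g where g: "real_polynomial_function g" "\<And>x. x \<in> {-1..1} \<Longrightarrow> \<bar>\<phi> x - g x\<bar> < sqrt (\<epsilon> / 2)"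
    by (rule Stone_Weierstrass_real_polynomial_function) auto
  have p: "trig_poly H (\<lambda>w. of_real (g (q w)))"
    by (rule trig_poly_real_polynomial[OF lin_H q g(1)])
  have b: "(cmod (of_real (\<phi> (q w)) - of_real (g (q w))))\<^sup>2 \<le> \<epsilon> / 2" for w
  proof -
    have "\<bar>\<phi> (q w) - g (q w)\<bar> \<le> sqrt (\<epsilon> / 2)"
      using g(2)[of "q w"] qb[of w] by (auto simp: abs_le_iff)
    then have "\<bar>\<phi> (q w) - g (q w)\<bar>\<^sup>2 \<le> (sqrt (\<epsilon> / 2))\<^sup>2" by (intro power_mono) auto
    then show ?thesis using \<epsilon> by (simp add: of_real_diff[symmetric] del: of_real_diff)
  qed
  have "expectation (\<lambda>w. (cmod (of_real (\<phi> (q w)) - of_real (g (q w))))\<^sup>2) \<le> expectation (\<lambda>_. \<epsilon> / 2)"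
    using b \<epsilon> by (intro integral_mono') auto
  also have "\<dots> < \<epsilon>" using \<epsilon> by (simp add: prob_space)
  finally show "\<exists>p. trig_poly H p \<and> expectation (\<lambda>w. (cmod (of_real (\<phi> (q w)) - p w))\<^sup>2) < \<epsilon>"
    using p by blast
qed

section \<open>The sigma-algebra of approximable events\<close>

definition trig_sets :: "'a set set" where
  "trig_sets = {A \<in> sets M. trig_approx (indicator A)}"

lemma trig_approx_poly_bounded:
  assumes "trig_poly H p" "\<And>w. w \<in> space M \<Longrightarrow> cmod (p w) \<le> 1"
  shows "trig_approx p"
  unfolding trig_approx_def using assms trig_poly_measurable[OF assms(1)]
  by (auto intro!: exI[of _ p])

text \<open>Complements use \<open>1 - p\<close>, intersections the product of indicators, and a
  countable union is the pointwise limit of its finite parts.\<close>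

lemma sigma_algebra_trig_sets: "sigma_algebra (space M) trig_sets"
proof -
  have compl: "space M - A \<in> trig_sets" if A: "A \<in> trig_sets" for A
  proof -
    have "trig_approx (indicator (space M - A))"
      unfolding trig_approx_def
    proof (intro conjI ballI allI impI)
      have [measurable]: "A \<in> sets M" using A by (simp add: trig_sets_def)
      show "indicator (space M - A) \<in> borel_measurable M" by measurable
      show "cmod (indicator (space M - A) w) \<le> 1" for w by (simp add: indicator_def)
      fix \<epsilon> :: real assume "\<epsilon> > 0"
      then obtain p where p: "trig_poly H p" "msd (indicator A) p < \<epsilon>"
        using A unfolding trig_sets_def trig_approx_def by auto
      have "trig_poly H (\<lambda>w. 1 + (-1) * p w)"
        by (intro trig_poly_add trig_poly_mult trig_poly_const lin_H p(1))
      moreover have "expectation (\<lambda>w. (cmod (indicator (space M - A) w - (1 + (-1) * p w)))\<^sup>2)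
        = msd (indicator A) p"
        by (intro Bochner_Integration.integral_cong refl)
          (auto simp: indicator_def norm_minus_commute)
      ultimately show "\<exists>p. trig_poly H p \<and> expectation (\<lambda>w. (cmod (indicator (space M - A) w - p w))\<^sup>2) < \<epsilon>"
        using p(2) by auto
    qed
    then show ?thesis using A by (auto simp: trig_sets_def)
  qed
  have inter: "A \<inter> B \<in> trig_sets" if "A \<in> trig_sets" "B \<in> trig_sets" for A B
  proof -
    have "trig_approx (\<lambda>w. indicator A w * indicator B w)"
      using that by (intro trig_approx_mult) (auto simp: trig_sets_def)
    moreover have "(\<lambda>w. indicator A w * indicator B w :: complex) = indicator (A \<inter> B)"
      by (auto simp: indicator_def fun_eq_iff)
    ultimately show ?thesis using that by (auto simp: trig_sets_def)
  qed
  have empty: "{} \<in> trig_sets"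
  proof -
    have "indicator {} = (\<lambda>_::'a. 0::complex)" by (simp add: fun_eq_iff)
    then show ?thesis
      using trig_approx_poly_bounded[OF trig_poly_zero] by (simp add: trig_sets_def)
  qed
  have sub: "A \<subseteq> space M" if "A \<in> trig_sets" for A
    using that sets.sets_into_space by (auto simp: trig_sets_def)
  have union: "A \<union> B \<in> trig_sets" if "A \<in> trig_sets" "B \<in> trig_sets" for A B
  proof -
    have "A \<union> B = space M - ((space M - A) \<inter> (space M - B))" using that[THEN sub] by blast
    then show ?thesis using compl inter that by simp
  qed
  show ?thesis
    unfolding sigma_algebra_iff2
  proof (intro conjI ballI allI impI)
    show "trig_sets \<subseteq> Pow (space M)" using sub by blast
    fix A :: "nat \<Rightarrow> 'a set" assume A: "range A \<subseteq> trig_sets"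
    have U: "(\<Union>i<k. A i) \<in> trig_sets" for k
    proof (induction k)
      case (Suc k)
      have "(\<Union>i<Suc k. A i) = A k \<union> (\<Union>i<k. A i)" by (simp add: lessThan_Suc)
      moreover have "A k \<in> trig_sets" using A by blast
      ultimately show ?case using union[OF _ Suc] by simp
    qed (simp add: empty)
    have "trig_approx (indicator (\<Union>i. A i))"
    proof (rule trig_approx_limit)
      show "trig_approx (indicator (\<Union>i<k. A i))" for k using U by (auto simp: trig_sets_def)
      show "(\<lambda>k. indicator (\<Union>i<k. A i) w) \<longlonglongrightarrow> indicator (\<Union>i. A i) w" for w
        by (rule LIMSEQ_indicator_UN)
    qed
    moreover have "(\<Union>i. A i) \<in> sets M" using A by (auto simp: trig_sets_def)
    ultimately show "\<Union> (range A) \<in> trig_sets" by (simp add: trig_sets_def)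
  qed (use empty compl in auto)
qed

text \<open>\<open>U\<close> is unbounded, so Weierstrass approximation on an interval cannot be
  applied to it. The bounded trigonometric polynomial \<open>sin ((U - a) / (n + 1))\<close>
  replaces \<open>U - a\<close>: at each point it has the same sign as soon as \<open>n\<close> is
  so large that its argument is less than \<open>pi\<close> in modulus.\<close>

lemma halfspace_trig_sets:
  assumes U: "U \<in> H"
  shows "{w \<in> space M. a < U w} \<in> trig_sets"
proof -
  have [measurable]: "U \<in> borel_measurable M" using U H_sub measurable_\<G> by auto
  define s where "s = (\<lambda>n w. sin (1 / real (Suc n) * (U w - a)))"
  have pos: "trig_approx (indicator {w. 0 < s n w})" for n
  \<comment> \<open>For fixed \<open>n\<close> the continuous ramps rise to the indicator of
    \<open>0 < s n w\<close>; at \<open>s n w = 0\<close> they are all 0, as required for a strict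
    inequality.\<close>
  proof (rule trig_approx_limit[where f = "\<lambda>k w. of_real (min 1 (max 0 (real k * s n w)))"])
    fix k
    show "trig_approx (\<lambda>w. of_real (min 1 (max 0 (real k * s n w))))"
    proof (rule trig_approx_continuous[where q = "s n" and \<phi> = "\<lambda>x. min 1 (max 0 (real k * x))"])
      show "trig_poly H (\<lambda>w. of_real (s n w))"
        unfolding s_def by (rule trig_poly_sin[OF lin_H U])
      show "\<bar>s n w\<bar> \<le> 1" for w by (simp add: s_def abs_sin_le_one)
    qed (auto intro!: continuous_intros)
  next
    fix w
    show "(\<lambda>k. complex_of_real (min 1 (max 0 (real k * s n w)))) \<longlonglongrightarrow> indicator {w. 0 < s n w} w"
    proof (cases "0 < s n w")
      case True
      from ex_less_of_nat_mult[OF this, of 1] obtain K :: nat where K: "1 < real K * s n w"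
        by blast
      have "\<forall>\<^sub>F k in sequentially. complex_of_real (min 1 (max 0 (real k * s n w))) = 1"
        using eventually_ge_at_top[of K]
      proof eventually_elim
        case (elim k)
        then have "real K * s n w \<le> real k * s n w" using True by (intro mult_right_mono) auto
        then show ?case using K by simp
      qed
      then show ?thesis using True by (auto intro: tendsto_eventually)
    next
      case False
      then have "max 0 (real k * s n w) = 0" for k by (simp add: mult_nonneg_nonpos)
      then show ?thesis using False by simp
    qed
  qed
  have "trig_approx (indicator {w \<in> space M. a < U w})"
  proof (rule trig_approx_limit[OF pos])
    fix w assume w: "w \<in> space M"
    obtain K :: nat where K: "\<bar>U w - a\<bar> < real K" using reals_Archimedean2 by blast
    have "\<forall>\<^sub>F n in sequentially. indicator {w. 0 < s n w} w = (indicator {w \<in> space M. a < U w} w :: complex)"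
      using eventually_ge_at_top[of K]
    proof eventually_elim
      case (elim n)
      define y where "y = 1 / real (Suc n) * (U w - a)"
      have "\<bar>U w - a\<bar> < real (Suc n)" using K elim by simp
      then have "\<bar>y\<bar> < 1" by (simp add: y_def abs_mult field_simps)
      then have y: "- pi < y" "y < pi" using pi_gt3 by linarith+
      have "0 < sin y \<longleftrightarrow> 0 < y"
      proof (cases "0 < y")
        case True
        then show ?thesis using sin_gt_zero y by simp
      next
        case False
        then have "0 \<le> sin (- y)" using y by (intro sin_ge_zero) auto
        then show ?thesis using False by simp
      qed
      also have "0 < y \<longleftrightarrow> a < U w" by (simp add: y_def zero_less_divide_iff)
      finally show ?case using w by (simp add: indicator_def s_def y_def)
    qed
    then show "(\<lambda>n. indicator {w. 0 < s n w} w :: complex) \<longlonglongrightarrow> indicator {w \<in> space M. a < U w} w"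
      by (rule tendsto_eventually)
  qed
  then show ?thesis by (simp add: trig_sets_def)
qed

lemma measurable_trig_sets:
  assumes U: "U \<in> H"
  shows "U \<in> borel_measurable (sigma (space M) trig_sets)"
proof -
  interpret S: sigma_algebra "space M" trig_sets by (rule sigma_algebra_trig_sets)
  show ?thesis
    using halfspace_trig_sets[OF U] by (simp add: borel_measurable_iff_greater S.sets_measure_of_eq S.space_measure_of_eq)
qed

end

text \<open>\<open>trig_poly_ccov_le\<close> passes to the mean-square limit. The variances of the
  two indicators are bounded by 1 each, and their sum cancels the factor 2 on the left.\<close>

lemma (in gaussian_space) gebelein:
  assumes H1: "linear_space H1" "H1 \<subseteq> \<G>" and H2: "linear_space H2" "H2 \<subseteq> \<G>"
    and \<rho>: "\<And>U V. U \<in> H1 \<Longrightarrow> V \<in> H2 \<Longrightarrow>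
      - 2 * ip U V \<le> \<rho> * (msq U + msq V)"
    and \<rho>0: "0 \<le> \<rho>"
    and A: "A \<in> gaussian_subspace.trig_sets M H1" and B: "B \<in> gaussian_subspace.trig_sets M H2"
  shows "prob (A \<inter> B) - prob A * prob B \<le> \<rho>"
proof -
  interpret S1: gaussian_subspace M \<G> H1 by standard (use H1 in auto)
  interpret S2: gaussian_subspace M \<G> H2 by standard (use H2 in auto)
  define f :: "'a \<Rightarrow> complex" where "f = indicator A"
  define g :: "'a \<Rightarrow> complex" where "g = indicator B"
  have [measurable]: "A \<in> sets M" "B \<in> sets M" using A B by (auto simp: S1.trig_sets_def S2.trig_sets_def)
  have fg: "S1.trig_approx f" "S2.trig_approx g"
    using A B by (auto simp: S1.trig_sets_def S2.trig_sets_def f_def g_def)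
  have fm: "f \<in> borel_measurable M" "g \<in> borel_measurable M"
    unfolding f_def g_def by measurable
  have "\<forall>n. \<exists>p. trig_poly H1 p \<and> msd f p < 1 / real (Suc n)"
    using fg(1) unfolding S1.trig_approx_def by simp
  then obtain p where p: "\<And>n. trig_poly H1 (p n)" "\<And>n. msd f (p n) < 1 / real (Suc n)"
    by metis
  have "\<forall>n. \<exists>p. trig_poly H2 p \<and> msd g p < 1 / real (Suc n)"
    using fg(2) unfolding S2.trig_approx_def by simp
  then obtain q where q: "\<And>n. trig_poly H2 (q n)" "\<And>n. msd g (q n) < 1 / real (Suc n)"
    by metis
  have lim: "(\<lambda>n. msd h (r n)) \<longlonglongrightarrow> 0"
    if "\<And>n. msd h (r n) < 1 / real (Suc n)" for h r
  proof (rule tendsto_sandwich[OF _ _ tendsto_const LIMSEQ_inverse_real_of_nat])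
    show "\<forall>\<^sub>F n in sequentially. msd h (r n) \<le> inverse (real (Suc n))"
      using that by (intro always_eventually allI less_imp_le) (simp add: inverse_eq_divide)
  qed simp
  have conv: "(\<lambda>n. ccov M (P n) (Q n)) \<longlonglongrightarrow> ccov M F G"
    if "F \<in> borel_measurable M" "G \<in> borel_measurable M"
      "\<And>n. P n \<in> borel_measurable M" "\<And>n. Q n \<in> borel_measurable M"
      "\<And>w. cmod (F w) \<le> 1" "\<And>w. cmod (G w) \<le> 1"
      "\<And>n. \<exists>B. \<forall>w. cmod (P n w) \<le> B" "\<And>n. \<exists>B. \<forall>w. cmod (Q n w) \<le> B"
      "\<And>n. msd F (P n) < 1 / real (Suc n)"
      "\<And>n. msd G (Q n) < 1 / real (Suc n)"
    for F G P Q
  proof -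
    \<comment> \<open>With the constant 1 as second factor, convergence of products becomes
      convergence of means.\<close>
    have "(\<lambda>n. expectation (\<lambda>w. P n w * cnj 1)) \<longlonglongrightarrow> expectation (\<lambda>w. F w * cnj 1)"
      using that by (intro L2_tendsto_product[where g = "\<lambda>_. 1" and q = "\<lambda>_ _. 1"] lim) auto
    moreover have "(\<lambda>n. expectation (\<lambda>w. Q n w * cnj 1)) \<longlonglongrightarrow> expectation (\<lambda>w. G w * cnj 1)"
      using that by (intro L2_tendsto_product[where g = "\<lambda>_. 1" and q = "\<lambda>_ _. 1"] lim) auto
    moreover have "(\<lambda>n. expectation (\<lambda>w. P n w * cnj (Q n w))) \<longlonglongrightarrow> expectation (\<lambda>w. F w * cnj (G w))"
      using that by (intro L2_tendsto_product lim) auto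
    ultimately show ?thesis unfolding ccov_def by (intro tendsto_intros) auto
  qed
  have b: "cmod (f w) \<le> 1" "cmod (g w) \<le> 1" for w by (simp_all add: f_def g_def indicator_def)
  note props = fm b p q S1.trig_poly_measurable[OF p(1)] S2.trig_poly_measurable[OF q(1)]
    S1.trig_poly_bounded[OF p(1)] S2.trig_poly_bounded[OF q(1)]
  have "(\<lambda>n. 2 * Re (ccov M (p n) (q n))) \<longlonglongrightarrow> 2 * Re (ccov M f g)"
    using props by (intro tendsto_intros conv) auto
  moreover have "(\<lambda>n. \<rho> * Re (ccov M (p n) (p n) + ccov M (q n) (q n))) \<longlonglongrightarrow> \<rho> * Re (ccov M f f + ccov M g g)"
    using props by (intro tendsto_intros conv) auto
  ultimately have le: "2 * Re (ccov M f g) \<le> \<rho> * Re (ccov M f f + ccov M g g)"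
    by (rule LIMSEQ_le) (use trig_poly_ccov_le[OF H1 H2 \<rho> p(1) q(1)] in blast)
  have ind: "ccov M (indicator C) (indicator D) = of_real (prob (C \<inter> D) - prob C * prob D)"
    if [measurable]: "C \<in> sets M" "D \<in> sets M" for C D
  proof -
    have "(\<lambda>w. indicator C w * cnj (indicator D w)) = (\<lambda>w. complex_of_real (indicator (C \<inter> D) w))"
      "indicator C = (\<lambda>w. complex_of_real (indicator C w))" "indicator D = (\<lambda>w. complex_of_real (indicator D w))"
      by (auto simp: indicator_def fun_eq_iff)
    then show ?thesis unfolding ccov_def by simp
  qed
  have "ccov M f f + ccov M g g = of_real ((prob A - prob A * prob A) + (prob B - prob B * prob B))"
    unfolding f_def g_def by (simp add: ind)
  then have "2 * (prob (A \<inter> B) - prob A * prob B) \<le> \<rho> * ((prob A - prob A * prob A) + (prob B - prob B * prob B))"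
    using le unfolding f_def g_def by (simp add: ind)
  also have "\<dots> \<le> \<rho> * (1 + 1)"
  proof -
    have "prob X - prob X * prob X \<le> 1" for X
      using prob_le_1[of X] measure_nonneg[of M X] mult_nonneg_nonneg[of "prob X" "prob X"] by linarith
    then show ?thesis by (intro mult_left_mono add_mono \<rho>0) auto
  qed
  finally show ?thesis by simp
qed

section \<open>Blocks of a stationary Gaussian process\<close>

lemma spectral_density_fourier_cos:
  assumes "is_spectral_density f \<gamma>"
  shows "\<gamma> n = fourier_cos f n"
proof -
  have f: "set_integrable lborel circ f" using assms unfolding is_spectral_density_def by blast
  have [measurable]: "(\<lambda>l. indicator circ l * f l) \<in> borel_measurable lborel"
    using f unfolding set_integrable_def by simp
  let ?e = "\<lambda>l. exp (\<i> * of_int n * complex_of_real l)"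
  have e: "?e l = cis (of_int n * l)" for l
    by (simp add: cis_conv_exp mult_ac)
  have int: "integrable lborel (\<lambda>l. complex_of_real (indicator circ l * f l) * ?e l)"
  proof (rule Bochner_Integration.integrable_bound)
    show "integrable lborel (\<lambda>l. indicator circ l * f l)"
      using f unfolding set_integrable_def by simp
    show "AE l in lborel. norm (complex_of_real (indicator circ l * f l) * ?e l) \<le> norm (indicator circ l * f l)"
      unfolding e by (simp add: norm_mult)
  qed measurable
  have "complex_of_real (\<gamma> n) = (LINT l:circ|lborel. complex_of_real (f l) * ?e l)"
    using assms unfolding is_spectral_density_def by blast
  also have "\<dots> = (LINT l|lborel. complex_of_real (indicator circ l * f l) * ?e l)"
    unfolding set_lebesgue_integral_def
    by (intro Bochner_Integration.integral_cong) (auto simp: indicator_def)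
  finally have "\<gamma> n = Re (LINT l|lborel. complex_of_real (indicator circ l * f l) * ?e l)"
    by (metis Re_complex_of_real)
  also have "\<dots> = (LINT l|lborel. Re (complex_of_real (indicator circ l * f l) * ?e l))"
    by (rule integral_Re[OF int, symmetric])
  also have "\<dots> = fourier_cos f n"
    unfolding fourier_cos_def set_lebesgue_integral_def e by (simp add: mult_ac)
  finally show ?thesis .
qed

definition process_span :: "(int \<Rightarrow> 'a \<Rightarrow> real) \<Rightarrow> ('a \<Rightarrow> real) set" where
  "process_span Z = {W. \<exists>I a. finite I \<and> W = (\<lambda>w. \<Sum>i\<in>I. a i * Z i w)}"

text \<open>Offsets start at 0 to match \<open>toeplitz_form\<close>; the indices covered are
  \<open>i, ..., i + m - 1\<close>, the same as in \<open>block X i m\<close>, whose components are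
  numbered from 1.\<close>

definition block_span :: "(int \<Rightarrow> 'a \<Rightarrow> real) \<Rightarrow> int \<Rightarrow> nat \<Rightarrow> ('a \<Rightarrow> real) set" where
  "block_span Z i m = {W. \<exists>a. W = (\<lambda>w. \<Sum>j<m. a j * Z (i + int j) w)}"

lemma process_spanI: "finite I \<Longrightarrow> (\<lambda>w. \<Sum>i\<in>I. a i * Z i w) \<in> process_span Z"
  unfolding process_span_def by blast

lemma block_spanI: "(\<lambda>w. \<Sum>j<m. a j * Z (i + int j) w) \<in> block_span Z i m"
  unfolding block_span_def by (simp, rule exI[of _ a], simp)

lemma linear_space_process_span: "linear_space (process_span Z)"
  unfolding linear_space_def
proof (intro conjI ballI allI)
  show "(\<lambda>_. 0) \<in> process_span Z"
    unfolding process_span_def by (auto intro!: exI[of _ "{}"])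
  fix U V and a b :: real assume "U \<in> process_span Z" "V \<in> process_span Z"
  then obtain I J u v where I: "finite I" "U = (\<lambda>w. \<Sum>i\<in>I. u i * Z i w)" and J: "finite J" "V = (\<lambda>w. \<Sum>i\<in>J. v i * Z i w)"
    unfolding process_span_def by blast
  define c where "c = (\<lambda>i. a * (if i \<in> I then u i else 0) + b * (if i \<in> J then v i else 0))"
  have "a * U w + b * V w = (\<Sum>i\<in>I \<union> J. c i * Z i w)" for w
  proof -
    have "(\<Sum>i\<in>I. u i * Z i w) = (\<Sum>i\<in>I \<union> J. (if i \<in> I then u i else 0) * Z i w)"
      using I(1) J(1) by (intro sum.mono_neutral_cong_left) auto
    moreover have "(\<Sum>i\<in>J. v i * Z i w) = (\<Sum>i\<in>I \<union> J. (if i \<in> J then v i else 0) * Z i w)"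
      using I(1) J(1) by (intro sum.mono_neutral_cong_left) auto
    ultimately show ?thesis
      unfolding I(2) J(2) c_def by (simp add: sum_distrib_left sum.distrib distrib_right mult.assoc)
  qed
  then show "(\<lambda>w. a * U w + b * V w) \<in> process_span Z"
    using process_spanI[of "I \<union> J" c Z] I(1) J(1) by simp
qed

lemma linear_space_block_span: "linear_space (block_span Z i m)"
  unfolding linear_space_def
proof (intro conjI ballI allI)
  show "(\<lambda>_. 0) \<in> block_span Z i m"
    unfolding block_span_def by (auto intro!: exI[of _ "\<lambda>_. 0"])
  fix U V and a b :: real assume "U \<in> block_span Z i m" "V \<in> block_span Z i m"
  then obtain u v where U: "U = (\<lambda>w. \<Sum>j<m. u j * Z (i + int j) w)" and V: "V = (\<lambda>w. \<Sum>j<m. v j * Z (i + int j) w)"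
    unfolding block_span_def by blast
  have eq: "(\<lambda>w. a * U w + b * V w) = (\<lambda>w. \<Sum>j<m. (a * u j + b * v j) * Z (i + int j) w)"
    unfolding U V by (simp add: sum_distrib_left sum.distrib distrib_right mult.assoc)
  show "(\<lambda>w. a * U w + b * V w) \<in> block_span Z i m"
    unfolding eq by (rule block_spanI)
qed

lemma block_span_subset: "block_span Z i m \<subseteq> process_span Z"
proof
  fix W assume "W \<in> block_span Z i m"
  then obtain a where W: "W = (\<lambda>w. \<Sum>j<m. a j * Z (i + int j) w)" unfolding block_span_def by blast
  have inj: "inj_on (\<lambda>j. i + int j) {..<m}" by (auto simp: inj_on_def)
  have "W = (\<lambda>w. \<Sum>l\<in>(\<lambda>j. i + int j) ` {..<m}. a (nat (l - i)) * Z l w)"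
    unfolding W by (subst sum.reindex[OF inj]) simp
  then show "W \<in> process_span Z"
    by (simp only:) (intro process_spanI finite_imageI finite_lessThan)
qed

lemma in_process_span: "Z i \<in> process_span Z"
  unfolding process_span_def by (auto intro!: exI[of _ "{i}"] exI[of _ "\<lambda>_. 1"])

lemma in_block_span: "i \<le> l \<Longrightarrow> l < i + int m \<Longrightarrow> Z l \<in> block_span Z i m"
proof -
  assume l: "i \<le> l" "l < i + int m"
  define j where "j = nat (l - i)"
  have j: "j < m" "l = i + int j" using l by (auto simp: j_def)
  have eq: "Z l = (\<lambda>w. \<Sum>j'<m. (if j' = j then 1 else 0) * Z (i + int j') w)"
    using j by (simp add: if_distrib[of "\<lambda>x. x * _"] cong: if_cong)
  show "Z l \<in> block_span Z i m" by (subst eq) (rule block_spanI)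
qed

lemma (in prob_space) gaussian_space_process_span:
  assumes Z: "gaussian_process M Z" and mean: "\<And>n. expectation (Z n) = 0" and var: "\<And>n. variance (Z n) = 1"
  shows "gaussian_space M (process_span Z)"
proof -
  have normal: "normal_rv M W" if "W \<in> process_span Z" for W
    using that Z unfolding process_span_def gaussian_process_def by blast
  have [measurable]: "Z n \<in> borel_measurable M" for n
    using normal[OF in_process_span] unfolding normal_rv_def by blast
  \<comment> \<open>A square that is not integrable would have integral 0 by convention, so variance
    1 forces integrability.\<close>
  have sq: "integrable M (\<lambda>w. (Z n w)\<^sup>2)" for n
    using var[of n] mean[of n] not_integrable_integral_eq[of M "\<lambda>w. (Z n w)\<^sup>2"] by fastforce
  have int: "integrable M (Z n)" for n
    by (rule square_integrable_imp_integrable[OF _ sq]) measurable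
  have prod: "integrable M (\<lambda>w. Z i w * Z j w)" for i j
  proof (rule Bochner_Integration.integrable_bound)
    show "integrable M (\<lambda>w. (Z i w)\<^sup>2 + (Z j w)\<^sup>2)" using sq by simp
    show "AE w in M. norm (Z i w * Z j w) \<le> norm ((Z i w)\<^sup>2 + (Z j w)\<^sup>2)"
      using abs_mult_le_sum_squares by simp
  qed measurable
  show ?thesis
  proof
    fix U assume "U \<in> process_span Z"
    then obtain I a where U: "finite I" "U = (\<lambda>w. \<Sum>i\<in>I. a i * Z i w)" unfolding process_span_def by blast
    show "expectation U = 0"
      unfolding U(2) using int mean by (subst Bochner_Integration.integral_sum) auto
    have "(\<lambda>w. (U w)\<^sup>2) = (\<lambda>w. \<Sum>i\<in>I. \<Sum>j\<in>I. a i * a j * (Z i w * Z j w))"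
      unfolding U(2) power2_eq_square sum_product by (simp add: mult_ac)
    then show "integrable M (\<lambda>w. (U w)\<^sup>2)"
      by (simp only:) (intro Bochner_Integration.integrable_sum integrable_mult_right prod)
  qed (use normal linear_space_process_span in auto)
qed

lemma (in gaussian_space) expectation_block_product:
  assumes Z: "\<And>i. Z i \<in> \<G>" and \<gamma>: "\<And>i j. ip (Z i) (Z j) = \<gamma> (j - i)"
  shows "expectation (\<lambda>w. (\<Sum>j<m. a j * Z (i + int j) w) * (\<Sum>l<m. b l * Z (i + k + int l) w))
    = toeplitz_form \<gamma> k m a b"
proof -
  have "expectation (\<lambda>w. (\<Sum>j<m. a j * Z (i + int j) w) * (\<Sum>l<m. b l * Z (i + k + int l) w))
    = expectation (\<lambda>w. \<Sum>j<m. \<Sum>l<m. a j * b l * (Z (i + int j) w * Z (i + k + int l) w))"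
    by (simp add: sum_product mult_ac)
  also have "\<dots> = (\<Sum>j<m. expectation (\<lambda>w. \<Sum>l<m. a j * b l * (Z (i + int j) w * Z (i + k + int l) w)))"
    by (intro Bochner_Integration.integral_sum Bochner_Integration.integrable_sum
        integrable_mult_right integrable_mult_\<G> Z)
  also have "\<dots> = (\<Sum>j<m. \<Sum>l<m. expectation (\<lambda>w. a j * b l * (Z (i + int j) w * Z (i + k + int l) w)))"
    by (intro sum.cong refl Bochner_Integration.integral_sum integrable_mult_right integrable_mult_\<G> Z)
  also have "\<dots> = toeplitz_form \<gamma> k m a b"
    unfolding toeplitz_form_def by (simp add: \<gamma> algebra_simps)
  finally show ?thesis .
qed

text \<open>The hypothesis of \<open>gebelein\<close> has \<open>2 * ip U V\<close> on its left,
  hence \<open>\<rho> = 2 * \<delta>\<close>.\<close>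

lemma (in gaussian_space) gebelein_blocks:
  assumes Z: "\<And>i. Z i \<in> \<G>" and \<gamma>: "\<And>i j. ip (Z i) (Z j) = \<gamma> (j - i)"
    and sub: "\<And>i m. block_span Z i m \<subseteq> \<G>" and \<delta>: "0 \<le> \<delta>"
    and le: "\<And>a b. \<bar>toeplitz_form \<gamma> k m a b\<bar> \<le> \<delta> * (toeplitz_form \<gamma> 0 m a a + toeplitz_form \<gamma> 0 m b b)"
    and A: "A \<in> gaussian_subspace.trig_sets M (block_span Z i m)"
    and B: "B \<in> gaussian_subspace.trig_sets M (block_span Z (i + k) m)"
  shows "prob (A \<inter> B) - prob A * prob B \<le> 2 * \<delta>"
proof (rule gebelein[OF linear_space_block_span sub linear_space_block_span sub _ _ A B])
  fix U V assume "U \<in> block_span Z i m" "V \<in> block_span Z (i + k) m"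
  then obtain a b where U: "U = (\<lambda>w. \<Sum>j<m. a j * Z (i + int j) w)" and V: "V = (\<lambda>w. \<Sum>l<m. b l * Z (i + k + int l) w)"
    unfolding block_span_def by blast
  have "ip U V = toeplitz_form \<gamma> k m a b"
    unfolding U V by (rule expectation_block_product[where Z = Z and \<gamma> = \<gamma>, OF Z \<gamma>])
  moreover have "msq U = toeplitz_form \<gamma> 0 m a a"
    using expectation_block_product[where Z = Z and \<gamma> = \<gamma> and m = m and a = a and b = a and i = i and k = 0, OF Z \<gamma>] by (simp add: U power2_eq_square)
  moreover have "msq V = toeplitz_form \<gamma> 0 m b b"
    using expectation_block_product[where Z = Z and \<gamma> = \<gamma> and m = m and a = b and b = b and i = "i + k" and k = 0, OF Z \<gamma>] by (simp add: V power2_eq_square)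
  ultimately show "- 2 * ip U V
      \<le> 2 * \<delta> * (msq U + msq V)"
    using le[of a b] by (simp add: abs_le_iff)
qed (use \<delta> in simp)

text \<open>\<open>M'\<close> is arbitrary because the lemma is applied both to \<open>M\<close> and
  to the sigma-algebra of approximable events.\<close>

lemma measurable_block:
  assumes G: "G \<in> borel_measurable borel" and X: "\<And>n w. X n w = G (Z n w)"
    and Z: "\<And>l. int i \<le> l \<Longrightarrow> l < int i + int m \<Longrightarrow> Z l \<in> borel_measurable M'"
  shows "block X i m \<in> measurable M' (\<Pi>\<^sub>M j\<in>{1..m}. borel)"
  unfolding block_def X
proof (rule measurable_restrict)
  fix j assume "j \<in> {1..m}"
  then have [measurable]: "Z (int i + int j - 1) \<in> borel_measurable M'" by (intro Z) auto
  show "(\<lambda>w. G (Z (int i + int j - 1) w)) \<in> borel_measurable M'"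
    using G by measurable
qed

text \<open>\<open>S\<close> and \<open>G\<close> are arbitrary measurable functions, so the event
  is reached through the sigma-algebra: each \<open>Z l\<close> of the block is measurable for it,
  hence the statistic is.\<close>

lemma (in gaussian_subspace) block_event_trig_sets:
  assumes G: "G \<in> borel_measurable borel" and X: "\<And>n w. X n w = G (Z n w)"
    and Z: "\<And>l. int i \<le> l \<Longrightarrow> l < int i + int m \<Longrightarrow> Z l \<in> H"
    and S: "S \<in> borel_measurable (\<Pi>\<^sub>M j\<in>{1..m}. borel)"
  shows "{w \<in> space M. S (block X i m w) \<le> (x::real)} \<in> trig_sets"
proof -
  interpret S: sigma_algebra "space M" trig_sets by (rule sigma_algebra_trig_sets)
  have [measurable]: "block X i m \<in> measurable (sigma (space M) trig_sets) (\<Pi>\<^sub>M j\<in>{1..m}. borel)"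
    by (rule measurable_block[where G = G and Z = Z]) (use G X Z measurable_trig_sets in auto)
  have "(\<lambda>w. S (block X i m w)) \<in> borel_measurable (sigma (space M) trig_sets)"
    using S by measurable
  then have "{w \<in> space (sigma (space M) trig_sets). S (block X i m w) \<le> x} \<in> sets (sigma (space M) trig_sets)"
    by measurable
  then show ?thesis by (simp add: S.sets_measure_of_eq S.space_measure_of_eq)
qed

lemma (in prob_space) stationary_block_distr:
  assumes Z: "stationary_process M Z" and G: "G \<in> borel_measurable borel" and X: "\<And>n w. X n w = G (Z n w)"
    and S[measurable]: "S \<in> borel_measurable (\<Pi>\<^sub>M j\<in>{1..m}. borel)"
  shows "distr M borel (\<lambda>w. S (block X i m w) :: real) = distr M borel (\<lambda>w. S (block X 1 m w))"
proof -
  define I where "I = int ` {1..m}"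
  define \<Phi> where "\<Phi> = (\<lambda>z::int \<Rightarrow> real. S (\<lambda>j\<in>{1..m}. G (z (int j))))"
  have [measurable]: "Z n \<in> borel_measurable M" for n using Z unfolding stationary_process_def by blast
  have [measurable]: "\<Phi> \<in> borel_measurable (\<Pi>\<^sub>M i\<in>I. borel)"
  proof -
    have "(\<lambda>z. \<lambda>j\<in>{1..m}. G (z (int j))) \<in> measurable (\<Pi>\<^sub>M i\<in>I. borel) (\<Pi>\<^sub>M j\<in>{1..m}. borel)"
    proof (rule measurable_restrict)
      fix j assume "j \<in> {1..m}"
      then have "(\<lambda>z. z (int j)) \<in> borel_measurable (\<Pi>\<^sub>M i\<in>I. borel)"
        by (intro measurable_component_singleton) (auto simp: I_def)
      then show "(\<lambda>z. G (z (int j))) \<in> borel_measurable (\<Pi>\<^sub>M i\<in>I. borel)"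
        using G by measurable
    qed
    then show ?thesis unfolding \<Phi>_def by measurable
  qed
  \<comment> \<open>Block \<open>i'\<close> begins with \<open>Z i'\<close> while the index set
    begins with 1, so the shift is \<open>i' - 1\<close>.\<close>
  have eq: "S (block X i' m w) = \<Phi> (\<lambda>t\<in>I. Z (t + (int i' - 1)) w)" for i' w
  proof -
    have "block X i' m w = (\<lambda>j\<in>{1..m}. G ((\<lambda>t\<in>I. Z (t + (int i' - 1)) w) (int j)))"
      unfolding block_def X by (rule restrict_ext) (auto simp: I_def algebra_simps)
    then show ?thesis unfolding \<Phi>_def by simp
  qed
  have dist: "distr M borel (\<lambda>w. S (block X i' m w)) = distr (distr M (\<Pi>\<^sub>M i\<in>I. borel) (\<lambda>w. \<lambda>t\<in>I. Z (t + (int i' - 1)) w)) borel \<Phi>" for i'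
    unfolding eq by (subst distr_distr) (auto simp: o_def)
  have "finite I" by (simp add: I_def)
  then have "distr M (\<Pi>\<^sub>M i\<in>I. borel) (\<lambda>w. \<lambda>t\<in>I. Z (t + h) w) = distr M (\<Pi>\<^sub>M i\<in>I. borel) (\<lambda>w. \<lambda>t\<in>I. Z t w)" for h
    using Z unfolding stationary_process_def by blast
  then show ?thesis unfolding dist by simp
qed

lemma (in prob_space) stationary_covariance:
  assumes Z: "stationary_process M Z" and mean: "\<And>n. expectation (Z n) = 0"
  shows "ip (Z i) (Z j) = covariance M (Z (i - j)) (Z 0)"
proof -
  define I where "I = {i - j, 0}"
  have [measurable]: "Z n \<in> borel_measurable M" for n using Z unfolding stationary_process_def by blast
  have [measurable]: "(\<lambda>z. z (i - j) * z 0 :: real) \<in> borel_measurable (\<Pi>\<^sub>M i\<in>I. borel)"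
    by (intro borel_measurable_times measurable_component_singleton) (auto simp: I_def)
  have "finite I" by (simp add: I_def)
  then have d: "distr M (\<Pi>\<^sub>M i\<in>I. borel) (\<lambda>w. \<lambda>t\<in>I. Z (t + j) w) = distr M (\<Pi>\<^sub>M i\<in>I. borel) (\<lambda>w. \<lambda>t\<in>I. Z t w)"
    using Z unfolding stationary_process_def by blast
  have "ip (Z i) (Z j)
    = integral\<^sup>L (distr M (\<Pi>\<^sub>M i\<in>I. borel) (\<lambda>w. \<lambda>t\<in>I. Z (t + j) w)) (\<lambda>z. z (i - j) * z 0)"
    by (subst integral_distr) (auto simp: I_def)
  also have "\<dots> = expectation (\<lambda>w. Z (i - j) w * Z 0 w)"
    unfolding d by (subst integral_distr) (auto simp: I_def)
  also have "\<dots> = covariance M (Z (i - j)) (Z 0)"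
    by (simp add: covariance_def mean)
  finally show ?thesis .
qed

section \<open>Weak dependence of block events and the variance of their averages\<close>

abbreviation (in prob_space) (input) block_event ::
    "(int \<Rightarrow> 'a \<Rightarrow> real) \<Rightarrow> ((nat \<Rightarrow> real) \<Rightarrow> real) \<Rightarrow> nat \<Rightarrow> nat \<Rightarrow> real \<Rightarrow> 'a set" where
  "block_event X S i m x \<equiv> {w \<in> space M. S (block X i m w) \<le> x}"

text \<open>One \<open>K\<close> serves all block lengths, statistics and levels, so it stays fixed
  while the block size grows with \<open>n\<close>. The bound is one-sided, which is enough to
  estimate a variance, and \<open>K * m\<close> separates the starting points of the blocks.\<close>

definition (in prob_space) mixing_gap :: "(int \<Rightarrow> 'a \<Rightarrow> real) \<Rightarrow> real \<Rightarrow> nat \<Rightarrow> bool" where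
  "mixing_gap X \<delta> K \<longleftrightarrow> (\<forall>m i j S x. 2 \<le> m \<longrightarrow> S \<in> borel_measurable (\<Pi>\<^sub>M j\<in>{1..m}. borel) \<longrightarrow> i + K * m \<le> j \<longrightarrow>
    prob (block_event X S i m x \<inter> block_event X S j m x)
      - prob (block_event X S i m x) * prob (block_event X S j m x) \<le> \<delta>)"

lemma (in prob_space) block_mixing:
  assumes stat: "stationary_process M Z" and gauss: "gaussian_process M Z"
    and zero_mean: "\<And>n. expectation (Z n) = 0" and var: "\<And>n. variance (Z n) = 1"
    and f: "is_spectral_density f (\<lambda>n. covariance M (Z n) (Z 0))"
    and ff0: "\<And>l. l \<in> circ \<Longrightarrow> f l = frac_density d l * f0 l"
    and d: "0 < d" "d < 1 / 2"
    and f0: "is_spectral_density f0 \<gamma>0" and inf: "(INF l\<in>circ. f0 l) > 0"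
    and summ: "(\<lambda>n. \<bar>\<gamma>0 n\<bar>) summable_on UNIV"
    and G: "G \<in> borel_measurable borel" and X: "\<And>n w. X n w = G (Z n w)"
    and \<delta>: "0 < \<delta>"
  shows "\<exists>K. mixing_gap X \<delta> K"
proof -
  interpret gaussian_space M "process_span Z"
    by (rule gaussian_space_process_span[OF gauss zero_mean var])
  have f0i: "set_integrable lborel circ f0" and f0nn: "\<And>l. l \<in> circ \<Longrightarrow> 0 \<le> f0 l"
    using f0 unfolding is_spectral_density_def by auto
  define c where "c = (INF l\<in>circ. f0 l)"
  \<comment> \<open>The infimum is a genuine lower bound because \<open>f0\<close>, being a spectral
    density, is bounded below by 0.\<close>
  have c: "0 < c" "c \<le> f0 l" if "l \<in> circ" for l
    using inf that f0nn by (auto simp: c_def intro!: cINF_lower bdd_belowI2[where m=0])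
  have c0: "0 < c" using inf by (simp add: c_def)
  have fi: "set_integrable lborel circ (\<lambda>l. frac_density d l * f0 l)"
  proof -
    have "set_integrable lborel circ f" using f unfolding is_spectral_density_def by blast
    also have "?this \<longleftrightarrow> set_integrable lborel circ (\<lambda>l. frac_density d l * f0 l)"
      by (rule set_integrable_cong) (auto simp: ff0)
    finally show ?thesis .
  qed
  define \<gamma> where "\<gamma> = frac_acf d f0"
  have "fourier_cos f n = \<gamma> n" for n
    unfolding \<gamma>_def fourier_cos_def by (intro set_lebesgue_integral_cong) (auto simp: ff0)
  \<comment> \<open>\<open>stationary_covariance\<close> produces the lag \<open>i - j\<close>,
    \<open>toeplitz_form\<close> needs \<open>j - i\<close>; cosine coefficients are even.\<close>
  then have cov: "ip (Z i) (Z j) = \<gamma> (j - i)" for i j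
    using stationary_covariance[OF stat zero_mean, of i j] spectral_density_fourier_cos[OF f, of "i - j"]
      fourier_cos_uminus[of f "i - j"] by simp
  have summ': "(\<lambda>n. \<bar>fourier_cos f0 n\<bar>) summable_on UNIV"
    using summ spectral_density_fourier_cos[OF f0] by simp
  have half: "0 < \<delta> / 2" using \<delta> by simp
  have "\<exists>K::nat. \<forall>m\<ge>2. \<forall>k\<ge>K * m. \<forall>a b.
      \<bar>toeplitz_form \<gamma> (int k) m a b\<bar> \<le> \<delta> / 2 * (toeplitz_form \<gamma> 0 m a a + toeplitz_form \<gamma> 0 m b b)"
    unfolding \<gamma>_def by (rule block_covariance_le[OF d f0i fi c0 c(2) summ' half])
  then obtain K :: nat where "\<forall>m\<ge>2. \<forall>k\<ge>K * m. \<forall>a b.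
      \<bar>toeplitz_form \<gamma> (int k) m a b\<bar> \<le> \<delta> / 2 * (toeplitz_form \<gamma> 0 m a a + toeplitz_form \<gamma> 0 m b b)" ..
  then have K: "\<bar>toeplitz_form \<gamma> (int k) m a b\<bar> \<le> \<delta> / 2 * (toeplitz_form \<gamma> 0 m a a + toeplitz_form \<gamma> 0 m b b)"
    if "2 \<le> m" "K * m \<le> k" for m k a b using that by blast
  show ?thesis
    unfolding mixing_gap_def
  proof (intro exI[of _ K] allI impI)
    fix m i j :: nat and S :: "(nat \<Rightarrow> real) \<Rightarrow> real" and x :: real
    assume m: "2 \<le> m" and S: "S \<in> borel_measurable (\<Pi>\<^sub>M j\<in>{1..m}. borel)" and ij: "i + K * m \<le> j"
    define k where "k = j - i"
    have k: "K * m \<le> k" "int j = int i + int k" using ij by (auto simp: k_def)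
    have ev: "block_event X S i' m x \<in> gaussian_subspace.trig_sets M (block_span Z (int i') m)" for i'
    proof -
      interpret B: gaussian_subspace M "process_span Z" "block_span Z (int i') m"
        by standard (auto simp: linear_space_block_span block_span_subset[THEN subsetD])
      show ?thesis
        by (intro B.block_event_trig_sets[where G = G and Z = Z] G X S in_block_span)
    qed
    have "prob (block_event X S i m x \<inter> block_event X S j m x)
      - prob (block_event X S i m x) * prob (block_event X S j m x) \<le> 2 * (\<delta> / 2)"
    proof (rule gebelein_blocks[where Z = Z and \<gamma> = \<gamma> and i = "int i" and k = "int k" and m = m])
      show "block_event X S j m x \<in> gaussian_subspace.trig_sets M (block_span Z (int i + int k) m)"
        using ev[of j] k(2) by simp
      show "0 \<le> \<delta> / 2" using \<delta> by simp
    qed (rule in_process_span cov block_span_subset K[OF m k(1)] ev)+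
    then show "prob (block_event X S i m x \<inter> block_event X S j m x)
      - prob (block_event X S i m x) * prob (block_event X S j m x) \<le> \<delta>" by simp
  qed
qed

text \<open>Chebyshev's inequality. In each row of the double sum for the variance at most
  \<open>2 * D\<close> pairs are close, costing at most 1 each on top of the \<open>\<rho>\<close>
  allowed for every pair.\<close>

lemma (in prob_space) average_indicator_deviation:
  fixes A :: "nat \<Rightarrow> 'a set"
  assumes L: "1 \<le> L" and A[measurable]: "\<And>i. A i \<in> events" and p: "\<And>i. prob (A i) = p"
    and mix: "\<And>i j. i + D \<le> j \<Longrightarrow> prob (A i \<inter> A j) - p * p \<le> \<rho>" and \<rho>: "0 \<le> \<rho>" and \<eta>: "0 < \<eta>"
  shows "prob {w \<in> space M. \<eta> \<le> \<bar>(\<Sum>i=1..L. indicator (A i) w) / real L - p\<bar>} \<le> (2 * real D / real L + \<rho>) / \<eta>\<^sup>2"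
proof -
  define Y where "Y = (\<lambda>w. (\<Sum>i=1..L. indicator (A i) w) / real L :: real)"
  have [measurable]: "Y \<in> borel_measurable M" unfolding Y_def by measurable
  have Ai: "integrable M (indicat_real (A i))" for i
    by (intro integrable_const_bound[where B=1]) (auto simp: indicator_def)
  have EY: "expectation Y = p"
  proof -
    have "expectation (\<lambda>w. \<Sum>i=1..L. indicator (A i) w) = (\<Sum>i=1..L. prob (A i))"
      by (subst Bochner_Integration.integral_sum) (auto simp: Ai)
    then show ?thesis using L unfolding Y_def by (simp add: p)
  qed
  have Yb: "\<bar>Y w\<bar> \<le> 1" for w
  proof -
    have "(\<Sum>i=1..L. indicator (A i) w :: real) \<le> (\<Sum>i=1..L. 1)" by (intro sum_mono) (simp add: indicator_def)
    then show ?thesis using L unfolding Y_def by (simp add: sum_nonneg divide_le_eq abs_le_iff)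
  qed
  have Y2: "integrable M (\<lambda>w. (Y w)\<^sup>2)"
    using Yb by (intro integrable_const_bound[where B=1]) (auto simp: abs_square_le_1)
  have cov: "prob (A i \<inter> A j) - p * p \<le> \<rho> + of_bool (i < j + D \<and> j < i + D)" for i j
  proof -
    have "prob (A i \<inter> A j) - p * p \<le> 1"
      using prob_le_1[of "A i \<inter> A j"] zero_le_square[of p] by linarith
    moreover have "prob (A i \<inter> A j) - p * p \<le> \<rho>" if "\<not> (i < j + D \<and> j < i + D)"
      using mix[of i j] mix[of j i] that by (auto simp: Int_commute not_less)
    ultimately show ?thesis using \<rho> by (cases "i < j + D \<and> j < i + D") auto
  qed
  have count: "(\<Sum>j=1..L. of_bool (i < j + D \<and> j < i + D) :: real) \<le> 2 * real D" for i
  proof -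
    have "(\<Sum>j=1..L. of_bool (i < j + D \<and> j < i + D) :: real) = real (card {j\<in>{1..L}. i < j + D \<and> j < i + D})"
      by (simp add: of_bool_def sum.If_cases Int_def)
    \<comment> \<open>Truncated subtraction can only make this interval shorter than
      \<open>2 * D\<close>.\<close>
    also have "\<dots> \<le> real (card {i - D..<i + D})" by (intro of_nat_mono card_mono) auto
    also have "\<dots> \<le> 2 * real D" by simp
    finally show ?thesis .
  qed
  have ind: "expectation (\<lambda>w. (indicator (A i) w - p) * (indicator (A j) w - p)) = prob (A i \<inter> A j) - p * p"
    and indi: "integrable M (\<lambda>w. (indicator (A i) w - p) * (indicator (A j) w - p))" for i j
  proof -
    have eq: "(indicator (A i) w - p) * (indicator (A j) w - p)
      = indicator (A i \<inter> A j) w - p * indicator (A i) w - p * indicator (A j) w + p * p" for w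
      by (simp add: indicator_inter_arith algebra_simps)
    have Aij: "integrable M (indicat_real (A i \<inter> A j))"
      by (intro integrable_const_bound[where B=1]) (auto simp: indicator_def)
    show "expectation (\<lambda>w. (indicator (A i) w - p) * (indicator (A j) w - p)) = prob (A i \<inter> A j) - p * p"
      unfolding eq using Ai Aij by (simp add: p prob_space)
    show "integrable M (\<lambda>w. (indicator (A i) w - p) * (indicator (A j) w - p))"
      unfolding eq using Ai Aij by simp
  qed
  have "variance Y = expectation (\<lambda>w. \<Sum>i=1..L. \<Sum>j=1..L. (indicator (A i) w - p) * (indicator (A j) w - p) / (real L)\<^sup>2)"
  proof -
    have "(Y w - p)\<^sup>2 = (\<Sum>i=1..L. \<Sum>j=1..L. (indicator (A i) w - p) * (indicator (A j) w - p) / (real L)\<^sup>2)" for w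
    proof -
      have "Y w - p = (\<Sum>i=1..L. indicator (A i) w - p) / real L"
        using L by (simp add: Y_def sum_subtractf diff_divide_distrib)
      then show ?thesis by (simp add: power2_eq_square sum_product sum_divide_distrib)
    qed
    then show ?thesis by (simp add: EY)
  qed
  also have "\<dots> = (\<Sum>i=1..L. expectation (\<lambda>w. \<Sum>j=1..L. (indicator (A i) w - p) * (indicator (A j) w - p) / (real L)\<^sup>2))"
    by (intro Bochner_Integration.integral_sum Bochner_Integration.integrable_sum integrable_divide indi)
  also have "\<dots> = (\<Sum>i=1..L. \<Sum>j=1..L. expectation (\<lambda>w. (indicator (A i) w - p) * (indicator (A j) w - p) / (real L)\<^sup>2))"
    by (intro sum.cong refl Bochner_Integration.integral_sum integrable_divide indi)
  also have "\<dots> = (\<Sum>i=1..L. \<Sum>j=1..L. prob (A i \<inter> A j) - p * p) / (real L)\<^sup>2"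
    by (simp add: ind sum_divide_distrib)
  also have "\<dots> \<le> (\<Sum>i=1..L. \<Sum>j=1..L. \<rho> + of_bool (i < j + D \<and> j < i + D)) / (real L)\<^sup>2"
    by (intro divide_right_mono sum_mono cov) simp
  also have "\<dots> \<le> (\<Sum>i=1..L. real L * \<rho> + 2 * real D) / (real L)\<^sup>2"
    using count by (intro divide_right_mono sum_mono) (auto simp: sum.distrib simp del: of_bool_conj)
  also have "\<dots> = 2 * real D / real L + \<rho>"
    using L by (simp add: power2_eq_square field_simps)
  finally have var: "variance Y \<le> 2 * real D / real L + \<rho>" .
  have "prob {w \<in> space M. \<eta> \<le> \<bar>Y w - p\<bar>} \<le> variance Y / \<eta>\<^sup>2"
    using Chebyshev_inequality[of Y \<eta>] Y2 \<eta> EY by simp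
  also have "\<dots> \<le> (2 * real D / real L + \<rho>) / \<eta>\<^sup>2"
    using var by (intro divide_right_mono) auto
  finally show ?thesis unfolding Y_def .
qed

lemma eventually_block_ratio_le:
  fixes b :: "nat \<Rightarrow> nat"
  assumes b: "(\<lambda>n. real (b n)) \<in> o(\<lambda>n. real n)" and \<epsilon>: "0 < \<epsilon>"
  shows "\<forall>\<^sub>F n in sequentially. b n \<le> n \<and> real (b n) / real (n - b n + 1) \<le> \<epsilon>"
proof -
  \<comment> \<open>The \<open>1 / 2\<close> makes the number of blocks at least
    \<open>n / 2\<close>; \<open>\<epsilon> / 2\<close> compensates for that factor.\<close>
  define c where "c = min (1 / 2) (\<epsilon> / 2)"
  have c: "0 < c" "c \<le> 1 / 2" "c \<le> \<epsilon> / 2" using \<epsilon> by (auto simp: c_def)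
  from landau_o.smallD[OF b c(1)] have "\<forall>\<^sub>F n in sequentially. real (b n) \<le> c * real n" by simp
  then show ?thesis
  proof eventually_elim
    case (elim n)
    have half: "c * real n \<le> 1 / 2 * real n" using c by (intro mult_right_mono) auto
    then have bn: "2 * real (b n) \<le> real n" using elim by simp
    then have le: "b n \<le> n" by linarith
    have "real (b n) \<le> \<epsilon> / 2 * real n"
      using elim c(3) mult_right_mono[of c "\<epsilon> / 2" "real n"] by simp
    also have "\<dots> \<le> \<epsilon> * real (n - b n + 1)"
    proof -
      have "real n / 2 \<le> real (n - b n + 1)" using bn le by (simp add: of_nat_diff)
      then have "\<epsilon> * (real n / 2) \<le> \<epsilon> * real (n - b n + 1)" using \<epsilon> by (intro mult_left_mono) auto
      then show ?thesis by simp
    qed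
    finally show ?case using le by (simp add: divide_le_eq)
  qed
qed

section \<open>Consistency of subsampling\<close>

text \<open>Half of \<open>\<eta>\<close> is spent on the bias \<open>p (b n) - q\<close>, half on
  the fluctuation around \<open>p (b n)\<close>. Pairs of blocks closer than \<open>K * b n\<close>
  are a vanishing fraction of all pairs, because \<open>b n\<close> is small against the number of
  blocks.\<close>

lemma (in prob_space) subsample_average_tendsto:
  fixes S :: "nat \<Rightarrow> (nat \<Rightarrow> real) \<Rightarrow> real" and b :: "nat \<Rightarrow> nat"
  assumes stat: "stationary_process M Z" and G: "G \<in> borel_measurable borel" and X: "\<And>n w. X n w = G (Z n w)"
    and S: "\<And>m. 1 \<le> m \<Longrightarrow> S m \<in> borel_measurable (\<Pi>\<^sub>M j\<in>{1..m}. borel)"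
    and mixing: "\<And>\<delta>. 0 < \<delta> \<Longrightarrow> \<exists>K. mixing_gap X \<delta> K"
    and b: "filterlim b at_top sequentially" "(\<lambda>n. real (b n)) \<in> o(\<lambda>n. real n)"
    and lim: "(\<lambda>m. prob {w \<in> space M. S m (block X 1 m w) \<le> y}) \<longlonglongrightarrow> q" and \<eta>: "0 < \<eta>"
  shows "(\<lambda>n. prob {w \<in> space M. \<eta> < \<bar>(\<Sum>i=1..n - b n + 1. of_bool (S (b n) (block X i (b n) w) \<le> y)) / real (n - b n + 1) - q\<bar>}) \<longlonglongrightarrow> 0"
proof (rule tendstoI)
  fix e :: real assume e: "0 < e"
  \<comment> \<open>Makes the Chebyshev bound
    \<open>(\<rho> + \<rho>) / (\<eta> / 2)\<^sup>2\<close> equal to \<open>e / 2\<close>: one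
    \<open>\<rho>\<close> for the close pairs, one for the distant pairs.\<close>
  define \<rho> where "\<rho> = e / 4 * (\<eta> / 2)\<^sup>2"
  have \<rho>: "0 < \<rho>" using e \<eta> by (simp add: \<rho>_def)
  obtain K where K: "mixing_gap X \<rho> K" using mixing[OF \<rho>] ..
  have Zm: "Z n \<in> borel_measurable M" for n using stat unfolding stationary_process_def by blast
  define A where "A = (\<lambda>n i. {w \<in> space M. S (b n) (block X i (b n) w) \<le> y})"
  define p where "p = (\<lambda>m. prob {w \<in> space M. S m (block X 1 m w) \<le> y})"
  have "\<forall>\<^sub>F n in sequentially. \<bar>p (b n) - q\<bar> < \<eta> / 2"
    using tendstoD[OF filterlim_compose[OF lim b(1)], of "\<eta> / 2"] \<eta> by (simp add: p_def dist_real_def)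
  moreover have "\<forall>\<^sub>F n in sequentially. 2 \<le> b n"
    using b(1) by (simp add: filterlim_at_top)
  moreover have "\<forall>\<^sub>F n in sequentially. b n \<le> n \<and> real (b n) / real (n - b n + 1) \<le> \<rho> / (2 * (real K + 1))"
    using \<rho> by (intro eventually_block_ratio_le[OF b(2)]) auto
  ultimately have "\<forall>\<^sub>F n in sequentially. prob {w \<in> space M. \<eta> < \<bar>(\<Sum>i=1..n - b n + 1. of_bool (S (b n) (block X i (b n) w) \<le> y)) / real (n - b n + 1) - q\<bar>} \<le> e / 2"
  proof eventually_elim
    case (elim n)
    define L where "L = n - b n + 1"
    let ?avg = "\<lambda>w. (\<Sum>i=1..L. of_bool (S (b n) (block X i (b n) w) \<le> y)) / real L"
    let ?B = "{w \<in> space M. \<eta> / 2 \<le> \<bar>(\<Sum>i=1..L. indicator (A n i) w) / real L - p (b n)\<bar>}"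
    have meas: "(\<lambda>w. S (b n) (block X i (b n) w)) \<in> borel_measurable M" for i
    proof -
      have [measurable]: "block X i (b n) \<in> measurable M (\<Pi>\<^sub>M j\<in>{1..b n}. borel)"
        by (rule measurable_block[where G = G and Z = Z]) (use G X Zm in auto)
      have [measurable]: "S (b n) \<in> borel_measurable (\<Pi>\<^sub>M j\<in>{1..b n}. borel)" using S elim by simp
      show ?thesis by measurable
    qed
    have Am: "A n i \<in> events" for i using meas[of i] unfolding A_def by measurable
    have pA: "prob (A n i) = p (b n)" for i
    proof -
      have "measure (distr M borel (\<lambda>w. S (b n) (block X i (b n) w))) {..y}
        = measure (distr M borel (\<lambda>w. S (b n) (block X 1 (b n) w))) {..y}"
        using stationary_block_distr[OF stat G X, of "S (b n)" "b n" i] S elim by simp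
      then show ?thesis
        by (simp add: measure_distr meas A_def p_def vimage_def Int_def conj_commute)
    qed
    have "prob ?B
      \<le> (2 * real (K * b n) / real L + \<rho>) / (\<eta> / 2)\<^sup>2"
    proof (rule average_indicator_deviation[OF _ Am pA])
      fix i j assume "i + K * b n \<le> j"
      then have "prob (A n i \<inter> A n j) - prob (A n i) * prob (A n j) \<le> \<rho>"
        using K S[of "b n"] elim unfolding A_def mixing_gap_def by auto
      then show "prob (A n i \<inter> A n j) - p (b n) * p (b n) \<le> \<rho>" by (simp add: pA)
    qed (use \<rho> \<eta> in \<open>auto simp: L_def\<close>)
    also have "\<dots> \<le> (\<rho> + \<rho>) / (\<eta> / 2)\<^sup>2"
    proof (intro divide_right_mono add_mono order_refl)
      have "2 * real (K * b n) / real L = 2 * real K * (real (b n) / real L)" by simp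
      also have "\<dots> \<le> 2 * real K * (\<rho> / (2 * (real K + 1)))"
        using elim unfolding L_def by (intro mult_left_mono) auto
      also have "\<dots> = (real K / (real K + 1)) * \<rho>" by (simp add: field_simps)
      also have "\<dots> \<le> 1 * \<rho>" using \<rho> by (intro mult_right_mono) (auto simp: divide_le_eq)
      finally show "2 * real (K * b n) / real L \<le> \<rho>" by simp
    qed simp
    also have "\<dots> = e / 2" using \<eta> by (simp add: \<rho>_def)
    finally have bound: "prob ?B \<le> e / 2" .
    have ind: "(\<Sum>i=1..L. indicator (A n i) w) = (\<Sum>i=1..L. of_bool (S (b n) (block X i (b n) w) \<le> y) :: real)" if "w \<in> space M" for w
      using that by (simp add: A_def indicator_def)
    have "prob {w \<in> space M. \<eta> < \<bar>?avg w - q\<bar>}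
      \<le> prob ?B"
    proof (rule finite_measure_mono)
      show "{w \<in> space M. \<eta> < \<bar>?avg w - q\<bar>}
        \<subseteq> ?B"
      proof
        fix w assume w: "w \<in> {w \<in> space M. \<eta> < \<bar>?avg w - q\<bar>}"
        then have "w \<in> space M" by blast
        moreover from this w have "\<eta> < \<bar>(\<Sum>i=1..L. indicator (A n i) w) / real L - q\<bar>"
          unfolding ind[OF \<open>w \<in> space M\<close>] by blast
        then have "\<eta> / 2 \<le> \<bar>(\<Sum>i=1..L. indicator (A n i) w) / real L - p (b n)\<bar>"
          using elim(1) by linarith
        ultimately show "w \<in> ?B"
          by blast
      qed
      show "?B \<in> events"
        using Am by measurable
    qed
    with bound show ?case unfolding L_def by simp
  qed
  then show "\<forall>\<^sub>F n in sequentially. dist (prob {w \<in> space M. \<eta> < \<bar>(\<Sum>i=1..n - b n + 1. of_bool (S (b n) (block X i (b n) w) \<le> y)) / real (n - b n + 1) - q\<bar>}) 0 < e"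
  proof (rule eventually_mono)
    have "dist z 0 < e" if "z \<le> e / 2" "0 \<le> z" for z :: real
      using that e by (simp add: dist_real_def)
    then show "dist (prob {w \<in> space M. P n w}) 0 < e" if "prob {w \<in> space M. P n w} \<le> e / 2" for P n
      using that measure_nonneg by blast
  qed
qed

text \<open>A monotone function has countably many discontinuities, so all but countably many
  \<open>e\<close> make both \<open>x - e\<close> and \<open>x + e\<close> continuity points. Both
  are wanted at once because the comparison of the subsampling distribution functions uses the same
  shift on either side.\<close>

lemma cdf_continuity_points_near:
  fixes F :: "real \<Rightarrow> real"
  assumes mono: "mono F" and x: "isCont F x" and \<epsilon>: "0 < \<epsilon>"
  obtains e where "0 < e" "isCont F (x - e)" "isCont F (x + e)" "F x - \<epsilon> < F (x - e)" "F (x + e) < F x + \<epsilon>"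
proof -
  obtain s where s: "0 < s" "\<And>y. \<bar>y - x\<bar> < s \<Longrightarrow> \<bar>F y - F x\<bar> < \<epsilon>"
    using x \<epsilon> unfolding continuous_at_eps_delta by (auto simp: dist_real_def)
  define C where "C = {a. \<not> isCont F a}"
  have "countable C" unfolding C_def by (rule mono_ctble_discont[OF mono])
  then have "countable ((\<lambda>a. x - a) ` C \<union> (\<lambda>a. a - x) ` C)" by simp
  moreover have "uncountable {0<..<s}" using s by (simp add: uncountable_open_interval)
  ultimately have "\<not> {0<..<s} \<subseteq> (\<lambda>a. x - a) ` C \<union> (\<lambda>a. a - x) ` C"
    using countable_subset by meson
  then obtain e where e: "e \<in> {0<..<s}" "e \<notin> (\<lambda>a. x - a) ` C \<union> (\<lambda>a. a - x) ` C"
    by blast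
  have "x - e \<notin> C" "x + e \<notin> C" using e(2) by force+
  then show ?thesis
    using that[of e] e(1) s(2)[of "x - e"] s(2)[of "x + e"] by (auto simp: C_def abs_less_iff)
qed

theorem theorem4p1:
  fixes M :: "'a measure" and N :: "'c measure"
    and Z X :: "int \<Rightarrow> 'a \<Rightarrow> real" and G :: "real \<Rightarrow> real"
    and f f\<^sub>0 :: "real \<Rightarrow> real" and \<gamma>\<^sub>0 :: "int \<Rightarrow> real" and d :: real
    and T :: "nat \<Rightarrow> (nat \<Rightarrow> real) \<Rightarrow> 'p::metric_space \<Rightarrow> real"
    and \<theta> :: 'p and \<theta>hat :: "nat \<Rightarrow> (nat \<Rightarrow> real) \<Rightarrow> 'p"
    and T_lim :: "'c \<Rightarrow> real" and F_T :: "real \<Rightarrow> real" and F_Tn :: "nat \<Rightarrow> real \<Rightarrow> real"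
    and Fstar Fhat :: "nat \<Rightarrow> real \<Rightarrow> 'a \<Rightarrow> real"
    and b :: "nat \<Rightarrow> nat"
  assumes "prob_space M"
    \<comment> \<open>statistic, estimator, block size\<close>
    and "\<And>n. n \<ge> 1 \<Longrightarrow> (\<lambda>x. T n x \<theta>) \<in> borel_measurable (\<Pi>\<^sub>M j\<in>{1..n}. borel)"
    and "\<And>n. n \<ge> 1 \<Longrightarrow> \<theta>hat n \<in> borel_measurable (\<Pi>\<^sub>M j\<in>{1..n}. borel)"
    and "\<And>n i. 1 \<le> i \<Longrightarrow> i + b n \<le> n + 1 \<Longrightarrow>
           (\<lambda>\<omega>. T (b n) (block X i (b n) \<omega>) (\<theta>hat n (block X 1 n \<omega>))) \<in> borel_measurable M"
    and "tendsto_in_prob M (\<lambda>n \<omega>. \<theta>hat n (block X 1 n \<omega>)) \<theta>"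
    and "\<And>n. b n \<ge> 1"
    and "\<And>n x. F_Tn n x = cdf (distr M borel (\<lambda>\<omega>. T n (block X 1 n \<omega>) \<theta>)) x"
    and "\<And>n x \<omega>. Fstar n x \<omega> = subsample_cdf T X n (b n) \<theta> x \<omega>"
    and "\<And>n x \<omega>. Fhat n x \<omega> = subsample_cdf T X n (b n) (\<theta>hat n (block X 1 n \<omega>)) x \<omega>"
    \<comment> \<open>the underlying Gaussian process\<close>
    and "G \<in> borel_measurable borel"
    and "\<And>n \<omega>. X n \<omega> = G (Z n \<omega>)"
    and "stationary_process M Z" and "gaussian_process M Z"
    and "\<And>n. prob_space.expectation M (Z n) = 0"
    and "\<And>n. prob_space.variance M (Z n) = 1"
    and "\<And>m. m \<ge> 1 \<Longrightarrow>
           invertible_mat (mat m m (\<lambda>(i, j). covariance M (Z (int i + 1)) (Z (int j + 1))))"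
    and "is_spectral_density f (\<lambda>n. covariance M (Z n) (Z 0))"
    and "\<And>l. l \<in> {-pi<..pi} \<Longrightarrow> f l = frac_density d l * f\<^sub>0 l"
    and "0 < d" and "d < 1/2"
    and "is_spectral_density f\<^sub>0 \<gamma>\<^sub>0"
    and "(INF l\<in>{-pi<..pi}. f\<^sub>0 l) > 0"
    and "(\<lambda>n. \<bar>\<gamma>\<^sub>0 n\<bar>) summable_on UNIV"
    and "(\<lambda>n::nat. \<gamma>\<^sub>0 (int n)) \<in> O(\<lambda>n. 1 / real n)"
    \<comment> \<open>convergence in distribution of the statistic\<close>
    and "prob_space N" and "T_lim \<in> borel_measurable N"
    and "\<And>x. F_T x = cdf (distr N borel T_lim) x"
    and "weak_conv_m (\<lambda>n. distr M borel (\<lambda>\<omega>. T n (block X 1 n \<omega>) \<theta>)) (distr N borel T_lim)"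
    \<comment> \<open>comparison of the two subsampling distribution functions\<close>
    and "\<And>x \<epsilon> \<delta>. isCont F_T x \<Longrightarrow> \<epsilon> > 0 \<Longrightarrow> \<delta> > 0 \<Longrightarrow>
           (\<lambda>n. measure M {\<omega> \<in> space M.
              Fstar n (x - \<epsilon>) \<omega> - \<delta> \<le> Fhat n x \<omega> \<and> Fhat n x \<omega> \<le> Fstar n (x + \<epsilon>) \<omega> + \<delta>})
           \<longlonglongrightarrow> 1"
    \<comment> \<open>growth of the block size\<close>
    and "filterlim b at_top sequentially"
    and "(\<lambda>n. real (b n)) \<in> o(\<lambda>n. real n)"
  shows "\<forall>x. isCont F_T x \<longrightarrow>
           tendsto_in_prob M (\<lambda>n \<omega>. \<bar>F_Tn n x - Fhat n x \<omega>\<bar>) 0"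
proof (intro allI impI)
  interpret prob_space M by (rule assms(1))
  note S = assms(2) and Fstar = assms(8) and Fhat = assms(9) and G = assms(10) and X = assms(11)
    and stat = assms(12) and gauss = assms(13) and b_top = assms(30) and b_o = assms(31)
  fix x assume x: "isCont F_T x"
  have FT: "F_T = cdf (distr N borel T_lim)" using assms(27) by (simp add: fun_eq_iff)
  interpret N: prob_space N by (rule assms(25))
  interpret D: real_distribution "distr N borel T_lim"
    using N.real_distribution_distr assms(26) by blast
  have mono: "mono F_T" unfolding FT by (intro monoI D.cdf_nondecreasing)
  have meas: "(\<lambda>w. T m (block X i m w) \<theta>) \<in> borel_measurable M" if "1 \<le> m" for m i
  proof -
    have [measurable]: "block X i m \<in> measurable M (\<Pi>\<^sub>M j\<in>{1..m}. borel)"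
      by (rule measurable_block[where G = G and Z = Z]) (use G X stat in \<open>auto simp: stationary_process_def\<close>)
    have [measurable]: "(\<lambda>x. T m x \<theta>) \<in> borel_measurable (\<Pi>\<^sub>M j\<in>{1..m}. borel)" by (rule S[OF that])
    show ?thesis by measurable
  qed
  have Fn_lim: "(\<lambda>n. F_Tn n y) \<longlonglongrightarrow> F_T y" if "isCont F_T y" for y
    using assms(28) that unfolding weak_conv_m_def weak_conv_def FT assms(7) by blast
  have Fn_prob: "F_Tn n y = prob {w \<in> space M. T n (block X 1 n w) \<theta> \<le> y}" if "1 \<le> n" for n y
    using meas[OF that] by (simp add: assms(7) cdf_def measure_distr vimage_def Int_def conj_commute)
  have star: "(\<lambda>n. prob {w \<in> space M. \<eta> < \<bar>Fstar n y w - F_T y\<bar>}) \<longlonglongrightarrow> 0"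
    if y: "isCont F_T y" and \<eta>: "0 < \<eta>" for y \<eta>
    unfolding Fstar subsample_cdf_def
  proof (rule subsample_average_tendsto[OF stat G X, where S = "\<lambda>m z. T m z \<theta>"])
    \<comment> \<open>\<open>F_Tn\<close> is identified with a probability for sample sizes from 1
      on, where the statistic is assumed measurable; a limit ignores the rest.\<close>
    show "(\<lambda>m. prob {w \<in> space M. T m (block X 1 m w) \<theta> \<le> y}) \<longlonglongrightarrow> F_T y"
      by (rule Lim_transform_eventually[OF Fn_lim[OF y]])
        (use eventually_ge_at_top[of 1] in eventually_elim, simp add: Fn_prob)
  qed (use S b_top b_o \<eta> block_mixing[OF stat gauss assms(14,15,17,18,19,20,21,22,23) G X] in auto)
  show "tendsto_in_prob M (\<lambda>n w. \<bar>F_Tn n x - Fhat n x w\<bar>) 0"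
    unfolding tendsto_in_prob_def
  proof (intro allI impI)
    fix \<epsilon> :: real assume \<epsilon>: "0 < \<epsilon>"
    let ?E = "\<lambda>n. {w \<in> space M. \<epsilon> < dist \<bar>F_Tn n x - Fhat n x w\<bar> 0}"
    \<comment> \<open>Four errors of at most \<open>\<eta>\<close> each add up to at most
      \<open>\<epsilon> / 2\<close>: the slack in the comparison, the fluctuation of
      \<open>Fstar\<close>, the variation of \<open>F_T\<close> near \<open>x\<close>, and the
      convergence of \<open>F_Tn\<close>.\<close>
    define \<eta> where "\<eta> = \<epsilon> / 8"
    have \<eta>: "0 < \<eta>" using \<epsilon> by (simp add: \<eta>_def)
    obtain e where e: "0 < e" "isCont F_T (x - e)" "isCont F_T (x + e)" "F_T x - \<eta> < F_T (x - e)" "F_T (x + e) < F_T x + \<eta>"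
      by (rule cdf_continuity_points_near[OF mono x \<eta>])
    \<comment> \<open>The comparison hypothesis with shift \<open>e\<close> and slack
      \<open>\<eta>\<close>; \<open>star\<close> applies at both shifted points by the choice of
      \<open>e\<close>.\<close>
    define P where "P = (\<lambda>n. {w \<in> space M. Fstar n (x - e) w - \<eta> \<le> Fhat n x w \<and> Fhat n x w \<le> Fstar n (x + e) w + \<eta>})"
    define Q where "Q = (\<lambda>n y. {w \<in> space M. \<eta> < \<bar>Fstar n y w - F_T y\<bar>})"
    have P_lim: "(\<lambda>n. prob (P n)) \<longlonglongrightarrow> 1"
      unfolding P_def by (rule assms(29)[OF x e(1) \<eta>])
    have Q_lim: "(\<lambda>n. prob (Q n (x - e))) \<longlonglongrightarrow> 0" "(\<lambda>n. prob (Q n (x + e))) \<longlonglongrightarrow> 0"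
      unfolding Q_def by (rule star[OF e(2) \<eta>] star[OF e(3) \<eta>])+
    have one: "0 < (1::real)" by simp
    have bound: "\<forall>\<^sub>F n in sequentially. prob (?E n)
        \<le> (1 - prob (P n)) + prob (Q n (x - e)) + prob (Q n (x + e))"
      using tendstoD[OF Fn_lim[OF x] \<eta>] eventually_block_ratio_le[OF b_o one]
    proof eventually_elim
      case (elim n)
      \<comment> \<open>For \<open>b n \<le> n\<close> all blocks lie inside the sample, and the
        summands of \<open>Fhat\<close> are covered by the measurability assumption.\<close>
      have bn: "b n \<le> n" using elim by simp
      have star_meas[measurable]: "Fstar n y \<in> borel_measurable M" for y
      proof -
        have [measurable]: "(\<lambda>w. T (b n) (block X i (b n) w) \<theta>) \<in> borel_measurable M" for i
          by (rule meas[OF assms(6)])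
        have "(\<lambda>w. subsample_cdf T X n (b n) \<theta> y w) \<in> borel_measurable M"
          unfolding subsample_cdf_def of_bool_def by measurable
        then show ?thesis by (simp add: Fstar[abs_def])
      qed
      have hat_meas[measurable]: "Fhat n x \<in> borel_measurable M"
      proof -
        let ?T = "\<lambda>i w. T (b n) (block X i (b n) w) (\<theta>hat n (block X 1 n w))"
        have "(\<lambda>w. (\<Sum>i=1..n - b n + 1. of_bool (?T i w \<le> x)) / real (n - b n + 1))
            \<in> borel_measurable M"
        proof (intro borel_measurable_divide borel_measurable_sum borel_measurable_const)
          fix i assume i: "i \<in> {1..n - b n + 1}"
          then have [measurable]: "(\<lambda>w. ?T i w) \<in> borel_measurable M"
            using bn by (intro assms(4)) auto
          show "(\<lambda>w. of_bool (?T i w \<le> x)) \<in> borel_measurable M"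
            unfolding of_bool_def by measurable
        qed
        then show ?thesis by (simp add: Fhat[abs_def] subsample_cdf_def)
      qed
      have Pm: "P n \<in> events" unfolding P_def by measurable
      have Qm: "Q n y \<in> events" for y unfolding Q_def by measurable
      have "?E n \<subseteq> ((space M - P n) \<union> Q n (x - e)) \<union> Q n (x + e)"
      proof (rule subsetI, rule ccontr)
        fix w assume w: "w \<in> ?E n"
          and n: "w \<notin> ((space M - P n) \<union> Q n (x - e)) \<union> Q n (x + e)"
        have "Fstar n (x - e) w - \<eta> \<le> Fhat n x w" "Fhat n x w \<le> Fstar n (x + e) w + \<eta>"
          "\<bar>Fstar n (x - e) w - F_T (x - e)\<bar> \<le> \<eta>" "\<bar>Fstar n (x + e) w - F_T (x + e)\<bar> \<le> \<eta>"
          using w n by (auto simp: P_def Q_def)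
        moreover have "\<bar>F_Tn n x - F_T x\<bar> < \<eta>" using elim by (simp add: dist_real_def)
        moreover have "\<epsilon> < \<bar>F_Tn n x - Fhat n x w\<bar>" using w by simp
        ultimately show False using e(4,5) \<eta> \<eta>_def by linarith
      qed
      then have "prob (?E n)
          \<le> prob (((space M - P n) \<union> Q n (x - e)) \<union> Q n (x + e))"
        using Pm Qm by (intro finite_measure_mono) auto
      also have "\<dots> \<le> prob ((space M - P n) \<union> Q n (x - e)) + prob (Q n (x + e))"
        using Pm Qm by (intro measure_Un_le) auto
      also have "\<dots> \<le> prob (space M - P n) + prob (Q n (x - e)) + prob (Q n (x + e))"
        using Pm Qm by (intro add_right_mono measure_Un_le) auto
      also have "prob (space M - P n) = 1 - prob (P n)" by (rule prob_compl[OF Pm])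
      finally show ?case .
    qed
    have "(\<lambda>n. (1 - prob (P n)) + prob (Q n (x - e)) + prob (Q n (x + e))) \<longlonglongrightarrow> (1 - 1) + 0 + 0"
      by (intro tendsto_intros P_lim Q_lim)
    then show "(\<lambda>n. prob (?E n)) \<longlonglongrightarrow> 0"
      by (intro tendsto_sandwich[OF _ bound tendsto_const]) auto
  qed
qed

end
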